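(* Let $0<L<\infty$, $A=[-L,L]$ with the endpoints $\pm L$ identified, and let $\sigma,\mu:A\to\mathbb{R}$ be periodic functions with $\sigma(x)>0$ for all $x\in A$. Suppose that $\sigma^2$ and $\mu$ are uniformly continuous on $A$. Let $\rho$ be a non-decreasing function with $\lim_{d\downarrow0}\rho(d)=0$ such that, for some constant $c_0>0$ and for both $\phi=\sigma^2$ and $\phi=\mu$, $$|\phi(x)-\phi(y)|\le c_0\,\rho(d(x,y))\qquad\text{for all }x,y\in A.$$ Let $t>0$. Then there is a constant $c>0$ such that for all $m'\ge m\ge m_0$ and all $x,y\in A_m$ the following hold: (i) $$|u_m(x,y;t)-u_{m'}(x,y;t)|\le c\,\rho(h_m);$$ (ii) $$|\partial_t u_m(x,y;t)-\partial_t u_{m'}(x,y;t)| = |\mathcal{L}^{m*}_y u_m(x,y;t)-\mathcal{L}^{m'*}_y u_{m'}(x,y;t)| = |\mathcal{L}^{m}_x u_m(x,y;t)-\mathcal{L}^{m'}_x u_{m'}(x,y;t)|\le c\,\rho(h_m).$$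
   Context: Periodic boundary conditions are assumed throughout: $-L$ and $L$ are identified, and all functions are $2L$-periodic. The distance is $d(x,y)=\min_{n\in\mathbb{Z}}|x-y-2Ln|$. For $m\in\{0,1,2,\dots\}$ let $h_m=L2^{-m}$ and $A_m=h_m\mathbb{Z}\cap A$ (with $\pm L$ identified, so $A_m$ has $2^{m+1}$ points, and $A_m\subset A_{m'}$ for $m'\ge m$). On periodic functions $f:A_m\to\mathbb{R}$ define $$\nabla^m_x f(x)=\frac{f(x+h_m)-f(x-h_m)}{2h_m},\qquad \Delta^m_x f(x)=\frac{f(x+h_m)+f(x-h_m)-2f(x)}{h_m^2},$$ $$\mathcal{L}^m_x=\frac{\sigma(x)^2}{2}\Delta^m_x+\mu(x)\nabla^m_x .$$ Write $\mathcal{L}^m(x,y)$, $x,y\in A_m$, for the matrix elements of this operator, i.e. $(\mathcal{L}^m_xf)(x)=\sum_{y\in A_m}\mathcal{L}^m(x,y)f(y)$, and let $\mathcal{L}^{m*}_y$ be the transposed operator acting on the $y$ variable, $(\mathcal{L}^{m*}_y\phi)(y)=\sum_{z\in A_m}\mathcal{L}^m(z,y)\phi(z)$. $m_0$ is the least integer such that $\frac{\sigma(x)^2}{2h_m^2}>\frac{|\mu(x)|}{2h_m}$ for all $m\ge m_0$ and all $x\in A_m$. The kernel $u_m(x,y;t)$, $x,y\in A_m$, is the solution of $\partial_t u_m(x,y;t)=\mathcal{L}^{m*}_y u_m(x,y;t)$ with $\lim_{t\downarrow0}u_m(x,y;t)=\delta_m(x-y)$, where $\delta_m(x-y)=1/h_m$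 if $x=y$ mod $2L$ and $0$ otherwise. Equivalently, $u_m(x,y;t)=\frac1{h_m}\exp(t\mathcal{L}^m)(x,y)$ (matrix exponential).
   Formalization: If σ² and μ are both constant, the formal theorem also assumes h_m² ≤ c₁ρ(h_m) for some c₁>0 and all m ≥ m₀; without this the claim fails, e.g. for σ=1, μ=0, ρ=0. *)

theory Defs
  imports "HOL-Analysis.Analysis" "HOL-Library.Real_Mod"
begin

text \<open>Functions on the circle of length \<open>2 * L\<close> are functions on the reals that are periodic
  with period \<open>2 * L\<close>.\<close>

definition circle_dist :: "real \<Rightarrow> real \<Rightarrow> real \<Rightarrow> real" where
  "circle_dist L x y = (INF n::int. \<bar>x - y - 2 * L * of_int n\<bar>)"

definition mesh :: "real \<Rightarrow> nat \<Rightarrow> real" where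
  "mesh L m = L / 2 ^ m"

definition lattice :: "real \<Rightarrow> nat \<Rightarrow> real set" where
  "lattice L m = range (\<lambda>k::int. of_int k * mesh L m)"

text \<open>The end points \<open>- L\<close> and \<open>L\<close> are the same point of the circle; the half-open interval picks
  one representative of each class, so that sums over the grid count every point once.\<close>

definition grid :: "real \<Rightarrow> nat \<Rightarrow> real set" where
  "grid L m = lattice L m \<inter> {-L..<L}"

definition nabla :: "real \<Rightarrow> nat \<Rightarrow> (real \<Rightarrow> real) \<Rightarrow> real \<Rightarrow> real" where
  "nabla L m f x = (f (x + mesh L m) - f (x - mesh L m)) / (2 * mesh L m)"

definition laplacian :: "real \<Rightarrow> nat \<Rightarrow> (real \<Rightarrow> real) \<Rightarrow> real \<Rightarrow> real" where
  "laplacian L m f x = (f (x + mesh L m) + f (x - mesh L m) - 2 * f x) / (mesh L m)\<^sup>2"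

definition gen :: "real \<Rightarrow> (real \<Rightarrow> real) \<Rightarrow> (real \<Rightarrow> real) \<Rightarrow> nat \<Rightarrow> (real \<Rightarrow> real) \<Rightarrow> real \<Rightarrow> real" where
  "gen L \<sigma> \<mu> m f x = (\<sigma> x)\<^sup>2 / 2 * laplacian L m f x + \<mu> x * nabla L m f x"

text \<open>The matrix element at \<open>(x, y)\<close> is the generator applied to the periodic indicator function
  of \<open>y\<close>, evaluated at \<open>x\<close>; see \<open>gen_eq_sum_gen_matrix\<close> below.\<close>

definition gen_matrix :: "real \<Rightarrow> (real \<Rightarrow> real) \<Rightarrow> (real \<Rightarrow> real) \<Rightarrow> nat \<Rightarrow> real \<Rightarrow> real \<Rightarrow> real" where
  "gen_matrix L \<sigma> \<mu> m x y = gen L \<sigma> \<mu> m (\<lambda>z. if [z = y] (rmod (2 * L)) then 1 else 0) x"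

definition gen_adj :: "real \<Rightarrow> (real \<Rightarrow> real) \<Rightarrow> (real \<Rightarrow> real) \<Rightarrow> nat \<Rightarrow> (real \<Rightarrow> real) \<Rightarrow> real \<Rightarrow> real" where
  "gen_adj L \<sigma> \<mu> m \<phi> y = (\<Sum>z\<in>grid L m. gen_matrix L \<sigma> \<mu> m z y * \<phi> z)"

definition min_level :: "real \<Rightarrow> (real \<Rightarrow> real) \<Rightarrow> (real \<Rightarrow> real) \<Rightarrow> nat" where
  "min_level L \<sigma> \<mu> = (LEAST k. \<forall>m\<ge>k. \<forall>x\<in>grid L m.
     (\<sigma> x)\<^sup>2 / (2 * (mesh L m)\<^sup>2) > \<bar>\<mu> x\<bar> / (2 * mesh L m))"

definition discrete_delta :: "real \<Rightarrow> nat \<Rightarrow> real \<Rightarrow> real \<Rightarrow> real" where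
  "discrete_delta L m x y = (if [x = y] (rmod (2 * L)) then 1 / mesh L m else 0)"

text \<open>\<open>v x y t\<close> is the periodic solution of the forward equation with discrete delta initial
  datum. It is determined on the lattice and for positive times; nothing is said elsewhere.\<close>

definition is_kernel ::
  "real \<Rightarrow> (real \<Rightarrow> real) \<Rightarrow> (real \<Rightarrow> real) \<Rightarrow> nat \<Rightarrow> (real \<Rightarrow> real \<Rightarrow> real \<Rightarrow> real) \<Rightarrow> bool" where
  "is_kernel L \<sigma> \<mu> m v \<longleftrightarrow>
     (\<forall>x\<in>lattice L m. \<forall>y\<in>lattice L m. \<forall>t>0.
        v (x + 2 * L) y t = v x y t \<and> v x (y + 2 * L) t = v x y t) \<and>
     (\<forall>x\<in>grid L m. \<forall>y\<in>grid L m.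
        (\<forall>t>0. ((\<lambda>s. v x y s) has_real_derivative gen_adj L \<sigma> \<mu> m (\<lambda>z. v x z t) y) (at t)) \<and>
        ((\<lambda>s. v x y s) \<longlongrightarrow> discrete_delta L m x y) (at_right 0))"

lemma mesh_pos: "0 < L \<Longrightarrow> 0 < mesh L m"
  by (simp add: mesh_def)

lemma grid_eq:
  assumes "0 < L"
  shows "grid L m = (\<lambda>k. of_int k * mesh L m) ` {-(2 ^ m)..<2 ^ m}"
proof -
  have "of_int k * mesh L m \<in> {-L..<L} \<longleftrightarrow> k \<in> {-(2 ^ m)..<2 ^ m}" for k :: int
  proof -
    have L: "L = 2 ^ m * mesh L m" by (simp add: mesh_def)
    have "-L \<le> of_int k * mesh L m \<longleftrightarrow> - (2 ^ m) * mesh L m \<le> real_of_int k * mesh L m"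
      using L by simp
    also have "\<dots> \<longleftrightarrow> - (2 ^ m) \<le> real_of_int k"
      using mesh_pos[OF assms] by (simp only: mult_le_cancel_right_pos)
    also have "\<dots> \<longleftrightarrow> real_of_int (- (2 ^ m)) \<le> real_of_int k" by simp
    also have "\<dots> \<longleftrightarrow> - (2 ^ m) \<le> k" by (simp only: of_int_le_iff)
    finally have 1: "-L \<le> of_int k * mesh L m \<longleftrightarrow> - (2 ^ m) \<le> k" .
    have "of_int k * mesh L m < L \<longleftrightarrow> real_of_int k * mesh L m < 2 ^ m * mesh L m"
      using L by simp
    also have "\<dots> \<longleftrightarrow> real_of_int k < 2 ^ m"
      using mesh_pos[OF assms] by (simp only: mult_less_cancel_right_pos)
    also have "\<dots> \<longleftrightarrow> real_of_int k < real_of_int (2 ^ m)" by simp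
    also have "\<dots> \<longleftrightarrow> k < 2 ^ m" by (simp only: of_int_less_iff)
    finally have 2: "of_int k * mesh L m < L \<longleftrightarrow> k < 2 ^ m" .
    from 1 2 show ?thesis by simp
  qed
  then show ?thesis unfolding grid_def lattice_def by blast
qed

lemma finite_grid: "0 < L \<Longrightarrow> finite (grid L m)"
  by (simp add: grid_eq)

lemma card_grid:
  assumes "0 < L"
  shows "card (grid L m) = 2 ^ (m + 1)"
proof -
  have "inj_on (\<lambda>k::int. of_int k * mesh L m) {-(2 ^ m)..<2 ^ m}"
    using mesh_pos[OF assms, of m] by (auto simp: inj_on_def)
  then have "card (grid L m) = card {-(2 ^ m)..<(2 ^ m :: int)}"
    by (simp add: grid_eq[OF assms] card_image)
  also have "\<dots> = nat (2 ^ (m + 1))" by simp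
  also have "\<dots> = 2 ^ (m + 1)" by (simp only: nat_power_eq) simp
  finally show ?thesis .
qed

lemma lattice_shift:
  "x \<in> lattice L m \<Longrightarrow> x + of_int n * (2 * L) \<in> lattice L m"
  unfolding lattice_def
proof (clarify, rule image_eqI)
  fix k :: int
  have "of_int n * (2 * L) = of_int (2 * n * 2 ^ m) * mesh L m" by (simp add: mesh_def)
  then show "of_int k * mesh L m + of_int n * (2 * L) = of_int (k + 2 * n * 2 ^ m) * mesh L m"
    by (simp add: algebra_simps)
qed simp

lemma periodic_of_int:
  fixes f :: "real \<Rightarrow> real"
  assumes per: "\<And>z. z \<in> lattice L m \<Longrightarrow> f (z + 2 * L) = f z" and x: "x \<in> lattice L m"
  shows "f (x + of_int n * (2 * L)) = f x"
proof (induction n rule: int_induct[where k = 0])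
  case base
  then show ?case by simp
next
  case (step1 i)
  have "f (x + of_int (i + 1) * (2 * L)) = f ((x + of_int i * (2 * L)) + 2 * L)"
    by (simp add: algebra_simps)
  then show ?case using per[OF lattice_shift[OF x, of i]] step1 by simp
next
  case (step2 i)
  have "f (x + of_int i * (2 * L)) = f ((x + of_int (i - 1) * (2 * L)) + 2 * L)"
    by (simp add: algebra_simps)
  then show ?case using per[OF lattice_shift[OF x, of "i - 1"]] step2 by simp
qed

lemma sum_grid_indicator:
  fixes f :: "real \<Rightarrow> real"
  assumes L: "0 < L" and per: "\<And>z. z \<in> lattice L m \<Longrightarrow> f (z + 2 * L) = f z"
    and w: "w \<in> lattice L m"
  shows "(\<Sum>y\<in>grid L m. (if [w = y] (rmod (2 * L)) then 1 else 0) * f y) = f w"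
proof -
  define n where "n = \<lfloor>(w + L) / (2 * L)\<rfloor>"
  define y0 where "y0 = w + of_int (- n) * (2 * L)"
  have n: "of_int n * (2 * L) \<le> w + L" "w + L < (of_int n + 1) * (2 * L)"
    using floor_correct[of "(w + L) / (2 * L)"] L unfolding n_def[symmetric]
    by (simp_all add: field_simps)
  have y0: "y0 \<in> grid L m"
    using n lattice_shift[OF w, of "- n"] by (simp add: grid_def y0_def algebra_simps)
  have "[w = y] (rmod (2 * L)) \<longleftrightarrow> y = y0" if y: "y \<in> grid L m" for y
  proof
    assume "[w = y] (rmod (2 * L))"
    then have "[y = w] (rmod (2 * L))" by (simp add: rcong_def)
    then obtain k where k: "w = y + of_int k * (2 * L)"
      unfolding rcong_altdef by blast
    have e: "y - y0 = of_int (n - k) * (2 * L)" by (simp add: k y0_def algebra_simps)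
    have "\<bar>y - y0\<bar> < 2 * L" using y y0 by (auto simp: grid_def)
    then have "\<bar>real_of_int (n - k)\<bar> * (2 * L) < 1 * (2 * L)" using e L by (simp add: abs_mult)
    then have "\<bar>real_of_int (n - k)\<bar> < 1" using L by (simp only: mult_less_cancel_right_pos)
    then have "n - k = 0" by linarith
    with e show "y = y0" by simp
  next
    assume "y = y0"
    then show "[w = y] (rmod (2 * L))"
      unfolding rcong_altdef y0_def by blast
  qed
  then have "(\<Sum>y\<in>grid L m. (if [w = y] (rmod (2 * L)) then 1 else 0) * f y)
      = (\<Sum>y\<in>grid L m. if y = y0 then f y else 0)"
    by (intro sum.cong) auto
  also have "\<dots> = f y0" using y0 finite_grid[OF L] by simp
  also have "\<dots> = f w" unfolding y0_def by (rule periodic_of_int[where f = f, OF per w])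
  finally show ?thesis .
qed

lemma gen_eq_sum_gen_matrix:
  assumes L: "0 < L" and per: "\<And>z. z \<in> lattice L m \<Longrightarrow> f (z + 2 * L) = f z"
    and x: "x \<in> grid L m"
  shows "gen L \<sigma> \<mu> m f x = (\<Sum>y\<in>grid L m. gen_matrix L \<sigma> \<mu> m x y * f y)"
proof -
  let ?h = "mesh L m"
  let ?e = "\<lambda>w y. (if [w = y] (rmod (2 * L)) then 1 else 0 :: real)"
  let ?a = "(\<sigma> x)\<^sup>2 / 2 / ?h\<^sup>2" and ?b = "\<mu> x / (2 * ?h)"
  obtain k where k: "x = of_int k * ?h" using x by (auto simp: grid_def lattice_def)
  have lat: "x \<in> lattice L m" "x + ?h \<in> lattice L m" "x - ?h \<in> lattice L m"
    unfolding lattice_def k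
    by (auto intro: range_eqI[of _ _ "k + 1"] range_eqI[of _ _ "k - 1"] simp: algebra_simps)
  have g: "gen L \<sigma> \<mu> m f' x = (?a + ?b) * f' (x + ?h) + (?a - ?b) * f' (x - ?h) - 2 * ?a * f' x" for f'
    by (simp add: gen_def laplacian_def nabla_def algebra_simps add_divide_distrib diff_divide_distrib)
  have "(\<Sum>y\<in>grid L m. gen_matrix L \<sigma> \<mu> m x y * f y)
      = (?a + ?b) * (\<Sum>y\<in>grid L m. ?e (x + ?h) y * f y)
        + (?a - ?b) * (\<Sum>y\<in>grid L m. ?e (x - ?h) y * f y) - 2 * ?a * (\<Sum>y\<in>grid L m. ?e x y * f y)"
    unfolding gen_matrix_def g sum_distrib_left sum.distrib[symmetric] sum_subtractf[symmetric]
    by (intro sum.cong refl) (simp only: algebra_simps)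
  also have "\<dots> = gen L \<sigma> \<mu> m f x"
    unfolding g using lat by (simp only: sum_grid_indicator[where f = f, OF L per])
  finally show ?thesis by simp
qed

end

theory Submission
  imports Defs "HOL-Library.Function_Algebras" "Jordan_Normal_Form.Determinant"
begin

text \<open>
  Both levels are compared by energy estimates for the damped generators \<open>A = damping - L\<close>, which
  are coercive for the inner products with weight \<open>1 / a\<close>, \<open>a = \<sigma>\<^sup>2 / 2\<close>; positivity of the kernels
  plays no role. Let \<open>K\<close> be the inverse of \<open>A\<close> and \<open>P s = exp (- s A)\<close> on the coarse level, with primes
  on the fine level; \<open>R\<close> is the restriction to the coarse lattice and \<open>I\<close> the weighted adjoint of
  piecewise linear interpolation, which maps point sources to point sources. Since \<open>I\<close> turns the
  fine Laplacian into the coarse one, testing the resolvent equations shows that \<open>K I - R K'\<close> is of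
  order \<open>\<omega> + h\<^sup>2\<close>, where \<open>\<omega>\<close> is the oscillation of the coefficients over a cell. Only second
  differences at interior nodes of the cells enter, so this includes point sources at coarse nodes.
  The smoothed error \<open>K K (P s I - I P' s) K'\<close> solves the parabolic equation with zero initial value
  and a forcing of that order, and it commutes with the generators up to such terms. Therefore
  \<open>P (2 s) I - R P' (2 s)\<close> and its time derivative can be written in terms of it, with all unbounded
  factors absorbed by the smoothing of \<open>P s\<close> and \<open>P' s\<close>. Finally \<open>h\<^sup>2\<close> is dominated by \<open>\<rho> h\<close>, because
  a nonconstant coefficient forces \<open>\<rho>\<close> to be at least linear.\<close>

section \<open>Periodic functions and matrices\<close>

text \<open>The coefficients have only a modulus of continuity, so no estimate may take a difference
  quotient of them. The weight \<open>1 / a\<close> makes this possible: it cancels \<open>a\<close>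
  in front of the Laplacian, summation by parts never meets a coefficient, and the discrepancy
  between two levels becomes a quadrature error for \<open>1 / a\<close> and for the drift ratio.
  The second obstacle is the datum. The weighted norm of a point source grows like the inverse
  square root of the mesh width, so the source enters only through its resolvent, which is bounded
  uniformly; the additional power of \<open>A\<close> is paid for by parabolic smoothing. This is
  why the time is doubled: in one half the coarse flow absorbs the unbounded factors, in the other
  half the fine flow does, and the result at time \<open>t\<close> is obtained with
  \<open>s = t / 2\<close>. The damping makes \<open>A\<close> invertible with bounds that do not
  depend on the level, and a factor \<open>exp (damping a1 b1 * t)\<close> removes it at the end.
  Pointwise bounds come from the one-dimensional Sobolev inequality, so energy norms suffice
  throughout.\<close>

definition per :: "nat \<Rightarrow> (int \<Rightarrow> real) set" where
  "per N = {f. \<forall>k. f (k + int N) = f k}"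

lemma perI: "(\<And>k. f (k + int N) = f k) \<Longrightarrow> f \<in> per N"
  by (simp add: per_def)

lemma perD: "f \<in> per N \<Longrightarrow> f (k + int N) = f k"
  by (simp add: per_def)

lemma per_add: "f \<in> per N \<Longrightarrow> g \<in> per N \<Longrightarrow> f + g \<in> per N"
  and per_diff: "f \<in> per N \<Longrightarrow> g \<in> per N \<Longrightarrow> f - g \<in> per N"
  and per_zero: "0 \<in> per N"
  by (simp_all add: per_def)

lemma per_mult_int:
  assumes "f \<in> per N"
  shows "f (k + j * int N) = f k"
proof (induction j rule: int_induct[where k = 0])
  case (step1 i)
  then show ?case using perD[OF assms, of "k + i * int N"] by (simp add: algebra_simps)
next
  case (step2 i)
  then show ?case using perD[OF assms, of "k + (i - 1) * int N"] by (simp add: algebra_simps)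
qed simp

lemma per_mod: "f \<in> per N \<Longrightarrow> f (k mod int N) = f k"
  using per_mult_int[of f N "k mod int N" "k div int N"] by simp

lemma per_shift: "f \<in> per N \<Longrightarrow> (\<lambda>k. f (k + j)) \<in> per N"
  by (auto simp: per_def) (metis add.assoc add.commute)

lemma per_eqI:
  assumes "f \<in> per N" "g \<in> per N" "0 < N" "\<And>k. k < N \<Longrightarrow> f (int k) = g (int k)"
  shows "f = g"
proof
  fix k
  have "k mod int N = int (nat (k mod int N))" "nat (k mod int N) < N"
    using assms(3) by (simp_all add: nat_less_iff)
  then show "f k = g k"
    using assms(4)[of "nat (k mod int N)"] per_mod[OF assms(1), of k] per_mod[OF assms(2), of k]
    by simp
qed

lemma sum_per_shift1:
  assumes "f \<in> per N"
  shows "(\<Sum>k<N. f (int k + 1)) = (\<Sum>k<N. f (int k))"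
proof -
  have "(\<Sum>k<N. f (int k + 1)) + f 0 = (\<Sum>k<N. f (int k)) + f (int N)"
    using sum.lessThan_Suc_shift[of "\<lambda>k. f (int k)" N] sum.lessThan_Suc[of "\<lambda>k. f (int k)" N]
    by (simp add: algebra_simps)
  then show ?thesis using perD[OF assms, of 0] by simp
qed

lemma sum_per_shift_back:
  assumes "f \<in> per N"
  shows "(\<Sum>k<N. f (int k - 1)) = (\<Sum>k<N. f (int k))"
  using sum_per_shift1[OF per_shift[OF assms, of "-1"]] by simp

lemma sum_per_int_interval:
  assumes f: "f \<in> per N"
  shows "(\<Sum>k\<in>{c..<c + int N}. f k) = (\<Sum>k<N. f (int k))"
proof -
  have *: "(\<Sum>k<N. f (int k + c)) = (\<Sum>k<N. f (int k))" for c
  proof (induction c rule: int_induct[where k = 0])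
    case (step1 i)
    then show ?case using sum_per_shift1[OF per_shift[OF f, of i]] by (simp add: algebra_simps)
  next
    case (step2 i)
    then show ?case using sum_per_shift_back[OF per_shift[OF f, of i]] by (simp add: algebra_simps)
  qed simp
  have "(\<Sum>k\<in>{c..<c + int N}. f k) = (\<Sum>k<N. f (int k + c))"
    by (rule sum.reindex_bij_witness[of _ "\<lambda>k. int k + c" "\<lambda>k. nat (k - c)"]) auto
  with * show ?thesis by simp
qed

section \<open>Linear operators on periodic functions\<close>

text \<open>Only periodic arguments are constrained and the output index runs over all integers, so
  the notion also covers maps between lattices of different size such as \<open>I\<close>. Being a
  finite sum, such an operator commutes with derivatives and limits in time.\<close>

definition kernel_op :: "nat \<Rightarrow> ((int \<Rightarrow> real) \<Rightarrow> int \<Rightarrow> real) \<Rightarrow> bool" where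
  "kernel_op N T \<longleftrightarrow> (\<exists>\<kappa>. \<forall>f\<in>per N. \<forall>k. T f k = (\<Sum>l<N. \<kappa> k l * f (int l)))"

lemma kernel_opE:
  assumes "kernel_op N T"
  obtains \<kappa> where "\<And>f k. f \<in> per N \<Longrightarrow> T f k = (\<Sum>l<N. \<kappa> k l * f (int l))"
  using assms unfolding kernel_op_def by blast

lemma kernel_op_add:
  assumes "kernel_op N T" "f \<in> per N" "g \<in> per N"
  shows "T (f + g) = T f + T g"
  using assms(1) by (rule kernel_opE) (auto simp: assms per_add fun_eq_iff algebra_simps sum.distrib)

lemma kernel_op_diff:
  assumes "kernel_op N T" "f \<in> per N" "g \<in> per N"
  shows "T (f - g) = T f - T g"
  using assms(1)
  by (rule kernel_opE) (auto simp: assms per_diff fun_eq_iff algebra_simps sum_subtractf)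

lemma kernel_op_scale:
  assumes "kernel_op N T" "f \<in> per N"
  shows "T (\<lambda>k. c * f k) k = c * T f k"
proof -
  have "(\<lambda>k. c * f k) \<in> per N" using assms(2) by (simp add: per_def)
  then show ?thesis using assms(1)
    unfolding kernel_op_def by (auto simp: assms(2) sum_distrib_left algebra_simps)
qed

lemma kernel_op_compose:
  assumes T: "kernel_op N T" and S: "kernel_op N2 S" and per: "\<And>f. f \<in> per N \<Longrightarrow> T f \<in> per N2"
  shows "kernel_op N (\<lambda>f. S (T f))"
proof -
  obtain \<kappa> where \<kappa>: "\<And>f k. f \<in> per N \<Longrightarrow> T f k = (\<Sum>l<N. \<kappa> k l * f (int l))"
    using T unfolding kernel_op_def by blast
  obtain \<nu> where \<nu>: "\<And>f k. f \<in> per N2 \<Longrightarrow> S f k = (\<Sum>l<N2. \<nu> k l * f (int l))"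
    using S unfolding kernel_op_def by blast
  have "S (T f) k = (\<Sum>l<N. (\<Sum>j<N2. \<nu> k j * \<kappa> (int j) l) * f (int l))" if "f \<in> per N" for f k
    unfolding \<nu>[OF per[OF that]] \<kappa>[OF that] sum_distrib_left sum_distrib_right
    by (subst sum.swap) (simp add: mult.assoc)
  then show ?thesis unfolding kernel_op_def by (intro exI[of _ "\<lambda>k l. \<Sum>j<N2. \<nu> k j * \<kappa> (int j) l"]) simp
qed

text \<open>The kernel is the indicator of the representative of \<open>\<phi> k\<close> modulo
  \<open>N\<close>. Shifts are the case from which \<open>A\<close> is built; a general index map
  lets \<open>I\<close> read the fine nodes.\<close>

lemma kernel_op_eval:
  assumes "0 < N"
  shows "kernel_op N (\<lambda>f k. f (\<phi> k))"
proof -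
  have "f (\<phi> k) = (\<Sum>l<N. (if int l = \<phi> k mod int N then 1 else 0) * f (int l))"
    if "f \<in> per N" for f k
  proof -
    have l: "int l = \<phi> k mod int N \<longleftrightarrow> l = nat (\<phi> k mod int N)" for l
      using assms by auto
    have "nat (\<phi> k mod int N) < N" using assms by (simp add: nat_less_iff)
    then have "(\<Sum>l<N. (if int l = \<phi> k mod int N then 1 else 0) * f (int l)) = f (\<phi> k mod int N)"
      unfolding l using assms by (simp add: if_distrib[of "\<lambda>x. x * _"] cong: if_cong)
    then show ?thesis using per_mod[OF that] by simp
  qed
  then show ?thesis unfolding kernel_op_def by (intro exI[of _ "\<lambda>k l. if int l
      = \<phi> k mod int N then 1 else 0"]) blast
qed

lemma kernel_op_mult:
  assumes "kernel_op N T"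
  shows "kernel_op N (\<lambda>f k. c k * T f k)"
proof -
  obtain \<kappa> where "\<And>f k. f \<in> per N \<Longrightarrow> T f k = (\<Sum>l<N. \<kappa> k l * f (int l))"
    using assms unfolding kernel_op_def by blast
  then show ?thesis unfolding kernel_op_def
    by (intro exI[of _ "\<lambda>k l. c k * \<kappa> k l"]) (simp add: sum_distrib_left mult.assoc)
qed

lemma kernel_op_sum:
  assumes "\<And>i. i \<in> I \<Longrightarrow> kernel_op N (T i)"
  shows "kernel_op N (\<lambda>f k. \<Sum>i\<in>I. T i f k)"
proof -
  have ex: "\<forall>i\<in>I. \<exists>\<kappa>. \<forall>f\<in>per N. \<forall>k. T i f k = (\<Sum>l<N. \<kappa> k l * f (int l))"
    using assms unfolding kernel_op_def by blast
  from bchoice[OF ex] obtain \<kappa> where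
    "\<forall>i\<in>I. \<forall>f\<in>per N. \<forall>k. T i f k = (\<Sum>l<N. \<kappa> i k l * f (int l))" ..
  then show ?thesis unfolding kernel_op_def
    by (intro exI[of _ "\<lambda>k l. \<Sum>i\<in>I. \<kappa> i k l"]) (simp add: sum_distrib_right sum.swap[of _ "{..<N}" I])
qed

lemma kernel_op_plus2:
  assumes "kernel_op N T" "kernel_op N S"
  shows "kernel_op N (\<lambda>f k. T f k + S f k)"
  using kernel_op_sum[of "{0, 1 :: nat}" N "\<lambda>i. if i = 0 then T else S"] assms by simp

lemma kernel_op_deriv:
  assumes T: "kernel_op N T" and per: "\<And>s. 0 < s \<Longrightarrow> e s \<in> per N" "e' \<in> per N" and s: "0 < s"
    and e: "\<And>k. ((\<lambda>s. e s k) has_real_derivative e' k) (at s)"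
  shows "((\<lambda>s. T (e s) k) has_real_derivative T e' k) (at s)"
proof -
  obtain \<kappa> where \<kappa>: "\<And>f k. f \<in> per N \<Longrightarrow> T f k = (\<Sum>l<N. \<kappa> k l * f (int l))"
    using T unfolding kernel_op_def by blast
  have "((\<lambda>s. \<Sum>l<N. \<kappa> k l * e s (int l)) has_real_derivative (\<Sum>l<N. \<kappa> k l * e' (int l))) (at s)"
    by (intro DERIV_sum DERIV_cmult e)
  moreover have "eventually (\<lambda>s. T (e s) k = (\<Sum>l<N. \<kappa> k l * e s (int l))) (nhds s)"
    using eventually_gt_at_top[of 0] eventually_nhds_in_open[of "{0<..}" s] s
    by (auto elim!: eventually_mono simp: \<kappa> per)
  ultimately show ?thesis
    using DERIV_cong_ev[OF refl _ refl, of "\<lambda>s. T (e s) k"] by (simp add: \<kappa>[OF per(2)])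
qed

lemma kernel_op_lim:
  assumes T: "kernel_op N T" and per: "\<And>s. 0 < s \<Longrightarrow> e s \<in> per N" "f \<in> per N"
    and e: "\<And>k. ((\<lambda>s. e s k) \<longlongrightarrow> f k) (at_right 0)"
  shows "((\<lambda>s. T (e s) k) \<longlongrightarrow> T f k) (at_right (0 :: real))"
proof -
  obtain \<kappa> where \<kappa>: "\<And>f k. f \<in> per N \<Longrightarrow> T f k = (\<Sum>l<N. \<kappa> k l * f (int l))"
    using T unfolding kernel_op_def by blast
  have "((\<lambda>s. \<Sum>l<N. \<kappa> k l * e s (int l)) \<longlongrightarrow> (\<Sum>l<N. \<kappa> k l * f (int l))) (at_right 0)"
    by (intro tendsto_intros e)
  moreover have "eventually (\<lambda>s. (\<Sum>l<N. \<kappa> k l * e s (int l)) = T (e s) k) (at_right 0)"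
    using eventually_at_right_less[of "0::real"] by eventually_elim (simp add: \<kappa> per)
  ultimately have "((\<lambda>s. T (e s) k) \<longlongrightarrow> (\<Sum>l<N. \<kappa> k l * f (int l))) (at_right 0)"
    by (rule Lim_transform_eventually)
  then show ?thesis by (simp add: \<kappa>[OF per(2)])
qed

text \<open>On one period \<open>T\<close> is a square matrix, and injectivity excludes a zero
  determinant. The inverse matrix, extended periodically, is a right inverse; injectivity applied to
  \<open>S (T f) - f\<close> makes it a left inverse.\<close>

lemma kernel_op_inverse:
  assumes N: "0 < N" and T: "kernel_op N T" and per: "\<And>f. f \<in> per N \<Longrightarrow> T f \<in> per N"
    and inj: "\<And>f. f \<in> per N \<Longrightarrow> T f = 0 \<Longrightarrow> f = 0"
  obtains S where "kernel_op N S" "\<And>f. f \<in> per N \<Longrightarrow> S f \<in> per N"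
    "\<And>f. f \<in> per N \<Longrightarrow> T (S f) = f" "\<And>f. f \<in> per N \<Longrightarrow> S (T f) = f"
proof -
  obtain \<kappa> where \<kappa>: "\<And>f k. f \<in> per N \<Longrightarrow> T f k = (\<Sum>l<N. \<kappa> k l * f (int l))"
    using T unfolding kernel_op_def by blast
  define A where "A = mat N N (\<lambda>(k, l). \<kappa> (int k) l)"
  have A: "A \<in> carrier_mat N N" by (simp add: A_def)
  define ext :: "(nat \<Rightarrow> real) \<Rightarrow> int \<Rightarrow> real" where "ext g = (\<lambda>k. g (nat (k mod int N)))" for g
  have ext: "ext g \<in> per N" "\<And>k. k < N \<Longrightarrow> ext g (int k) = g k" for g
    by (simp_all add: ext_def per_def)
  have "det A \<noteq> 0"
  proof
    assume "det A = 0"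
    then obtain v where v: "v \<in> carrier_vec N" "v \<noteq> 0\<^sub>v N" "A *\<^sub>v v = 0\<^sub>v N"
      using det_0_iff_vec_prod_zero_field[OF A] by auto
    have "T (ext (\<lambda>k. v $ k)) = 0"
    proof (rule per_eqI[OF per[OF ext(1)] per_zero N])
      fix k assume k: "k < N"
      have "T (ext (\<lambda>k. v $ k)) (int k) = (\<Sum>l<N. \<kappa> (int k) l * v $ l)"
        by (simp add: \<kappa>[OF ext(1)] ext(2))
      also have "\<dots> = (A *\<^sub>v v) $ k"
        using k v(1) by (simp add: A_def scalar_prod_def atLeast0LessThan)
      finally show "T (ext (\<lambda>k. v $ k)) (int k) = 0 (int k)" using v(3) k by simp
    qed
    then have "ext (\<lambda>k. v $ k) = 0" using inj ext(1) by blast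
    then have "v $ k = 0" if "k < N" for k using ext(2)[OF that, of "\<lambda>k. v $ k"] by simp
    then show False using v(1,2) by (auto simp: vec_eq_iff)
  qed
  then have "A \<in> Units (ring_mat TYPE(real) N ())" by (rule det_non_zero_imp_unit[OF A])
  then obtain B where B: "B \<in> carrier_mat N N" "B * A = 1\<^sub>m N" "A * B = 1\<^sub>m N"
    by (auto simp: Units_def ring_mat_def)
  define S where "S f = ext (\<lambda>k. \<Sum>l<N. B $$ (k, l) * f (int l))" for f :: "int \<Rightarrow> real"
  have S: "kernel_op N S" unfolding kernel_op_def S_def
    by (intro exI[of _ "\<lambda>k l. B $$ (nat (k mod int N), l)"]) (simp add: ext_def)
  have TS: "T (S f) = f" if f: "f \<in> per N" for f
  proof (rule per_eqI[OF per f N])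
    show "S f \<in> per N" by (simp add: S_def ext)
    fix k assume k: "k < N"
    have "T (S f) (int k) = (\<Sum>l<N. \<kappa> (int k) l * (\<Sum>j<N. B $$ (l, j) * f (int j)))"
      by (simp add: \<kappa> S_def ext)
    also have "\<dots> = (\<Sum>j<N. (\<Sum>l<N. \<kappa> (int k) l * B $$ (l, j)) * f (int j))"
      unfolding sum_distrib_left sum_distrib_right by (subst sum.swap) (simp add: mult.assoc)
    also have "\<dots> = (\<Sum>j<N. (A * B) $$ (k, j) * f (int j))"
      using k B(1) by (intro sum.cong) (auto simp: A_def scalar_prod_def atLeast0LessThan)
    also have "\<dots> = f (int k)" using k by (simp add: B(3) if_distrib[of "\<lambda>x. x * _"] cong: if_cong)
    finally show "T (S f) (int k) = f (int k)" .
  qed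
  have S_per: "S f \<in> per N" for f by (simp add: S_def ext)
  have ST: "S (T f) = f" if f: "f \<in> per N" for f
  proof -
    have "T (S (T f) - f) = 0"
      using kernel_op_diff[OF T S_per f, of "T f"] TS[OF per[OF f]] by simp
    then have "S (T f) - f = 0" by (rule inj[OF per_diff[OF S_per f]])
    then show ?thesis by simp
  qed
  show ?thesis using that S S_per TS ST by blast
qed

section \<open>Monotonicity arguments on the half line\<close>

text \<open>Solutions are differentiable for positive times only and attain their initial value as a
  limit, so a nonincreasing quantity is compared with that limit. The energy estimates in time are
  instances, with \<open>y\<close> an energy or a time-weighted energy.\<close>

lemma le_limit_at_right_0:
  fixes y y' :: "real \<Rightarrow> real"
  assumes deriv: "\<And>s. 0 < s \<Longrightarrow> (y has_real_derivative y' s) (at s)"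
    and neg: "\<And>s. 0 < s \<Longrightarrow> y' s \<le> 0" and lim: "(y \<longlongrightarrow> l) (at_right 0)" and s: "0 < s"
  shows "y s \<le> l"
proof (rule tendsto_lowerbound[OF lim])
  show "\<forall>\<^sub>F r in at_right 0. y s \<le> y r"
    unfolding eventually_at_right_field
  proof (intro exI[of _ s] conjI allI impI s)
    fix r assume r: "0 < r" "r < s"
    show "y s \<le> y r"
    proof (rule DERIV_nonpos_imp_nonincreasing[of r s y])
        show "\<exists>y''. (y has_real_derivative y'') (at x) \<and> y'' \<le> 0" if "r \<le> x" "x \<le> s" for x
          using r that by (intro exI[of _ "y' x"] conjI deriv neg) auto
      qed (use r in simp)
  qed
qed simp

text \<open>The energy \<open>\<Sum>j. (w j s)\<^sup>2\<close> grows at most exponentially, hence stays zero.\<close>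

lemma linear_ode_unique:
  fixes w :: "nat \<Rightarrow> real \<Rightarrow> real"
  assumes deriv: "\<And>l s. l < N \<Longrightarrow> 0 < s \<Longrightarrow> (w l has_real_derivative (\<Sum>j<N. c l j * w j s)) (at s)"
    and lim: "\<And>l. l < N \<Longrightarrow> (w l \<longlongrightarrow> 0) (at_right 0)" and s: "0 < s" and l: "l < N"
  shows "w l s = 0"
proof -
  define C where "C = 2 * (\<Sum>l<N. \<Sum>j<N. \<bar>c l j\<bar>)"
  define y where "y s = (\<Sum>l<N. (w l s)\<^sup>2)" for s
  define y' where "y' s = (\<Sum>l<N. 2 * w l s * (\<Sum>j<N. c l j * w j s))" for s
  have y: "(y has_real_derivative y' s) (at s)" if "0 < s" for s
    unfolding y_def y'_def
    by (intro DERIV_sum) (use deriv[OF _ that] in \<open>auto intro!: derivative_eq_intros\<close>)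
  have le: "y' s \<le> C * y s" if "0 < s" for s
  proof -
    have "\<bar>w l s * w j s\<bar> \<le> y s" if "l < N" "j < N" for l j
    proof -
      have "\<bar>w l s\<bar> \<le> sqrt (y s)" "\<bar>w j s\<bar> \<le> sqrt (y s)" unfolding y_def
        by (intro real_le_rsqrt; use that in \<open>auto intro!: member_le_sum[where f = "\<lambda>l. (w l s)\<^sup>2"]\<close>)+
      then have "\<bar>w l s\<bar> * \<bar>w j s\<bar> \<le> sqrt (y s) * sqrt (y s)"
        by (intro mult_mono) (auto simp: y_def sum_nonneg)
      then show ?thesis by (simp add: abs_mult y_def sum_nonneg)
    qed
    then have "c l j * (w l s * w j s) \<le> \<bar>c l j\<bar> * y s" if "l < N" "j < N" for l j
      using that by (metis abs_ge_self abs_ge_zero abs_mult mult_left_mono order_trans)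
    then have "(\<Sum>l<N. \<Sum>j<N. c l j * (w l s * w j s)) \<le> (\<Sum>l<N. \<Sum>j<N. \<bar>c l j\<bar> * y s)"
      by (intro sum_mono) auto
    moreover have "y' s = 2 * (\<Sum>l<N. \<Sum>j<N. c l j * (w l s * w j s))"
      by (simp add: y'_def sum_distrib_left algebra_simps)
    moreover have "C * y s = 2 * (\<Sum>l<N. \<Sum>j<N. \<bar>c l j\<bar> * y s)"
      by (simp add: C_def sum_distrib_right)
    ultimately show ?thesis by linarith
  qed
  have "exp (- C * s) * y s \<le> 0"
  proof (rule le_limit_at_right_0[where y = "\<lambda>s. exp (- C * s) * y s"
        and y' = "\<lambda>s. exp (- C * s) * (y' s - C * y s)", OF _ _ _ s])
    show "((\<lambda>s. exp (- C * s) * y s) has_real_derivative exp (- C * s) * (y' s - C * y s)) (at s)"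
      if "0 < s" for s
      using y[OF that] by (auto intro!: derivative_eq_intros simp: algebra_simps)
    show "exp (- C * s) * (y' s - C * y s) \<le> 0" if "0 < s" for s
      using le[OF that] by (simp add: mult_le_0_iff)
    have "((\<lambda>s. exp (- C * s) * y s) \<longlongrightarrow> exp (- C * 0) * (\<Sum>l<N. 0\<^sup>2)) (at_right 0)"
      unfolding y_def by (intro tendsto_intros lim) auto
    then show "((\<lambda>s. exp (- C * s) * y s) \<longlongrightarrow> 0) (at_right 0)" by simp
  qed
  then have "y s \<le> 0" by (simp add: mult_le_0_iff)
  moreover have "(w l s)\<^sup>2 \<le> y s" unfolding y_def using l by (intro member_le_sum) auto
  ultimately have "(w l s)\<^sup>2 \<le> 0" by linarith
  then show ?thesis by simp
qed

section \<open>Energy estimates for a periodic lattice diffusion\<close>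

definition fdiff :: "real \<Rightarrow> (int \<Rightarrow> real) \<Rightarrow> int \<Rightarrow> real" where
  "fdiff h f k = (f (k + 1) - f k) / h"

definition cdiff :: "real \<Rightarrow> (int \<Rightarrow> real) \<Rightarrow> int \<Rightarrow> real" where
  "cdiff h f k = (f (k + 1) - f (k - 1)) / (2 * h)"

definition lap :: "real \<Rightarrow> (int \<Rightarrow> real) \<Rightarrow> int \<Rightarrow> real" where
  "lap h f k = (f (k + 1) + f (k - 1) - 2 * f k) / h\<^sup>2"

lemma fdiff_per: "f \<in> per N \<Longrightarrow> fdiff h f \<in> per N"
  and cdiff_per: "f \<in> per N \<Longrightarrow> cdiff h f \<in> per N"
  and lap_per: "f \<in> per N \<Longrightarrow> lap h f \<in> per N"
  unfolding per_def fdiff_def cdiff_def lap_def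
  by (clarsimp; metis (no_types, opaque_lifting) add.commute add.left_commute diff_add_eq)+

lemma per_cmult: "c \<in> per N \<Longrightarrow> f \<in> per N \<Longrightarrow> (\<lambda>k. c k * f k) \<in> per N"
  by (simp add: per_def)

text \<open>Summation by parts: the pointwise defect is the increment of a periodic function
  \<open>F\<close>, and such increments cancel over a period.\<close>

lemma sum_lap_mult:
  assumes f: "f \<in> per N" and g: "g \<in> per N" and h: "0 < h"
  shows "(\<Sum>k<N. h * lap h f (int k) * g (int k)) = - (\<Sum>k<N. h * fdiff h f (int k) * fdiff h g (int k))"
proof -
  define F where "F k = (f k - f (k - 1)) / h * g k" for k
  have F: "F \<in> per N" using f g unfolding per_def F_def
    by clarsimp (metis add_diff_eq diff_add_eq)
  have "h * lap h f k * g k + h * fdiff h f k * fdiff h g k = F (k + 1) - F k" for k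
    using h by (simp add: F_def fdiff_def lap_def field_simps power2_eq_square)
  then have "(\<Sum>k<N. h * lap h f (int k) * g (int k)) + (\<Sum>k<N. h * fdiff h f (int k) * fdiff h g (int k))
      = (\<Sum>k<N. F (int k + 1) - F (int k))"
    by (simp add: sum.distrib[symmetric])
  also have "\<dots> = 0" using sum_per_shift1[OF F] by (simp add: sum_subtractf)
  finally show ?thesis by simp
qed

text \<open>The centered difference is the mean of the two adjacent forward differences; convexity
  of the square and a shift of the index suffice.\<close>

lemma sum_cdiff_sq_le:
  assumes f: "f \<in> per N" and h: "0 < h"
  shows "(\<Sum>k<N. h * (cdiff h f (int k))\<^sup>2) \<le> (\<Sum>k<N. h * (fdiff h f (int k))\<^sup>2)"
proof -
  define F where "F k = h * (fdiff h f k)\<^sup>2" for k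
  have F: "F \<in> per N" using fdiff_per[OF f] by (simp add: per_def F_def)
  have "h * (cdiff h f k)\<^sup>2 \<le> (F k + F (k - 1)) / 2" for k
  proof -
    have c: "cdiff h f k = (fdiff h f k + fdiff h f (k - 1)) / 2"
      using h by (simp add: cdiff_def fdiff_def field_simps)
    have "(cdiff h f k)\<^sup>2 \<le> ((fdiff h f k)\<^sup>2 + (fdiff h f (k - 1))\<^sup>2) / 2"
      unfolding c using sum_squares_bound[of "fdiff h f k" "fdiff h f (k - 1)"]
      by (simp add: power2_eq_square field_simps)
    from mult_left_mono[OF this, of h] h show ?thesis
      by (simp add: F_def algebra_simps add_divide_distrib)
  qed
  then have "(\<Sum>k<N. h * (cdiff h f (int k))\<^sup>2) \<le> (\<Sum>k<N. (F (int k) + F (int k - 1)) / 2)"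
    by (intro sum_mono) auto
  also have "\<dots> = (\<Sum>k<N. F (int k))"
    using sum_per_shift_back[OF F] by (simp add: sum.distrib flip: sum_divide_distrib)
  finally show ?thesis by (simp add: F_def)
qed

section \<open>Coercivity and the Sobolev inequality\<close>

definition damping :: "real \<Rightarrow> real \<Rightarrow> real" where
  "damping a1 b1 = (1 + a1 * b1\<^sup>2) / 2"

text \<open>The bounds \<open>a0\<close>, \<open>a1\<close>, \<open>b1\<close> and the circumference
  \<open>len\<close> are common to all levels. Constants are expressed through them alone, which
  makes the estimates uniform in \<open>N\<close> and \<open>h\<close>.\<close>

locale lattice_diffusion =
  fixes N :: nat and h :: real and a b :: "int \<Rightarrow> real" and a0 a1 b1 len :: real
  assumes N_pos: "0 < N" and h_pos: "0 < h" and circumference: "real N * h = len"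
    and a_per: "a \<in> per N" and b_per: "b \<in> per N"
    and a0_pos: "0 < a0" and a_lower: "a0 \<le> a k" and a_upper: "a k \<le> a1" and b_bound: "\<bar>b k\<bar> \<le> b1"
begin

text \<open>The generator is \<open>a * (lap + b * cdiff)\<close>, so \<open>b\<close> is the drift divided by \<open>a\<close>. It is
  coercive after subtraction of \<open>damping\<close>, for the inner product with the weight \<open>1 / a\<close>.\<close>

definition A :: "(int \<Rightarrow> real) \<Rightarrow> int \<Rightarrow> real" where
  "A f k = damping a1 b1 * f k - a k * (lap h f k + b k * cdiff h f k)"

definition ip :: "(int \<Rightarrow> real) \<Rightarrow> (int \<Rightarrow> real) \<Rightarrow> real" where
  "ip f g = (\<Sum>k<N. h / a (int k) * f (int k) * g (int k))"

definition e0 :: "(int \<Rightarrow> real) \<Rightarrow> real" where "e0 f = ip f f"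

text \<open>No weight appears: in the pairing of \<open>A f\<close> with \<open>f\<close> the factor
  \<open>a\<close> cancels against the weight of \<open>ip\<close>, and the Laplacian leaves the
  plain Dirichlet form.\<close>

definition e1 :: "(int \<Rightarrow> real) \<Rightarrow> real" where "e1 f = (\<Sum>k<N. h * (fdiff h f (int k))\<^sup>2)"

definition nrm0 :: "(int \<Rightarrow> real) \<Rightarrow> real" where "nrm0 f = sqrt (e0 f)"

definition nrm1 :: "(int \<Rightarrow> real) \<Rightarrow> real" where "nrm1 f = sqrt (e0 f + e1 f)"

lemma a_pos: "0 < a k"
  using a0_pos a_lower less_le_trans by blast

lemma a1_pos: "0 < a1"
  using a_pos a_upper less_le_trans by blast

lemma b1_nonneg: "0 \<le> b1"
  using b_bound[of 0] by linarith

lemma len_pos: "0 < len"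
  using N_pos h_pos circumference[symmetric] by simp

lemma damping_ge: "1 / 2 \<le> damping a1 b1"
  using a1_pos by (simp add: damping_def)

lemma A_per: "f \<in> per N \<Longrightarrow> A f \<in> per N"
  using a_per b_per lap_per[of f N h] cdiff_per[of f N h] by (simp add: per_def A_def)

lemma kernel_op_A: "kernel_op N A"
proof -
  have eq: "A = (\<lambda>f k. damping a1 b1 * f k
      + ((a k * (2 / h\<^sup>2)) * f k + ((- a k * (1 / h\<^sup>2 + b k / (2 * h))) * f (k + 1)
      + (- a k * (1 / h\<^sup>2 - b k / (2 * h))) * f (k - 1))))"
    by (intro ext) (simp add: A_def lap_def cdiff_def algebra_simps add_divide_distrib diff_divide_distrib)
  show ?thesis unfolding eq
    by (intro kernel_op_plus2 kernel_op_mult kernel_op_eval[OF N_pos])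
qed

lemma e0_eq: "e0 f = (\<Sum>k<N. h / a (int k) * (f (int k))\<^sup>2)"
  by (simp add: e0_def ip_def power2_eq_square mult.assoc)

lemma e0_nonneg: "0 \<le> e0 f"
  unfolding e0_eq using h_pos a_pos by (intro sum_nonneg) (simp add: less_imp_le)

lemma e1_nonneg: "0 \<le> e1 f"
  unfolding e1_def using h_pos by (intro sum_nonneg) simp

lemma nrm0_sq: "(nrm0 f)\<^sup>2 = e0 f"
  and nrm1_sq: "(nrm1 f)\<^sup>2 = e0 f + e1 f"
  by (simp_all add: nrm0_def nrm1_def e0_nonneg e1_nonneg)

lemma nrm0_nonneg: "0 \<le> nrm0 f"
  and nrm1_nonneg: "0 \<le> nrm1 f"
  by (simp_all add: nrm0_def nrm1_def e0_nonneg e1_nonneg)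

lemma nrm0_le_nrm1: "nrm0 f \<le> nrm1 f"
  by (simp add: nrm0_def nrm1_def e1_nonneg)

lemma nrm0_L2: "nrm0 f = L2_set (\<lambda>k. sqrt (h / a (int k)) * f (int k)) {..<N}"
  unfolding nrm0_def e0_eq L2_set_def using h_pos a_pos
  by (simp add: power_mult_distrib less_imp_le)

lemma sqrt_e1_L2: "sqrt (e1 f) = L2_set (\<lambda>k. sqrt h * fdiff h f (int k)) {..<N}"
  unfolding e1_def L2_set_def using h_pos by (simp add: power_mult_distrib less_imp_le)

lemma nrm0_add: "nrm0 (f + g) \<le> nrm0 f + nrm0 g"
  unfolding nrm0_L2 using L2_set_triangle_ineq by (simp add: algebra_simps)

lemma sqrt_e1_add: "sqrt (e1 (f + g)) \<le> sqrt (e1 f) + sqrt (e1 g)"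
proof -
  have "fdiff h (f + g) k = fdiff h f k + fdiff h g k" for k
    by (simp add: fdiff_def add_divide_distrib diff_divide_distrib)
  then show ?thesis unfolding sqrt_e1_L2 using L2_set_triangle_ineq by (simp add: algebra_simps)
qed

lemma nrm1_eq: "nrm1 f = sqrt ((nrm0 f)\<^sup>2 + (sqrt (e1 f))\<^sup>2)"
  by (simp add: nrm1_def nrm0_sq e1_nonneg)

lemma nrm1_add: "nrm1 (f + g) \<le> nrm1 f + nrm1 g"
proof -
  have "nrm1 (f + g) \<le> sqrt ((nrm0 f + nrm0 g)\<^sup>2 + (sqrt (e1 f) + sqrt (e1 g))\<^sup>2)"
    unfolding nrm1_eq
    by (intro real_sqrt_le_mono add_mono power_mono nrm0_add sqrt_e1_add) (simp_all add: nrm0_nonneg e1_nonneg)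
  also have "\<dots> \<le> nrm1 f + nrm1 g" unfolding nrm1_eq by (rule real_sqrt_sum_squares_triangle_ineq)
  finally show ?thesis .
qed

lemma nrm1_minus: "nrm1 (- f) = nrm1 f"
proof -
  have "fdiff h (- f) k = - fdiff h f k" for k by (simp add: fdiff_def diff_divide_distrib)
  then show ?thesis by (simp add: nrm1_def e0_eq e1_def)
qed

lemma nrm1_diff: "nrm1 (f - g) \<le> nrm1 f + nrm1 g"
  using nrm1_add[of f "- g"] by (simp add: nrm1_minus)

lemma ip_le: "\<bar>ip f g\<bar> \<le> nrm0 f * nrm0 g"
proof -
  have "\<bar>ip f g\<bar> \<le> (\<Sum>k<N. \<bar>sqrt (h / a (int k)) * f (int k)\<bar> * \<bar>sqrt (h / a (int k)) * g (int k)\<bar>)"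
    unfolding ip_def
  proof (rule order_trans[OF sum_abs], rule sum_mono)
    fix k
    define r where "r = sqrt (h / a (int k))"
    have r: "h / a (int k) = r * r" using h_pos a_pos[of "int k"] by (simp add: r_def)
    show "\<bar>h / a (int k) * f (int k) * g (int k)\<bar>
        \<le> \<bar>sqrt (h / a (int k)) * f (int k)\<bar> * \<bar>sqrt (h / a (int k)) * g (int k)\<bar>"
      unfolding r_def[symmetric] unfolding r by (simp only: abs_mult mult_ac order_refl)
  qed
  also have "\<dots> \<le> nrm0 f * nrm0 g" unfolding nrm0_L2 by (rule L2_set_mult_ineq)
  finally show ?thesis .
qed

lemma ip_commute: "ip f g = ip g f"
  unfolding ip_def by (intro sum.cong) auto

text \<open>Young's inequality at each node with a free parameter \<open>c\<close>, followed by
  \<open>sum_cdiff_sq_le\<close>. The parameter decides how the drift is split between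
  \<open>e0\<close> and \<open>e1\<close>: \<open>coercive\<close> takes
  \<open>1 / (a1 * b1\<^sup>2)\<close>, \<open>flow_energy_le\<close> takes
  \<open>2\<close>.\<close>

lemma ip_drift_le:
  assumes f: "f \<in> per N" and c: "0 < c"
  shows "(\<Sum>k<N. 2 * h * b (int k) * cdiff h f (int k) * g (int k))
    \<le> (\<Sum>k<N. h / a (int k) * (g (int k))\<^sup>2) / c + c * a1 * b1\<^sup>2 * e1 f"
proof -
  have "2 * h * b k * cdiff h f k * g k \<le> h / a k * (g k)\<^sup>2 / c + c * a1 * b1\<^sup>2 * (h * (cdiff h f k)\<^sup>2)" for k
  proof -
    have "2 * b k * cdiff h f k * g k \<le> (g k)\<^sup>2 / (c * a k) + c * a k * (b k * cdiff h f k)\<^sup>2"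
    proof -
      define z w where "z = c * a k" and "w = b k * cdiff h f k"
      have p: "0 < z" using c a_pos by (simp add: z_def)
      have "0 \<le> (g k - z * w)\<^sup>2 / z" using p by simp
      also have "\<dots> = (g k)\<^sup>2 / z + z * w\<^sup>2 - 2 * w * g k"
        using p by (simp add: power2_eq_square field_simps)
      finally show ?thesis by (simp add: z_def w_def mult.assoc)
    qed
    also have "c * a k * (b k * cdiff h f k)\<^sup>2 \<le> c * a1 * (b1\<^sup>2 * (cdiff h f k)\<^sup>2)"
      unfolding power_mult_distrib using c a_upper a_pos[of k] a1_pos b_bound[of k] b1_nonneg
      by (intro mult_mono order_refl power2_le_iff_abs_le[THEN iffD2]) (auto simp: less_imp_le)
    finally have "h * (2 * b k * cdiff h f k * g k) \<le> h * ((g k)\<^sup>2 / (c * a k)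
        + c * a1 * (b1\<^sup>2 * (cdiff h f k)\<^sup>2))"
      using h_pos by (intro mult_left_mono) auto
    then show ?thesis using c a_pos[of k] by (simp add: field_simps)
  qed
  then have "(\<Sum>k<N. 2 * h * b (int k) * cdiff h f (int k) * g (int k))
     \<le> (\<Sum>k<N. h / a (int k) * (g (int k))\<^sup>2 / c + c * a1 * b1\<^sup>2 * (h * (cdiff h f (int k))\<^sup>2))"
    by (intro sum_mono) auto
  also have "\<dots> = (\<Sum>k<N. h / a (int k) * (g (int k))\<^sup>2) / c
      + c * a1 * b1\<^sup>2 * (\<Sum>k<N. h * (cdiff h f (int k))\<^sup>2)"
    by (simp add: sum.distrib sum_distrib_left sum_divide_distrib)
  also have "c * a1 * b1\<^sup>2 * (\<Sum>k<N. h * (cdiff h f (int k))\<^sup>2) \<le> c * a1 * b1\<^sup>2 * e1 f"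
    unfolding e1_def using sum_cdiff_sq_le[OF f h_pos] c a1_pos by (intro mult_left_mono) auto
  finally show ?thesis by simp
qed

text \<open>The weight cancels \<open>a\<close>, so that the Laplacian stands without a coefficient
  and can be summed by parts.\<close>

lemma ip_A: "ip (A f) g = damping a1 b1 * ip f g - (\<Sum>k<N. h * lap h f (int k) * g (int k))
    - (\<Sum>k<N. h * b (int k) * cdiff h f (int k) * g (int k))"
proof -
  have "h / a k * A f k * g k = damping a1 b1 * (h / a k * f k * g k) - h * lap h f k * g k
      - h * b k * cdiff h f k * g k" for k
    using a_pos[of k] by (simp add: A_def field_simps)
  then show ?thesis unfolding ip_def by (simp add: sum_subtractf sum_distrib_left)
qed

lemma sum_lap_self: "f \<in> per N \<Longrightarrow> (\<Sum>k<N. h * lap h f (int k) * f (int k)) = - e1 f"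
  using sum_lap_mult[of f N f h] h_pos by (simp add: e1_def power2_eq_square mult.assoc)

lemma e0_le: "(\<Sum>k<N. h * (f (int k))\<^sup>2) \<le> a1 * e0 f"
  unfolding e0_eq sum_distrib_left
proof (rule sum_mono)
  fix k
  have "h * (f (int k))\<^sup>2 = a (int k) * (h / a (int k) * (f (int k))\<^sup>2)"
    using a_pos[of "int k"] by simp
  also have "\<dots> \<le> a1 * (h / a (int k) * (f (int k))\<^sup>2)"
    using a_upper h_pos a_pos[of "int k"] by (intro mult_right_mono) auto
  finally show "h * (f (int k))\<^sup>2 \<le> a1 * (h / a (int k) * (f (int k))\<^sup>2)" .
qed

text \<open>The Young parameter is chosen so that the drift consumes one of the two copies of
  \<open>e1 f\<close> and \<open>a1 * b1\<^sup>2\<close> copies of \<open>e0 f\<close>. The latter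
  is what \<open>2 * damping a1 b1\<close> contains beyond \<open>1\<close>, so one copy of each
  term is left.\<close>

lemma coercive:
  assumes f: "f \<in> per N"
  shows "e0 f + e1 f \<le> 2 * ip (A f) f"
proof -
  define D where "D = (\<Sum>k<N. h * b (int k) * cdiff h f (int k) * f (int k))"
  have D2: "2 * D = (\<Sum>k<N. 2 * h * b (int k) * cdiff h f (int k) * f (int k))"
    by (simp add: D_def sum_distrib_left mult.assoc)
  have main: "2 * ip (A f) f = 2 * damping a1 b1 * e0 f + 2 * e1 f - 2 * D"
    unfolding ip_A sum_lap_self[OF f] D_def[symmetric] by (simp add: e0_def)
  show ?thesis
  \<comment> \<open>For \<open>b1 = 0\<close> the parameter \<open>1 / (a1 * b1\<^sup>2)\<close>
    degenerates, but then the drift vanishes.\<close>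
  proof (cases "b1 = 0")
    case True
    then have "b k = 0" for k using b_bound[of k] by simp
    then have "D = 0" by (simp add: D_def)
    then show ?thesis using main True e1_nonneg[of f] by (simp add: damping_def)
  next
    case False
    then have p: "0 < a1 * b1\<^sup>2" using a1_pos by simp
    have "2 * D \<le> e0 f / (1 / (a1 * b1\<^sup>2)) + 1 / (a1 * b1\<^sup>2) * a1 * b1\<^sup>2 * e1 f"
      unfolding D2 e0_eq using p by (intro ip_drift_le[OF f]) simp
    then have "2 * D \<le> a1 * b1\<^sup>2 * e0 f + e1 f" using a1_pos False by (simp add: mult_ac)
    moreover have "2 * damping a1 b1 * e0 f = e0 f + a1 * b1\<^sup>2 * e0 f"
      by (simp add: damping_def algebra_simps)
    ultimately show ?thesis using main by linarith
  qed
qed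

text \<open>One factor \<open>nrm1 f\<close> is cancelled after testing with \<open>f\<close>
  itself. The resolvent estimates below all reduce to bounding the functional
  \<open>ip (A f) f\<close> in this way.\<close>

lemma nrm1_le_if_weak:
  assumes f: "f \<in> per N" and le: "ip (A f) f \<le> B * nrm1 f" and B: "0 \<le> B"
  shows "nrm1 f \<le> 2 * B"
proof (cases "nrm1 f = 0")
  case False
  have "nrm1 f * nrm1 f \<le> 2 * B * nrm1 f"
    using coercive[OF f] le nrm1_sq[of f] by (simp add: power2_eq_square)
  then show ?thesis using False nrm1_nonneg[of f] by simp
qed (use B in simp)

lemma A_inj:
  assumes f: "f \<in> per N" and z: "A f = 0"
  shows "f = 0"
proof (rule per_eqI[OF f per_zero N_pos])
  fix k assume k: "k < N"
  have "e0 f \<le> 0" using coercive[OF f] e1_nonneg[of f] by (simp add: z ip_def)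
  then have "(\<Sum>k<N. h * (f (int k))\<^sup>2) \<le> 0"
    using e0_le[of f] a1_pos by (meson mult_nonneg_nonpos less_imp_le order_trans)
  moreover have "h * (f (int k))\<^sup>2 \<le> (\<Sum>k<N. h * (f (int k))\<^sup>2)"
    using k h_pos by (intro member_le_sum[where f = "\<lambda>k. h * (f (int k))\<^sup>2"]) auto
  ultimately have "h * (f (int k))\<^sup>2 \<le> 0" by linarith
  then show "f (int k) = 0 (int k)" using h_pos by (simp add: mult_le_0_iff)
qed

lemma fdiff_L1: "(\<Sum>k<N. \<bar>f (int k + 1) - f (int k)\<bar>) \<le> sqrt (len * e1 f)"
proof -
  have "(\<Sum>k<N. \<bar>f (int k + 1) - f (int k)\<bar>) = (\<Sum>k<N. \<bar>sqrt h\<bar> * \<bar>sqrt h * fdiff h f (int k)\<bar>)"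
    using h_pos by (intro sum.cong) (simp_all add: fdiff_def abs_mult flip: mult.assoc)
  also have "\<dots> \<le> L2_set (\<lambda>k. sqrt h) {..<N} * sqrt (e1 f)"
    unfolding sqrt_e1_L2 by (rule L2_set_mult_ineq)
  also have "\<dots> = sqrt (len * e1 f)"
    using h_pos circumference by (simp add: L2_set_def real_sqrt_mult)
  finally show ?thesis .
qed

lemma oscillation: "j < N \<Longrightarrow> k < N \<Longrightarrow> \<bar>f (int j) - f (int k)\<bar> \<le> sqrt (len * e1 f)"
proof (induction j k rule: linorder_wlog)
  case (le j k)
  have "f (int k) - f (int j) = (\<Sum>i\<in>{j..<k}. f (int (Suc i)) - f (int i))"
    using le by (subst sum_Suc_diff'[of j k "\<lambda>i. f (int i)"]) auto
  then have "\<bar>f (int j) - f (int k)\<bar> = \<bar>\<Sum>i\<in>{j..<k}. f (int i + 1) - f (int i)\<bar>"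
    by (simp add: abs_minus_commute add.commute)
  also have "\<dots> \<le> (\<Sum>i\<in>{j..<k}. \<bar>f (int i + 1) - f (int i)\<bar>)" by (rule sum_abs)
  also have "\<dots> \<le> (\<Sum>i<N. \<bar>f (int i + 1) - f (int i)\<bar>)" using le by (intro sum_mono2) auto
  finally show ?case using fdiff_L1[of f] by linarith
qed (simp add: abs_minus_commute)

text \<open>The value \<open>f k\<close> is compared with every \<open>f j\<close> through the total
  variation, and the result is averaged over \<open>j\<close>. The factor
  \<open>2 * a1 / len\<close> turns the weighted \<open>e0\<close> into a mean of squares;
  \<open>2 * len\<close> comes from Cauchy-Schwarz for the variation.\<close>

lemma sobolev:
  assumes f: "f \<in> per N"
  shows "(f k)\<^sup>2 \<le> (2 * a1 / len + 2 * len) * (e0 f + e1 f)"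
proof -
  define k' where "k' = nat (k mod int N)"
  have k': "k' < N" "f (int k') = f k"
    using N_pos per_mod[OF f, of k] by (simp_all add: k'_def nat_less_iff)
  have "(f k)\<^sup>2 \<le> 2 * (f (int j))\<^sup>2 + 2 * (len * e1 f)" if "j < N" for j
  proof -
    have "\<bar>f k - f (int j)\<bar> \<le> sqrt (len * e1 f)" using oscillation[OF k'(1) that, of f] k'(2) by simp
    then have "(f k - f (int j))\<^sup>2 \<le> len * e1 f"
      by (metis e1_nonneg len_pos abs_le_square_iff abs_of_nonneg less_imp_le mult_nonneg_nonneg
          real_sqrt_ge_zero real_sqrt_pow2)
    moreover have "(f k)\<^sup>2 \<le> 2 * (f (int j))\<^sup>2 + 2 * (f k - f (int j))\<^sup>2"
      using zero_le_power2[of "f k - 2 * f (int j)"] by (simp add: power2_eq_square algebra_simps)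
    ultimately show ?thesis by linarith
  qed
  then have "h * (f k)\<^sup>2 \<le> h * (2 * (f (int j))\<^sup>2 + 2 * (len * e1 f))" if "j < N" for j
    using that h_pos by (intro mult_left_mono) auto
  then have "(\<Sum>j<N. h * (f k)\<^sup>2) \<le> (\<Sum>j<N. h * (2 * (f (int j))\<^sup>2 + 2 * (len * e1 f)))"
    by (intro sum_mono) auto
  also have "\<dots> = 2 * (\<Sum>j<N. h * (f (int j))\<^sup>2) + real N * h * (2 * (len * e1 f))"
    by (simp add: sum.distrib sum_distrib_left algebra_simps)
  also have "\<dots> \<le> 2 * (a1 * e0 f) + len * (2 * (len * e1 f))"
    using e0_le[of f] circumference by simp
  finally have "len * (f k)\<^sup>2 \<le> 2 * (a1 * e0 f) + len * (2 * (len * e1 f))"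
    by (simp add: circumference[symmetric])
  then have "(f k)\<^sup>2 \<le> 2 * a1 / len * e0 f + 2 * len * e1 f"
    using len_pos by (simp add: field_simps)
  also have "\<dots> \<le> (2 * a1 / len + 2 * len) * (e0 f + e1 f)"
    using len_pos a1_pos e0_nonneg[of f] e1_nonneg[of f] by (simp add: algebra_simps)
  finally show ?thesis .
qed

definition csob :: real where "csob = sqrt (2 * a1 / len + 2 * len)"

lemma csob_pos: "0 < csob"
  using a1_pos len_pos by (simp add: csob_def add_pos_pos)

lemma abs_le_nrm1:
  assumes "f \<in> per N"
  shows "\<bar>f k\<bar> \<le> csob * nrm1 f"
  using real_sqrt_le_mono[OF sobolev[OF assms, of k]]
  by (simp add: csob_def nrm1_def real_sqrt_mult)

end

section \<open>Energy estimates for the parabolic equation\<close>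

definition energy_weight :: "real \<Rightarrow> real \<Rightarrow> real" where
  "energy_weight a1 b1 = damping a1 b1 + 2 * a1 * b1\<^sup>2"

definition smoothing :: "real \<Rightarrow> real \<Rightarrow> real" where
  "smoothing a1 b1 = 2 * (1 + energy_weight a1 b1)"

context lattice_diffusion
begin

text \<open>Because of the drift, the Dirichlet energy alone need not decrease along the flow. The
  added multiple of \<open>e0\<close> restores monotonicity, and the sum stays equivalent to the
  square of \<open>nrm1\<close>.\<close>

definition energy :: "(int \<Rightarrow> real) \<Rightarrow> real" where
  "energy f = e1 f + energy_weight a1 b1 * e0 f"

lemma energy_weight_ge: "1 / 2 \<le> energy_weight a1 b1"
  using damping_ge a1_pos by (simp add: energy_weight_def add_increasing2)

lemma nrm1_sq_le_energy: "(nrm1 f)\<^sup>2 \<le> 2 * energy f"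
  using mult_right_mono[OF energy_weight_ge e0_nonneg[of f]] e1_nonneg[of f]
  by (simp add: nrm1_sq energy_def)

lemma energy_le: "2 * energy f \<le> smoothing a1 b1 * (nrm1 f)\<^sup>2"
  using e0_nonneg[of f] e1_nonneg[of f] mult_nonneg_nonneg[of "energy_weight a1 b1" "e1 f"] energy_weight_ge
  by (simp add: nrm1_sq energy_def smoothing_def algebra_simps)

lemma smoothing_ge: "2 \<le> smoothing a1 b1"
  using energy_weight_ge by (simp add: smoothing_def)

lemma energy_nonneg: "0 \<le> energy f"
  using nrm1_sq_le_energy[of f] by (smt (verit) zero_le_power2)

text \<open>The derivative of \<open>e1\<close> at \<open>f\<close> in the direction
  \<open>g\<close>, see \<open>e1_deriv\<close>.\<close>

definition de1 :: "(int \<Rightarrow> real) \<Rightarrow> (int \<Rightarrow> real) \<Rightarrow> real" where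
  "de1 f g = (\<Sum>k<N. 2 * h * fdiff h f (int k) * fdiff h g (int k))"

lemma e0_deriv:
  assumes "\<And>k. ((\<lambda>s. e s k) has_real_derivative e' k) (at s)"
  shows "((\<lambda>s. e0 (e s)) has_real_derivative 2 * ip (e s) e') (at s)"
  unfolding e0_eq ip_def sum_distrib_left
  by (intro DERIV_sum)
    (auto intro!: derivative_eq_intros assms simp: a_pos[THEN less_imp_neq, symmetric])

lemma e1_deriv:
  assumes "\<And>k. ((\<lambda>s. e s k) has_real_derivative e' k) (at s)"
  shows "((\<lambda>s. e1 (e s)) has_real_derivative de1 (e s) e') (at s)"
  unfolding e1_def de1_def fdiff_def using h_pos
  by (intro DERIV_sum) (auto intro!: derivative_eq_intros assms)

lemma energy_deriv:
  assumes "\<And>k. ((\<lambda>s. e s k) has_real_derivative e' k) (at s)"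
  shows "((\<lambda>s. energy (e s)) has_real_derivative de1 (e s) e' + energy_weight a1 b1 * (2 * ip (e s) e')) (at s)"
  unfolding energy_def by (intro DERIV_add DERIV_cmult e0_deriv e1_deriv assms)

lemma tendsto_e0: "(\<And>k. ((\<lambda>s. e s k) \<longlongrightarrow> f k) F) \<Longrightarrow> ((\<lambda>s. e0 (e s)) \<longlongrightarrow> e0 f) F"
  unfolding e0_eq by (intro tendsto_intros)

lemma tendsto_energy:
  assumes "\<And>k. ((\<lambda>s. e s k) \<longlongrightarrow> f k) F"
  shows "((\<lambda>s. energy (e s)) \<longlongrightarrow> energy f) F"
  unfolding energy_def e1_def fdiff_def using h_pos by (intro tendsto_intros tendsto_e0 assms) simp

lemma ip_diff_left: "ip (f - g) w = ip f w - ip g w"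
  and ip_minus_left: "ip (- f) w = - ip f w"
  by (simp_all add: ip_def algebra_simps sum_subtractf sum_negf)

lemma two_ip_le: "- 2 * ip f g \<le> e0 f + e0 g"
proof -
  have "- 2 * (h / a k * f k * g k) \<le> h / a k * (f k)\<^sup>2 + h / a k * (g k)\<^sup>2" for k
  proof -
    have "0 \<le> h / a k * (f k + g k)\<^sup>2" using h_pos a_pos[of k] by simp
    then show ?thesis by (simp add: power2_eq_square algebra_simps)
  qed
  then have "(\<Sum>k<N. - 2 * (h / a (int k) * f (int k) * g (int k)))
      \<le> (\<Sum>k<N. h / a (int k) * (f (int k))\<^sup>2 + h / a (int k) * (g (int k))\<^sup>2)"
    by (intro sum_mono)
  then show ?thesis unfolding e0_eq ip_def by (simp only: sum.distrib sum_distrib_left)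
qed

text \<open>In the forced case the term \<open>e0 f\<close> gained from coercivity is spent on the
  pairing with \<open>\<phi>\<close>; only the Dirichlet part of the dissipation survives.\<close>

lemma flow_e0_le:
  assumes f: "f \<in> per N"
  shows "2 * ip f (- A f - \<phi>) \<le> - e1 f + e0 \<phi>"
    and "2 * ip f (- A f) \<le> - (e0 f + e1 f)"
proof -
  show *: "2 * ip f (- A f) \<le> - (e0 f + e1 f)"
    using coercive[OF f] by (simp add: ip_minus_left ip_commute[of f])
  have "2 * ip f (- A f - \<phi>) = 2 * ip f (- A f) - 2 * ip \<phi> f"
    by (simp add: ip_diff_left ip_commute[of f])
  also have "\<dots> \<le> - e1 f + e0 \<phi>" using * two_ip_le[of \<phi> f] by linarith
  finally show "2 * ip f (- A f - \<phi>) \<le> - e1 f + e0 \<phi>" .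
qed

text \<open>The equation is tested with \<open>f'\<close>. The damping part of
  \<open>energy_weight\<close> cancels the pairing of \<open>f\<close> with \<open>f'\<close>; its
  part \<open>2 * a1 * b1\<^sup>2\<close> uses the decay of \<open>e0\<close> to absorb the
  Dirichlet energy produced by the drift. Drift and forcing each take \<open>e0 f' / 2\<close> from
  the available \<open>2 * e0 f'\<close>, which leaves one copy.\<close>

lemma flow_energy_le:
  assumes f: "f \<in> per N" and \<phi>: "\<phi> \<in> per N" and f': "f' = - A f - \<phi>"
  shows "de1 f f' + energy_weight a1 b1 * (2 * ip f f')
    \<le> - e0 f' + (2 + 2 * a1 * b1\<^sup>2) * e0 \<phi>"
proof -
  have f'_per: "f' \<in> per N" unfolding f' using A_per[OF f] \<phi> by (simp add: per_def)
  define D where "D = (\<Sum>k<N. 2 * h * b (int k) * cdiff h f (int k) * f' (int k))"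
  have eq: "h * lap h f k * f' k = h / a k * f' k * f' k + h / a k * \<phi> k * f' k
      + damping a1 b1 * (h / a k * f k * f' k) - h * b k * cdiff h f k * f' k" for k
  proof -
    have "a k * lap h f k = f' k + \<phi> k + damping a1 b1 * f k - a k * b k * cdiff h f k"
      by (simp add: f' A_def algebra_simps)
    then have "h / a k * f' k * (a k * lap h f k)
        = h / a k * f' k * (f' k + \<phi> k + damping a1 b1 * f k - a k * b k * cdiff h f k)" by simp
    then show ?thesis using a_pos[of k] by (simp add: field_simps)
  qed
  have "(\<Sum>k<N. h * lap h f (int k) * f' (int k))
      = ip f' f' + ip \<phi> f' + damping a1 b1 * ip f f' - D / 2"
    unfolding eq ip_def D_def
    by (simp add: sum.distrib sum_subtractf sum_distrib_left sum_divide_distrib mult_ac)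
  moreover have "de1 f f' = - 2 * (\<Sum>k<N. h * lap h f (int k) * f' (int k))"
    using sum_lap_mult[OF f f'_per h_pos] by (simp add: de1_def sum_distrib_left mult.assoc sum_negf)
  ultimately have de1: "de1 f f' = - 2 * e0 f' - 2 * ip \<phi> f' - damping a1 b1 * (2 * ip f f') + D"
    by (simp add: e0_def)
  have "D \<le> e0 f' / 2 + 2 * a1 * b1\<^sup>2 * e1 f"
    unfolding D_def e0_eq using ip_drift_le[OF f, of 2] by simp
  moreover have "- 2 * ip \<phi> f' \<le> e0 f' / 2 + 2 * e0 \<phi>"
  proof -
    \<comment> \<open>Doubling \<open>\<phi>\<close> before the symmetric Young inequality and
      halving afterwards leaves only \<open>e0 f' / 2\<close> to be absorbed.\<close>
    have "- 2 * ip (\<lambda>k. 2 * \<phi> k) f' \<le> e0 (\<lambda>k. 2 * \<phi> k) + e0 f'" by (rule two_ip_le)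
    moreover have "ip (\<lambda>k. 2 * \<phi> k) f' = 2 * ip \<phi> f'" "e0 (\<lambda>k. 2 * \<phi> k) = 4 * e0 \<phi>"
      by (simp_all add: ip_def e0_def sum_distrib_left algebra_simps)
    ultimately show ?thesis by linarith
  qed
  moreover have "2 * a1 * b1\<^sup>2 * (2 * ip f f') \<le> 2 * a1 * b1\<^sup>2 * (- e1 f + e0 \<phi>)"
    using flow_e0_le(1)[OF f, of \<phi>] a1_pos by (intro mult_left_mono) (simp_all add: f')
  ultimately show ?thesis unfolding de1 energy_weight_def by (simp add: algebra_simps)
qed

text \<open>By \<open>flow_energy_le\<close> with its dissipation dropped, the energy starts at zero
  and grows at a rate of at most \<open>(2 + 2 * a1 * b1\<^sup>2) * F\<close>. The gain is one
  derivative: forcing bounded in \<open>nrm0\<close> controls the solution in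
  \<open>nrm1\<close>.\<close>

lemma duhamel_bound:
  assumes per: "\<And>s. 0 < s \<Longrightarrow> e s \<in> per N" "\<And>s. 0 < s \<Longrightarrow> \<phi> s \<in> per N"
    and deriv: "\<And>s k. 0 < s \<Longrightarrow> ((\<lambda>s. e s k) has_real_derivative (- A (e s) - \<phi> s) k) (at s)"
    and lim: "\<And>k. ((\<lambda>s. e s k) \<longlongrightarrow> 0) (at_right 0)"
    and le: "\<And>s. 0 < s \<Longrightarrow> e0 (\<phi> s) \<le> F" and s: "0 < s"
  shows "(nrm1 (e s))\<^sup>2 \<le> 2 * (2 + 2 * a1 * b1\<^sup>2) * s * F"
proof -
  define C where "C = (2 + 2 * a1 * b1\<^sup>2) * F"
  have "energy (e s) - C * s \<le> energy 0 - C * 0"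
  proof (rule le_limit_at_right_0[OF _ _ _ s, where y' = "\<lambda>s. de1 (e s) (- A (e s) - \<phi> s)
        + energy_weight a1 b1 * (2 * ip (e s) (- A (e s) - \<phi> s)) - C"])
    show "((\<lambda>s. energy (e s) - C * s) has_real_derivative de1 (e s) (- A (e s) - \<phi> s)
        + energy_weight a1 b1 * (2 * ip (e s) (- A (e s) - \<phi> s)) - C) (at s)" if "0 < s" for s
      by (auto intro!: derivative_eq_intros energy_deriv deriv[OF that] simp: fun_Compl_def fun_diff_def)
    show "de1 (e s) (- A (e s) - \<phi> s)
        + energy_weight a1 b1 * (2 * ip (e s) (- A (e s) - \<phi> s)) - C \<le> 0" if "0 < s" for s
    proof -
      have "(2 + 2 * a1 * b1\<^sup>2) * e0 (\<phi> s) \<le> C"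
        unfolding C_def using le[OF that] a1_pos by (intro mult_left_mono) auto
      then show ?thesis
        using flow_energy_le[OF per[OF that] refl] e0_nonneg[of "- A (e s) - \<phi> s"] by linarith
    qed
    show "((\<lambda>s. energy (e s) - C * s) \<longlongrightarrow> energy 0 - C * 0) (at_right 0)"
      using lim by (intro tendsto_intros tendsto_energy) auto
  qed
  moreover have "energy 0 = 0" by (simp add: energy_def e0_eq e1_def fdiff_def)
  ultimately show ?thesis using nrm1_sq_le_energy[of "e s"] by (simp add: C_def algebra_simps)
qed

end

section \<open>Contraction and smoothing of the damped semigroup\<close>

text \<open>Resolvent and semigroup are given by their properties, so that the kernel of the problem
  can later be inserted for \<open>P\<close> without a matrix exponential. At time zero only the
  limit is prescribed.\<close>

locale diffusion_semigroup = lattice_diffusion +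
  fixes K :: "(int \<Rightarrow> real) \<Rightarrow> int \<Rightarrow> real" and P :: "real \<Rightarrow> (int \<Rightarrow> real) \<Rightarrow> int \<Rightarrow> real"
  assumes kernel_op_K: "kernel_op N K" and K_per: "f \<in> per N \<Longrightarrow> K f \<in> per N"
    and A_K: "f \<in> per N \<Longrightarrow> A (K f) = f" and K_A: "f \<in> per N \<Longrightarrow> K (A f) = f"
    and kernel_op_P: "0 < s \<Longrightarrow> kernel_op N (P s)"
    and P_per: "0 < s \<Longrightarrow> f \<in> per N \<Longrightarrow> P s f \<in> per N"
    and P_A: "0 < s \<Longrightarrow> f \<in> per N \<Longrightarrow> P s (A f) = A (P s f)"
    and P_add: "0 < s \<Longrightarrow> 0 < r \<Longrightarrow> f \<in> per N \<Longrightarrow> P (s + r) f = P s (P r f)"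
    and P_deriv: "0 < s \<Longrightarrow> f \<in> per N \<Longrightarrow>
      ((\<lambda>s. P s f k) has_real_derivative (- A (P s f)) k) (at s)"
    and P_lim: "f \<in> per N \<Longrightarrow> ((\<lambda>s. P s f k) \<longlongrightarrow> f k) (at_right 0)"
begin

lemma P_K: "0 < s \<Longrightarrow> f \<in> per N \<Longrightarrow> P s (K f) = K (P s f)"
  by (metis A_K K_A K_per P_A P_per)

lemma P_contraction:
  assumes s: "0 < s" and f: "f \<in> per N"
  shows "e0 (P s f) \<le> e0 f"
proof (rule le_limit_at_right_0[OF e0_deriv _ tendsto_e0 s])
  show "((\<lambda>s. P s f k) has_real_derivative (- A (P s f)) k) (at s)" if "0 < s" for s k
    using P_deriv[OF that f] .
  show "2 * ip (P s f) (- A (P s f)) \<le> 0" if "0 < s" for s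
    using flow_e0_le(2)[OF P_per[OF that f]] e0_nonneg[of "P s f"] e1_nonneg[of "P s f"] by linarith
  show "((\<lambda>s. P s f k) \<longlongrightarrow> f k) (at_right 0)" for k by (rule P_lim[OF f])
qed

lemma energy_P_deriv_le:
  assumes s: "0 < s" and f: "f \<in> per N"
  shows "de1 (P s f) (- A (P s f)) + energy_weight a1 b1 * (2 * ip (P s f) (- A (P s f)))
    \<le> - e0 (A (P s f))"
proof -
  have "e0 (- A (P s f)) = e0 (A (P s f))" by (simp add: e0_eq)
  then show ?thesis
    using flow_energy_le[OF P_per[OF s f] per_zero, of "- A (P s f)"] by (simp add: e0_eq)
qed

text \<open>The quantity \<open>s * energy (P s f) + C * e0 (P s f)\<close> is nonincreasing:
  differentiating the time weight releases one copy of the energy, at most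
  \<open>C * (nrm1 (P s f))\<^sup>2\<close>, and this is covered by the dissipation of
  \<open>C * e0\<close>. The size of \<open>smoothing\<close> is dictated by this
  requirement.\<close>

lemma P_smoothing:
  assumes s: "0 < s" and f: "f \<in> per N"
  shows "(nrm1 (P s f))\<^sup>2 \<le> smoothing a1 b1 / s * (nrm0 f)\<^sup>2"
proof -
  define C where "C = smoothing a1 b1 / 2"
  have "s * energy (P s f) + C * e0 (P s f) \<le> 0 * energy f + C * e0 f"
  proof (rule le_limit_at_right_0[OF _ _ _ s, where y' = "\<lambda>s. energy (P s f)
       + s * (de1 (P s f) (- A (P s f)) + energy_weight a1 b1 * (2 * ip (P s f) (- A (P s f))))
       + C * (2 * ip (P s f) (- A (P s f)))"])
    show "((\<lambda>s. s * energy (P s f) + C * e0 (P s f)) has_real_derivative energy (P s f)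
       + s * (de1 (P s f) (- A (P s f)) + energy_weight a1 b1 * (2 * ip (P s f) (- A (P s f))))
       + C * (2 * ip (P s f) (- A (P s f)))) (at s)" if "0 < s" for s
      by (auto intro!: derivative_eq_intros energy_deriv e0_deriv P_deriv[OF that f]
        simp: fun_Compl_def algebra_simps)
    show "energy (P s f)
       + s * (de1 (P s f) (- A (P s f)) + energy_weight a1 b1 * (2 * ip (P s f) (- A (P s f))))
       + C * (2 * ip (P s f) (- A (P s f))) \<le> 0" if "0 < s" for s
    proof -
      have "s * (de1 (P s f) (- A (P s f)) + energy_weight a1 b1 * (2 * ip (P s f) (- A (P s f)))) \<le> 0"
        using energy_P_deriv_le[OF that f] e0_nonneg[of "A (P s f)"] that
        by (intro mult_nonneg_nonpos) auto
      moreover have "C * (2 * ip (P s f) (- A (P s f))) \<le> C * (- (nrm1 (P s f))\<^sup>2)"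
        using flow_e0_le(2)[OF P_per[OF that f]] smoothing_ge
        by (intro mult_left_mono) (simp_all add: nrm1_sq C_def)
      moreover have "energy (P s f) \<le> C * (nrm1 (P s f))\<^sup>2"
        using energy_le[of "P s f"] by (simp add: C_def)
      ultimately show ?thesis by simp
    qed
    show "((\<lambda>s. s * energy (P s f) + C * e0 (P s f)) \<longlongrightarrow> 0 * energy f + C * e0 f) (at_right 0)"
      by (intro tendsto_intros tendsto_energy tendsto_e0 P_lim f)
  qed
  moreover have "0 \<le> C * e0 (P s f)" using smoothing_ge e0_nonneg by (simp add: C_def)
  ultimately have "s * energy (P s f) \<le> C * e0 f" by linarith
  moreover have "s * (nrm1 (P s f))\<^sup>2 \<le> s * (2 * energy (P s f))"
    using nrm1_sq_le_energy s by (intro mult_left_mono) auto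
  ultimately have "s * (nrm1 (P s f))\<^sup>2 \<le> smoothing a1 b1 * (nrm0 f)\<^sup>2"
    by (simp add: C_def nrm0_sq)
  then show ?thesis using s by (simp add: field_simps)
qed

text \<open>The same device one order higher: in \<open>s * e0 (A (P s f)) + energy (P s f)\<close>
  the time weight releases \<open>e0 (A (P s f))\<close>, which is covered by the dissipation of the
  energy.\<close>

lemma A_P_smoothing:
  assumes s: "0 < s" and f: "f \<in> per N"
  shows "(nrm0 (A (P s f)))\<^sup>2 \<le> smoothing a1 b1 / s * (nrm1 f)\<^sup>2"
proof -
  define y' where "y' s = e0 (A (P s f)) + s * (2 * ip (A (P s f)) (- A (A (P s f))))
    + (de1 (P s f) (- A (P s f)) + energy_weight a1 b1 * (2 * ip (P s f) (- A (P s f))))" for s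
  have Af: "A f \<in> per N" by (rule A_per[OF f])
  have AP: "A (P s f) = P s (A f)" if "0 < s" for s using P_A[OF that f] by simp
  have "s * e0 (P s (A f)) + energy (P s f) \<le> 0 * e0 (A f) + energy f"
  proof (rule le_limit_at_right_0[OF _ _ _ s, where y' = y'])
    show "((\<lambda>s. s * e0 (P s (A f)) + energy (P s f)) has_real_derivative y' s) (at s)" if "0 < s" for s
    proof (rule DERIV_cong[OF DERIV_add[OF DERIV_mult'[OF DERIV_ident
            e0_deriv[OF P_deriv[OF that Af]]] energy_deriv[OF P_deriv[OF that f]]]])
      show "s * (2 * ip (P s (A f)) (- A (P s (A f)))) + 1 * e0 (P s (A f))
        + (de1 (P s f) (- A (P s f)) + energy_weight a1 b1 * (2 * ip (P s f) (- A (P s f)))) = y' s"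
        unfolding y'_def AP[OF that] by linarith
    qed
    show "y' s \<le> 0" if "0 < s" for s
    proof -
      have "s * (2 * ip (A (P s f)) (- A (A (P s f)))) \<le> 0"
        using flow_e0_le(2)[OF A_per[OF P_per[OF that f]]] that
          e0_nonneg[of "A (P s f)"] e1_nonneg[of "A (P s f)"]
        by (intro mult_nonneg_nonpos) auto
      then show ?thesis unfolding y'_def using energy_P_deriv_le[OF that f] by linarith
    qed
    show "((\<lambda>s. s * e0 (P s (A f)) + energy (P s f)) \<longlongrightarrow> 0 * e0 (A f) + energy f) (at_right 0)"
      by (intro tendsto_intros tendsto_energy tendsto_e0 P_lim f Af)
  qed
  then have "2 * (s * e0 (A (P s f))) \<le> 2 * energy f" using energy_nonneg[of "P s f"] AP[OF s] by simp
  also have "\<dots> \<le> smoothing a1 b1 * (nrm1 f)\<^sup>2" by (rule energy_le)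
  finally have "2 * (s * (nrm0 (A (P s f)))\<^sup>2) \<le> smoothing a1 b1 * (nrm1 f)\<^sup>2" by (simp add: nrm0_sq)
  then have "s * (nrm0 (A (P s f)))\<^sup>2 \<le> smoothing a1 b1 * (nrm1 f)\<^sup>2"
    using mult_nonneg_nonneg[OF less_imp_le[OF s] zero_le_power2[of "nrm0 (A (P s f))"]] by linarith
  then show ?thesis using s by (simp add: field_simps)
qed

lemma A_pow_per: "f \<in> per N \<Longrightarrow> (A ^^ k) f \<in> per N"
  by (induction k) (simp_all add: A_per)

text \<open>The time is cut into \<open>2 * k + 1\<close> pieces of length \<open>s\<close>. One
  piece leads from \<open>nrm0\<close> to \<open>nrm1\<close>; each power of \<open>A\<close> uses
  two more, \<open>A_P_smoothing\<close> to land in \<open>nrm0\<close> and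
  \<open>P_smoothing\<close> to return to \<open>nrm1\<close>.\<close>

lemma A_pow_P:
  assumes s: "0 < s" and f: "f \<in> per N"
  shows "(nrm1 ((A ^^ k) (P (real (2 * k + 1) * s) f)))\<^sup>2 \<le> (smoothing a1 b1 / s) ^ (2 * k + 1) * (nrm0 f)\<^sup>2"
proof (induction k)
  case 0
  then show ?case using P_smoothing[OF s f] by simp
next
  case (Suc k)
  define r where "r = real (2 * k + 1) * s"
  define w where "w = (A ^^ k) (P r f)"
  have r: "0 < r" using s by (simp add: r_def)
  have w: "w \<in> per N" unfolding w_def by (intro A_pow_per P_per r f)
  have comm: "(A ^^ j) (P s g) = P s ((A ^^ j) g)" if "g \<in> per N" for g j
    by (induction j) (simp_all add: P_A[OF s A_pow_per[OF that], symmetric])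
  have time: "real (2 * Suc k + 1) * s = s + (s + r)" by (simp add: r_def algebra_simps)
  have "(A ^^ Suc k) (P (real (2 * Suc k + 1) * s) f) = (A ^^ Suc k) (P s (P s (P r f)))"
    unfolding time using P_add[of s "s + r" f] P_add[of s r f] s r f by simp
  also have "\<dots> = P s (A (P s w))"
    using comm[of "P s (P r f)" "Suc k"] comm[of "P r f" k] P_per[OF r f] P_per[OF s P_per[OF r f]]
    by (simp add: w_def)
  finally have eq: "(A ^^ Suc k) (P (real (2 * Suc k + 1) * s) f) = P s (A (P s w))" .
  have C: "0 \<le> smoothing a1 b1 / s" using smoothing_ge s by simp
  have "(nrm1 (P s (A (P s w))))\<^sup>2 \<le> smoothing a1 b1 / s * (nrm0 (A (P s w)))\<^sup>2"
    by (rule P_smoothing[OF s A_per[OF P_per[OF s w]]])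
  also have "\<dots> \<le> smoothing a1 b1 / s * (smoothing a1 b1 / s * (nrm1 w)\<^sup>2)"
    by (intro mult_left_mono A_P_smoothing s w C)
  also have "\<dots> \<le> smoothing a1 b1 / s * (smoothing a1 b1 / s *
      ((smoothing a1 b1 / s) ^ (2 * k + 1) * (nrm0 f)\<^sup>2))"
    using Suc.IH by (intro mult_left_mono C) (simp add: w_def r_def)
  finally show ?case unfolding eq by (simp add: algebra_simps)
qed

end

definition smoothing_const :: "real \<Rightarrow> real \<Rightarrow> nat \<Rightarrow> real \<Rightarrow> real" where
  "smoothing_const a1 b1 k s = sqrt ((smoothing a1 b1 * real (2 * k + 1) / s) ^ (2 * k + 1))"

lemma (in diffusion_semigroup) nrm1_A_pow_P:
  assumes s: "0 < s" and f: "f \<in> per N"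
  shows "nrm1 ((A ^^ k) (P s f)) \<le> smoothing_const a1 b1 k s * nrm0 f"
proof -
  define r where "r = s / real (2 * k + 1)"
  have r: "0 < r" "real (2 * k + 1) * r = s" "smoothing a1 b1 / r = smoothing a1 b1 * real (2 * k + 1) / s"
    using s by (simp_all add: r_def field_simps)
  have "sqrt ((nrm1 ((A ^^ k) (P s f)))\<^sup>2) \<le> sqrt ((smoothing a1 b1 / r) ^ (2 * k + 1) * (nrm0 f)\<^sup>2)"
    using A_pow_P[OF r(1) f, of k] unfolding r(2) by (rule real_sqrt_le_mono)
  then show ?thesis
    unfolding r(3) real_sqrt_mult smoothing_const_def by (simp add: nrm0_nonneg nrm1_nonneg)
qed

section \<open>Comparison of two levels\<close>

text \<open>The weights are the descending half of a hat function;
  \<open>sum_second_difference_up\<close> has the ascending half. When the two are joined at a node,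
  the slope terms there cancel and the second difference with step \<open>n\<close> remains.\<close>

lemma sum_second_difference_down:
  fixes v :: "int \<Rightarrow> real"
  shows "(\<Sum>i<n. (real n - real i) * (v (c + int i + 1) + v (c + int i - 1) - 2 * v (c + int i)))
    = v (c + int n) - v c - real n * (v c - v (c - 1))"
proof (induction n)
  case (Suc n)
  define d where "d i = v (c + int i + 1) + v (c + int i - 1) - 2 * v (c + int i)" for i
  have S: "(\<Sum>i<m. d i) = v (c + int m) - v (c + int m - 1) - (v c - v (c - 1))" for m
    by (induction m) (simp_all add: d_def algebra_simps)
  have "(\<Sum>i<Suc n. (real (Suc n) - real i) * d i) = (\<Sum>i<Suc n. (real n - real i) * d i + d i)"
    by (intro sum.cong refl) (simp add: algebra_simps)
  also have "\<dots> = (\<Sum>i<n. (real n - real i) * d i) + (\<Sum>i<Suc n. d i)"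
    by (simp only: sum.distrib) simp
  finally have "(\<Sum>i<Suc n. (real (Suc n) - real i) * d i) = (\<Sum>i<n. (real n - real i) * d i) + (\<Sum>i<Suc n. d i)" .
  then show ?case using Suc.IH S[of "Suc n"] unfolding d_def[symmetric] by (simp add: algebra_simps)
qed simp

lemma sum_second_difference_up:
  fixes v :: "int \<Rightarrow> real"
  shows "(\<Sum>i<n. real i * (v (c + int i + 1) + v (c + int i - 1) - 2 * v (c + int i)))
    = v c - v (c + int n) + real n * (v (c + int n) - v (c + int n - 1))"
  by (induction n) (simp_all add: algebra_simps)

text \<open>Within one cell of the coarse lattice, the variation of the slope is controlled by the second
  differences at the interior nodes only.\<close>

definition interior_variation :: "nat \<Rightarrow> (nat \<Rightarrow> real) \<Rightarrow> real" where
  "interior_variation M w = (\<Sum>l<M. if l = 0 then 0 else \<bar>w (l + 1) + w (l - 1) - 2 * w l\<bar>)"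

lemma slope_variation:
  fixes w :: "nat \<Rightarrow> real"
  assumes "i < M"
  shows "\<bar>(w (Suc i) - w i) - (w 1 - w 0)\<bar> \<le> interior_variation M w"
proof -
  define d where "d l = (if l = 0 then 0 else w (l + 1) + w (l - 1) - 2 * w l)" for l
  have "(w (Suc i) - w i) - (w 1 - w 0) = (\<Sum>l<Suc i. d l)"
    by (induction i) (simp_all add: d_def algebra_simps)
  also have "\<bar>\<dots>\<bar> \<le> (\<Sum>l<Suc i. \<bar>d l\<bar>)" by (rule sum_abs)
  also have "\<dots> \<le> (\<Sum>l<M. \<bar>d l\<bar>)" using assms by (intro sum_mono2) auto
  also have "\<dots> = interior_variation M w"
    unfolding interior_variation_def d_def by (intro sum.cong) auto
  finally show ?thesis .
qed

text \<open>The affine part with slope \<open>w 1 - w 0\<close> is reproduced by interpolation.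
  There remain two sums of slope deviations, up to \<open>M\<close> and up to \<open>i\<close>, each
  at most \<open>real M * interior_variation M w\<close>.\<close>

lemma linear_interpolation_error:
  fixes w :: "nat \<Rightarrow> real"
  assumes M: "0 < M" and i: "i \<le> M"
  shows "\<bar>(1 - real i / real M) * w 0 + real i / real M * w M - w i\<bar> \<le> 2 * (real M * interior_variation M w)"
proof -
  define S where "S = interior_variation M w"
  define e where "e l = (w (Suc l) - w l) - (w 1 - w 0)" for l
  have w: "w n = w 0 + real n * (w 1 - w 0) + (\<Sum>l<n. e l)" for n
    by (induction n) (simp_all add: e_def algebra_simps)
  have e: "\<bar>\<Sum>l<n. e l\<bar> \<le> real M * S" if "n \<le> M" for n
  proof -
    have "\<bar>\<Sum>l<n. e l\<bar> \<le> (\<Sum>l<n. \<bar>e l\<bar>)" by (rule sum_abs)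
    also have "\<dots> \<le> (\<Sum>l<M. \<bar>e l\<bar>)" using that by (intro sum_mono2) auto
    also have "\<dots> \<le> (\<Sum>l<M. S)"
      unfolding e_def S_def by (intro sum_mono slope_variation) auto
    finally show ?thesis by simp
  qed
  define \<theta> where "\<theta> = real i / real M"
  have \<theta>: "0 \<le> \<theta>" "\<theta> \<le> 1" "real i = \<theta> * real M" using M i by (simp_all add: \<theta>_def)
  have "(1 - \<theta>) * w 0 + \<theta> * w M - w i = \<theta> * (\<Sum>l<M. e l) - (\<Sum>l<i. e l)"
    unfolding w[of M] w[of i] \<theta>(3) by (simp add: algebra_simps)
  also have "\<bar>\<dots>\<bar> \<le> \<theta> * \<bar>\<Sum>l<M. e l\<bar> + \<bar>\<Sum>l<i. e l\<bar>"
    using \<theta>(1) abs_triangle_ineq4[of "\<theta> * (\<Sum>l<M. e l)" "\<Sum>l<i. e l"] by (simp add: abs_mult)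
  also have "\<dots> \<le> 1 * (real M * S) + real M * S"
    using \<theta> e[of M] e[OF i] by (intro add_mono mult_mono) auto
  finally show ?thesis by (simp add: \<theta>_def S_def)
qed

text \<open>Forward differences telescope over a cell, which allows \<open>Q1_le\<close> to compare
  the coarse and the fine drift form cell by cell.\<close>

lemma sum_mult_centered_difference:
  assumes B: "B \<in> per N" and v: "v \<in> per N"
  shows "(\<Sum>k<N. B (int k) * (v (int k + 1) - v (int k - 1)))
    = (\<Sum>k<N. (B (int k) + B (int k + 1)) * (v (int k + 1) - v (int k)))"
proof -
  define F where "F k = B k * (v k - v (k - 1))" for k
  have F: "F \<in> per N" using B v unfolding per_def F_def by clarsimp (metis diff_add_eq)
  have "B k * (v (k + 1) - v (k - 1)) = (B k + B (k + 1)) * (v (k + 1) - v k) - (F (k + 1) - F k)" for k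
    by (simp add: F_def algebra_simps)
  then show ?thesis using sum_per_shift1[OF F] by (simp add: sum_subtractf)
qed

text \<open>One coarse step consists of \<open>M\<close> fine steps. The moduli reach a full coarse
  step to either side of a coarse node, because both end nodes of a cell serve as reference
  points.\<close>

locale two_level =
  C: lattice_diffusion N h a b a0 a1 b1 len +
  F: lattice_diffusion "N * M" "h / real M" a' b' a0 a1 b1 len
  for N h a b a0 a1 b1 len M a' b' +
  fixes \<omega> :: real
  assumes a_eq: "a k = a' (k * int M)" and b_eq: "b k = b' (k * int M)"
    and a_modulus: "\<bar>j - k * int M\<bar> \<le> int M \<Longrightarrow> \<bar>1 / a' j - 1 / a' (k * int M)\<bar> \<le> \<omega>"
    and b_modulus: "\<bar>j - k * int M\<bar> \<le> int M \<Longrightarrow> \<bar>b' j - b' (k * int M)\<bar> \<le> \<omega>"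
begin

lemma M_pos: "0 < M"
  using F.N_pos by simp

lemma \<omega>_nonneg: "0 \<le> \<omega>"
  using a_modulus[of 0 0] by simp

section \<open>Restriction, piecewise linear extension and its weighted adjoint\<close>

definition R :: "(int \<Rightarrow> real) \<Rightarrow> int \<Rightarrow> real" where
  "R v k = v (k * int M)"

definition E :: "(int \<Rightarrow> real) \<Rightarrow> int \<Rightarrow> real" where
  "E g j = (1 - real_of_int (j mod int M) / real M) * g (j div int M)
    + real_of_int (j mod int M) / real M * g (j div int M + 1)"

text \<open>The adjoint of the piecewise linear extension \<open>E\<close> for the two weighted inner products, see
  \<open>ip_I\<close> below.\<close>

definition I :: "(int \<Rightarrow> real) \<Rightarrow> int \<Rightarrow> real" where
  "I \<phi> k = a k / real M *
    ((\<Sum>i<M. (1 - real i / real M) * (\<phi> (k * int M + int i) / a' (k * int M + int i)))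
     + (\<Sum>i<M. real i / real M * (\<phi> ((k - 1) * int M + int i) / a' ((k - 1) * int M + int i))))"

lemma per_fine: "f \<in> per (N * M) \<Longrightarrow> f ((k + int N) * int M + j) = f (k * int M + j)"
  using perD[of f "N * M" "k * int M + j"] by (simp add: algebra_simps)

lemma R_per: "v \<in> per (N * M) \<Longrightarrow> R v \<in> per N"
  using per_fine[of v _ 0] by (auto simp: R_def intro!: perI)

lemma I_per:
  assumes \<phi>: "\<phi> \<in> per (N * M)"
  shows "I \<phi> \<in> per N"
proof (rule perI)
  fix k
  show "I \<phi> (k + int N) = I \<phi> k"
    using per_fine[OF \<phi>, of "k - 1"] per_fine[OF F.a_per, of "k - 1"]
    by (simp add: I_def per_fine[OF \<phi>] per_fine[OF F.a_per] perD[OF C.a_per] diff_add_eq)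
qed

lemma E_cell:
  assumes "i \<le> M"
  shows "E g (k * int M + int i) = (1 - real i / real M) * g k + real i / real M * g (k + 1)"
proof (cases "i = M")
  case True
  have "E g ((k + 1) * int M) = g (k + 1)" using M_pos by (simp add: E_def)
  then show ?thesis using True M_pos by (simp add: algebra_simps)
next
  case False
  then have "i < M" using assms by simp
  then show ?thesis by (simp add: E_def)
qed

lemma E_per:
  assumes g: "g \<in> per N"
  shows "E g \<in> per (N * M)"
proof (rule perI)
  fix j
  have "(j + int (N * M)) div int M = j div int M + int N" "(j + int (N * M)) mod int M = j mod int M"
    using M_pos by simp_all
  moreover have "g (j div int M + int N + 1) = g (j div int M + 1)"
    using perD[OF g, of "j div int M + 1"] by (simp add: algebra_simps)
  ultimately show "E g (j + int (N * M)) = E g j" unfolding E_def using perD[OF g] by simp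
qed

lemma sum_cells: "(\<Sum>j<N * M. f (int j)) = (\<Sum>k<N. \<Sum>i<M. f (int k * int M + int i))"
proof -
  have "(\<Sum>j<N * M. f (int j)) = (\<Sum>k<N. \<Sum>j\<in>{k * M..<k * M + M}. f (int j))"
    by (rule sum.nat_group[symmetric])
  also have "\<dots> = (\<Sum>k<N. \<Sum>i<M. f (int k * int M + int i))"
  proof (rule sum.cong[OF refl])
    fix k
    show "(\<Sum>j\<in>{k * M..<k * M + M}. f (int j)) = (\<Sum>i<M. f (int k * int M + int i))"
      by (rule sum.reindex_bij_witness[of _ "\<lambda>i. k * M + i" "\<lambda>j. j - k * M"]) auto
  qed
  finally show ?thesis .
qed

lemma kernel_op_I: "kernel_op (N * M) I"
proof -
  have eq: "I = (\<lambda>\<phi> k. a k / real M *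
    ((\<Sum>i<M. ((1 - real i / real M) / a' (k * int M + int i)) * \<phi> (k * int M + int i))
     + (\<Sum>i<M. (real i / real M / a' ((k - 1) * int M + int i)) * \<phi> ((k - 1) * int M + int i))))"
    by (intro ext) (simp add: I_def)
  show ?thesis unfolding eq
    by (intro kernel_op_mult kernel_op_plus2 kernel_op_sum kernel_op_eval[OF F.N_pos])
qed

lemma ip_I:
  assumes g: "g \<in> per N" and \<phi>: "\<phi> \<in> per (N * M)"
  shows "C.ip (I \<phi>) g = F.ip \<phi> (E g)"
proof -
  define \<psi> where "\<psi> j = \<phi> j / a' j" for j
  have \<psi>: "\<psi> \<in> per (N * M)" using \<phi> F.a_per by (simp add: per_def \<psi>_def)
  \<comment> \<open>\<open>G k\<close> is the share of the cell starting at node \<open>k\<close>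
    that belongs to its right end node. Shifting \<open>G (k - 1)\<close> to \<open>G k\<close>
    around the circle regroups the two sums of \<open>I\<close> by cells.\<close>
  define G where "G k = (\<Sum>i<M. h / real M * (real i / real M) * \<psi> (k * int M + int i)) * g (k + 1)" for k
  have G: "G \<in> per N"
  proof (rule perI)
    fix k
    have "g (k + int N + 1) = g (k + 1)" using perD[OF g, of "k + 1"] by (simp add: add_ac)
    then show "G (k + int N) = G k" by (simp only: G_def per_fine[OF \<psi>])
  qed
  have eq: "h / a k * I \<phi> k * g k
      = (\<Sum>i<M. h / real M * (1 - real i / real M) * \<psi> (k * int M + int i)) * g k + G (k - 1)" for k
    using C.a_pos[of k] by (simp add: I_def G_def \<psi>_def sum_distrib_left algebra_simps)
  have "C.ip (I \<phi>) g = (\<Sum>k<N. (\<Sum>i<M. h / real M * (1 - real i / real M) * \<psi> (int k * int M + int i)) * g (int k)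
      + G (int k))"
    unfolding C.ip_def eq using sum_per_shift_back[OF G] by (simp add: sum.distrib)
  also have "\<dots> = (\<Sum>k<N. \<Sum>i<M. h / real M * \<psi> (int k * int M + int i) * E g (int k * int M + int i))"
  proof (rule sum.cong[OF refl])
    fix k
    show "(\<Sum>i<M. h / real M * (1 - real i / real M) * \<psi> (int k * int M + int i)) * g (int k) + G (int k)
      = (\<Sum>i<M. h / real M * \<psi> (int k * int M + int i) * E g (int k * int M + int i))"
      unfolding G_def sum_distrib_right sum.distrib[symmetric]
      by (intro sum.cong refl) (simp only: E_cell lessThan_iff less_imp_le, simp add: algebra_simps)
  qed
  also have "\<dots> = F.ip \<phi> (E g)"
    unfolding F.ip_def sum_cells[of "\<lambda>j. h / real M / a' j * \<phi> j * E g j"] by (simp add: \<psi>_def)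
  finally show ?thesis .
qed

text \<open>The weight in \<open>I\<close> cancels \<open>a'\<close>, and a hat function is left,
  tested against fine second differences. A hat is discretely harmonic away from coarse nodes, so
  the principal part is transferred without error; only the zeroth-order and drift terms survive in
  \<open>consistency\<close>.\<close>

lemma I_lap: "I (\<lambda>j. a' j * lap (h / real M) v j) k = a k * lap h (R v) k"
proof -
  define c where "c = k * int M"
  define d where "d j = v (j + 1) + v (j - 1) - 2 * v j" for j
  have c': "(k - 1) * int M = c - int M" by (simp add: c_def algebra_simps)
  define r where "r = (real M)\<^sup>2 / h\<^sup>2"
  have lap: "lap (h / real M) v j = r * d j" for j
    using M_pos C.h_pos by (simp add: lap_def d_def r_def power_divide)
  have q: "a' j * x / a' j = x" for j x using F.a_pos[of j] by simp
  have "real M * ((\<Sum>i<M. (1 - real i / real M) * d (c + int i)) + (\<Sum>i<M. real i / real M * d (c - int M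
      + int i)))
      = (\<Sum>i<M. (real M - real i) * d (c + int i)) + (\<Sum>i<M. real i * d (c - int M + int i))"
    using M_pos by (simp add: sum_distrib_left distrib_left flip: mult.assoc) (simp add: algebra_simps)
  also have "\<dots> = v (c + int M) + v (c - int M) - 2 * v c"
    unfolding d_def using sum_second_difference_down[of M v c] sum_second_difference_up[of v "c - int M" M]
    by (simp add: algebra_simps)
  finally have main: "real M * ((\<Sum>i<M. (1 - real i / real M) * d (c + int i))
      + (\<Sum>i<M. real i / real M * d (c - int M + int i))) = v (c + int M) + v (c - int M) - 2 * v c" .
  have "I (\<lambda>j. a' j * lap (h / real M) v j) k = a k / real M * (r *
      ((\<Sum>i<M. (1 - real i / real M) * d (c + int i)) + (\<Sum>i<M. real i / real M * d (c - int M + int i))))"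
    unfolding I_def q c' c_def[symmetric] lap by (simp add: sum_distrib_left distrib_left mult_ac)
  also have "\<dots> = a k / h\<^sup>2 * (real M * ((\<Sum>i<M. (1 - real i / real M) * d (c + int i))
      + (\<Sum>i<M. real i / real M * d (c - int M + int i))))"
    using M_pos by (simp add: r_def power2_eq_square)
  also have "\<dots> = a k * lap h (R v) k"
    unfolding main
    by (simp add: lap_def R_def c_def algebra_simps add_divide_distrib diff_divide_distrib)
  finally show ?thesis .
qed

section \<open>Consistency errors of the mass and drift forms\<close>

text \<open>The quadrature error of the weighted mass form. Since \<open>I\<close> is adjoint to
  \<open>E\<close>, it is also the pairing of \<open>R v - I v\<close> with
  \<open>g\<close>.\<close>

definition Q0 :: "(int \<Rightarrow> real) \<Rightarrow> (int \<Rightarrow> real) \<Rightarrow> real" where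
  "Q0 v g = C.ip (R v) g - F.ip v (E g)"

definition Q1 :: "(int \<Rightarrow> real) \<Rightarrow> (int \<Rightarrow> real) \<Rightarrow> real" where
  "Q1 v g = (\<Sum>k<N. h * b (int k) * cdiff h (R v) (int k) * g (int k))
    - (\<Sum>j<N * M. h / real M * b' (int j) * cdiff (h / real M) v (int j) * E g (int j))"

lemma consistency:
  assumes v: "v \<in> per (N * M)" and g: "g \<in> per N"
  shows "C.ip (C.A (R v) - I (F.A v)) g = damping a1 b1 * Q0 v g - Q1 v g"
proof -
  have al: "(\<lambda>j. a' j * lap (h / real M) v j) \<in> per (N * M)"
    using F.a_per lap_per[OF v, of "h / real M"] by (rule per_cmult)
  have "(\<Sum>j<N * M. h / real M * lap (h / real M) v (int j) * E g (int j))
      = F.ip (\<lambda>j. a' j * lap (h / real M) v j) (E g)"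
    unfolding F.ip_def using F.a_pos by (intro sum.cong refl) (simp add: less_imp_neq[symmetric])
  also have "\<dots> = (\<Sum>k<N. h * lap h (R v) (int k) * g (int k))"
    unfolding ip_I[OF g al, symmetric] C.ip_def I_lap using C.a_pos
    by (intro sum.cong refl) (simp add: less_imp_neq[symmetric])
  finally show ?thesis
    unfolding C.ip_diff_left ip_I[OF g F.A_per[OF v]] C.ip_A F.ip_A Q0_def Q1_def
    by (simp add: algebra_simps)
qed

definition lap_interior :: "(int \<Rightarrow> real) \<Rightarrow> real" where
  "lap_interior v = sqrt (\<Sum>j<N * M. if M dvd j then 0 else h / real M * (lap (h / real M) v (int j))\<^sup>2)"

definition cell_variation :: "(int \<Rightarrow> real) \<Rightarrow> nat \<Rightarrow> real" where
  "cell_variation v k = (\<Sum>i<M. if i = 0 then 0 else h / real M * \<bar>lap (h / real M) v (int k * int M + int i)\<bar>)"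

definition cell_lap_sq :: "(int \<Rightarrow> real) \<Rightarrow> nat \<Rightarrow> real" where
  "cell_lap_sq v k = (\<Sum>i<M. if i = 0 then 0 else h / real M * (lap (h / real M) v (int k * int M + int i))\<^sup>2)"

lemma cell_variation_nonneg: "0 \<le> cell_variation v k"
  unfolding cell_variation_def using C.h_pos by (intro sum_nonneg) simp

lemma cell_lap_sq_nonneg: "0 \<le> cell_lap_sq v k"
  unfolding cell_lap_sq_def using C.h_pos by (intro sum_nonneg) simp

lemma lap_interior_eq: "lap_interior v = sqrt (\<Sum>k<N. cell_lap_sq v k)"
proof -
  have d: "M dvd k * M + i \<longleftrightarrow> i = 0" if "i < M" for k i
    using that by (auto simp: dvd_add_right_iff dest: dvd_imp_le)
  have "(\<Sum>j<N * M. if M dvd j then 0 else h / real M * (lap (h / real M) v (int j))\<^sup>2)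
    = (\<Sum>j<N * M. (\<lambda>j. if int M dvd j then 0 else h / real M * (lap (h / real M) v j)\<^sup>2) (int j))"
    by simp
  also have "\<dots> = (\<Sum>k<N. cell_lap_sq v k)"
    unfolding sum_cells[of "\<lambda>j. if int M dvd j then 0 else h / real M * (lap (h / real M) v j)\<^sup>2"]
      cell_lap_sq_def using d
    by (intro sum.cong refl) (metis (no_types, lifting) int_dvd_int_iff lessThan_iff of_nat_add of_nat_mult)
  finally show ?thesis by (simp add: lap_interior_def)
qed

lemma lap_interior_nonneg: "0 \<le> lap_interior v"
  unfolding lap_interior_eq by (simp add: sum_nonneg cell_lap_sq_nonneg)

lemma interior_variation_eq:
  "interior_variation M (\<lambda>i. v (int k * int M + int i)) = h / real M * cell_variation v k"
proof -
  have "\<bar>v (c + int (l + 1)) + v (c + int (l - 1)) - 2 * v (c + int l)\<bar>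
      = h / real M * (h / real M * \<bar>lap (h / real M) v (c + int l)\<bar>)" if "l \<noteq> 0" for l c
  proof -
    have h': "0 < h / real M" using C.h_pos M_pos by simp
    have l: "c + int (l + 1) = c + int l + 1" "c + int (l - 1) = c + int l - 1" using that by simp_all
    define x where "x = v (c + int l + 1) + v (c + int l - 1) - 2 * v (c + int l)"
    have "lap (h / real M) v (c + int l) = x / (h / real M)\<^sup>2" by (simp add: lap_def x_def)
    then have "\<bar>lap (h / real M) v (c + int l)\<bar> = \<bar>x\<bar> / (h / real M)\<^sup>2" by simp
    then show ?thesis unfolding l x_def[symmetric] using h'
      by (metis (no_types, lifting) less_imp_neq mult.assoc nonzero_mult_div_cancel_left
          power2_eq_square power_not_zero times_divide_eq_right)
  qed
  then show ?thesis
    unfolding interior_variation_def cell_variation_def sum_distrib_left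
    by (intro sum.cong refl) (simp add: if_distrib)
qed

lemma cell_variation_sq: "(cell_variation v k)\<^sup>2 \<le> h * cell_lap_sq v k"
proof -
  define x where "x i = (if i = 0 then 0 else \<bar>lap (h / real M) v (int k * int M + int i)\<bar>)" for i :: nat
  have "cell_variation v k = h / real M * (\<Sum>i<M. x i)"
    unfolding cell_variation_def sum_distrib_left x_def by (intro sum.cong) auto
  moreover have "(\<Sum>i<M. x i)\<^sup>2 \<le> real M * (\<Sum>i<M. (x i)\<^sup>2)"
    using sum_squared_le_sum_of_squares[of x "{..<M}"] by (simp add: mult.commute)
  moreover have "cell_lap_sq v k = h / real M * (\<Sum>i<M. (x i)\<^sup>2)"
    unfolding cell_lap_sq_def sum_distrib_left x_def by (intro sum.cong) auto
  ultimately show ?thesis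
    using mult_left_mono[of "(\<Sum>i<M. x i)\<^sup>2" "real M * (\<Sum>i<M. (x i)\<^sup>2)" "(h / real M)\<^sup>2"] M_pos
    by (simp add: power2_eq_square mult_ac)
qed

lemma cell_variation_le: "cell_variation v k \<le> sqrt h * sqrt (cell_lap_sq v k)"
  using real_sqrt_le_mono[OF cell_variation_sq[of v k]] cell_variation_nonneg[of v k]
  by (simp add: real_sqrt_mult)

lemma sum_cell_variation: "(\<Sum>k<N. cell_variation v k) \<le> sqrt len * lap_interior v"
proof -
  have "(\<Sum>k<N. cell_variation v k) \<le> (\<Sum>k<N. \<bar>sqrt h\<bar> * \<bar>sqrt (cell_lap_sq v k)\<bar>)"
    using cell_variation_le C.h_pos by (intro sum_mono) (simp add: cell_lap_sq_nonneg)
  also have "\<dots> \<le> L2_set (\<lambda>k. sqrt h) {..<N} * L2_set (\<lambda>k. sqrt (cell_lap_sq v k)) {..<N}"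
    by (rule L2_set_mult_ineq)
  also have "\<dots> = sqrt len * lap_interior v"
    using C.h_pos C.circumference by (simp add: L2_set_def lap_interior_eq cell_lap_sq_nonneg)
  finally show ?thesis .
qed

lemma sum_fdiff_cell_variation:
  "(\<Sum>k<N. h * \<bar>fdiff h g (int k)\<bar> * cell_variation v k) \<le> h * (C.nrm1 g * lap_interior v)"
proof -
  have "h * \<bar>fdiff h g (int k)\<bar> * cell_variation v k
      \<le> h * (\<bar>sqrt h * fdiff h g (int k)\<bar> * \<bar>sqrt (cell_lap_sq v k)\<bar>)" for k
    using mult_left_mono[OF cell_variation_le, of "h * \<bar>fdiff h g (int k)\<bar>" v k] C.h_pos
    by (simp add: cell_lap_sq_nonneg abs_mult mult_ac)
  then have "(\<Sum>k<N. h * \<bar>fdiff h g (int k)\<bar> * cell_variation v k)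
      \<le> h * (\<Sum>k<N. \<bar>sqrt h * fdiff h g (int k)\<bar> * \<bar>sqrt (cell_lap_sq v k)\<bar>)"
    unfolding sum_distrib_left by (intro sum_mono)
  also have "\<dots> \<le> h * (sqrt (C.e1 g) * L2_set (\<lambda>k. sqrt (cell_lap_sq v k)) {..<N})"
    unfolding C.sqrt_e1_L2 using C.h_pos by (intro mult_left_mono L2_set_mult_ineq) simp
  also have "L2_set (\<lambda>k. sqrt (cell_lap_sq v k)) {..<N} = lap_interior v"
    by (simp add: L2_set_def lap_interior_eq cell_lap_sq_nonneg)
  also have "h * (sqrt (C.e1 g) * lap_interior v) \<le> h * (C.nrm1 g * lap_interior v)"
    using C.h_pos by (intro mult_left_mono mult_right_mono lap_interior_nonneg)
      (simp_all add: C.nrm1_def C.e0_nonneg)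
  finally show ?thesis .
qed

lemma e1_R_le: "C.e1 (R v) \<le> F.e1 v"
proof -
  have "C.e1 (R v) \<le> (\<Sum>k<N. \<Sum>i<M. h / real M * (fdiff (h / real M) v (int k * int M + int i))\<^sup>2)"
    unfolding C.e1_def
  proof (rule sum_mono)
    fix k
    define d where "d i = v (int k * int M + int i + 1) - v (int k * int M + int i)" for i
    have "R v (int k + 1) - R v (int k) = (\<Sum>i<M. d i)"
      using sum_lessThan_telescope[of "\<lambda>i. v (int k * int M + int i)" M]
      by (simp add: R_def d_def algebra_simps)
    moreover have "(\<Sum>i<M. d i)\<^sup>2 \<le> real M * (\<Sum>i<M. (d i)\<^sup>2)"
      using sum_squared_le_sum_of_squares[of d "{..<M}"] by (simp add: mult.commute)
    ultimately have "h * (fdiff h (R v) (int k))\<^sup>2 \<le> real M * (\<Sum>i<M. (d i)\<^sup>2) / h"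
      using C.h_pos by (simp add: fdiff_def power2_eq_square divide_right_mono)
    also have "\<dots> = (\<Sum>i<M. h / real M * (fdiff (h / real M) v (int k * int M + int i))\<^sup>2)"
      unfolding sum_distrib_left sum_divide_distrib using C.h_pos M_pos
      by (intro sum.cong refl) (simp add: fdiff_def d_def power2_eq_square)
    finally show "h * (fdiff h (R v) (int k))\<^sup>2
      \<le> (\<Sum>i<M. h / real M * (fdiff (h / real M) v (int k * int M + int i))\<^sup>2)" .
  qed
  also have "\<dots> = F.e1 v"
    unfolding F.e1_def
    by (rule sum_cells[of "\<lambda>j. h / real M * (fdiff (h / real M) v j)\<^sup>2", symmetric])
  finally show ?thesis .
qed

text \<open>Linear interpolation changes the sum over a cell by a fixed multiple of
  \<open>F (k + 1) - F k\<close>, and these increments telescope around the circle. This places the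
  coarse mass form on the fine lattice, where it can be compared node by node.\<close>

lemma sum_interpolation:
  assumes F: "F \<in> per N"
  shows "(\<Sum>k<N. h * F (int k))
    = (\<Sum>k<N. \<Sum>i<M. h / real M * ((1 - real i / real M) * F (int k) + real i / real M * F (int k + 1)))"
proof -
  define \<theta> where "\<theta> = (\<Sum>i<M. real i / real M)"
  have cell: "(\<Sum>i<M. h / real M * ((1 - real i / real M) * x + real i / real M * y)) = h * x
      + h / real M * \<theta> * (y - x)" for x y
  proof -
    have "(\<Sum>i<M. h / real M * ((1 - real i / real M) * x + real i / real M * y))
        = (\<Sum>i<M. h / real M * x + real i / real M * (h / real M * (y - x)))"
      by (intro sum.cong refl) (simp add: algebra_simps add_divide_distrib diff_divide_distrib)
    also have "\<dots> = h * x + \<theta> * (h / real M * (y - x))"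
      unfolding sum.distrib \<theta>_def sum_distrib_right using M_pos by simp
    finally show ?thesis by simp
  qed
  show ?thesis
    unfolding cell unfolding sum.distrib sum_distrib_left[symmetric] sum_subtractf sum_per_shift1[OF F] by simp
qed

definition sup_bound :: "(int \<Rightarrow> real) \<Rightarrow> real \<Rightarrow> bool" where
  "sup_bound f B \<longleftrightarrow> (\<forall>k. \<bar>f k\<bar> \<le> B)"

lemma abs_interp_le:
  assumes "\<bar>x\<bar> \<le> B" "\<bar>y\<bar> \<le> B" "0 \<le> \<theta>" "\<theta> \<le> (1::real)"
  shows "\<bar>(1 - \<theta>) * x + \<theta> * y\<bar> \<le> B"
proof -
  have "\<bar>(1 - \<theta>) * x + \<theta> * y\<bar> \<le> (1 - \<theta>) * \<bar>x\<bar> + \<theta> * \<bar>y\<bar>"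
    using abs_triangle_ineq[of "(1 - \<theta>) * x" "\<theta> * y"] assms by (simp add: abs_mult)
  also have "\<dots> \<le> (1 - \<theta>) * B + \<theta> * B" using assms by (intro add_mono mult_left_mono) auto
  finally show ?thesis by (simp add: algebra_simps)
qed

text \<open>Three errors are separated: the change of \<open>1 / a\<close> within the cell,
  collected in \<open>T\<close>; the difference between interpolating a product and multiplying the
  interpolants, which is exactly \<open>\<theta> * (1 - \<theta>)\<close> times the two increments;
  and the interpolation error \<open>x\<close> of \<open>v\<close>, which involves interior second
  differences only.\<close>

lemma Q0_cell:
  assumes i: "i < M" and g: "sup_bound g G" and v: "sup_bound v V"
  shows "\<bar>((1 - real i / real M) * (1 / a k * g k * R v k) + real i / real M * (1 / a (k + 1) * g (k
      + 1) * R v (k + 1)))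
      - 1 / a' (k * int M + int i) * v (k * int M + int i) * E g (k * int M + int i)\<bar>
    \<le> \<omega> * (G * V) + (\<bar>g (k + 1) - g k\<bar> * \<bar>R v (k + 1) - R v k\<bar>
      + 2 * (G * (real M * interior_variation M (\<lambda>i. v (k * int M + int i))))) / a0"
proof -
  define \<theta> where "\<theta> = real i / real M"
  define w where "w i = v (k * int M + int i)" for i
  define c where "c = 1 / a' (k * int M + int i)"
  define S where "S = real M * interior_variation M w"
  define x where "x = (1 - \<theta>) * w 0 + \<theta> * w M - w i"
  define gt where "gt = (1 - \<theta>) * g k + \<theta> * g (k + 1)"
  have \<theta>: "0 \<le> \<theta>" "\<theta> \<le> 1" using i by (simp_all add: \<theta>_def)
  have Rv: "R v k = w 0" "R v (k + 1) = w M" by (simp_all add: R_def w_def algebra_simps)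
  have Eg: "E g (k * int M + int i) = gt" using i by (simp add: E_cell gt_def \<theta>_def)
  have G: "\<bar>g k\<bar> \<le> G" "\<bar>g (k + 1)\<bar> \<le> G" and V: "\<bar>w 0\<bar> \<le> V" "\<bar>w M\<bar> \<le> V"
    using g v by (simp_all add: sup_bound_def w_def)
  have G0: "0 \<le> G" and V0: "0 \<le> V" using G V by linarith+
  have gt: "\<bar>gt\<bar> \<le> G" unfolding gt_def by (rule abs_interp_le[OF G \<theta>])
  have c: "0 \<le> c" "c \<le> 1 / a0"
    using F.a_pos F.a_lower C.a0_pos by (simp_all add: c_def less_imp_le frac_le)
  have c0: "\<bar>1 / a k - c\<bar> \<le> \<omega>"
    using a_modulus[of "k * int M + int i" k] i by (simp add: c_def a_eq abs_minus_commute)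
  have c1: "\<bar>1 / a (k + 1) - c\<bar> \<le> \<omega>"
    using a_modulus[of "k * int M + int i" "k + 1"] i
    by (simp add: c_def a_eq abs_minus_commute algebra_simps)
  have x: "\<bar>x\<bar> \<le> 2 * S"
    unfolding x_def \<theta>_def S_def using i by (intro linear_interpolation_error) auto
  have S0: "0 \<le> S" using x by linarith
  define T where "T = (1 - \<theta>) * ((1 / a k - c) * (g k * w 0)) + \<theta> * ((1 / a (k + 1) - c) * (g (k + 1) * w M))"
  have mult3: "\<bar>x * (y * z)\<bar> \<le> \<omega> * (G * V)" if "\<bar>x\<bar> \<le> \<omega>" "\<bar>y\<bar> \<le> G" "\<bar>z\<bar> \<le> V" for x y z
    unfolding abs_mult using that G0 V0 \<omega>_nonneg by (intro mult_mono mult_nonneg_nonneg abs_ge_zero) auto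
  have "\<bar>(1 / a k - c) * (g k * w 0)\<bar> \<le> \<omega> * (G * V)" "\<bar>(1 / a (k + 1) - c) * (g (k + 1) * w M)\<bar> \<le> \<omega> * (G * V)"
    using mult3[OF c0 G(1) V(1)] mult3[OF c1 G(2) V(2)] by auto
  then have T: "\<bar>T\<bar> \<le> \<omega> * (G * V)" unfolding T_def by (intro abs_interp_le \<theta>)
  have "\<bar>\<theta> * (1 - \<theta>) * ((g (k + 1) - g k) * (w M - w 0))\<bar> \<le> 1 * (\<bar>g (k + 1) - g k\<bar> * \<bar>w M - w 0\<bar>)"
    unfolding abs_mult using \<theta> by (intro mult_right_mono) (simp_all add: mult_le_one)
  moreover have "\<bar>gt * x\<bar> \<le> G * (2 * S)" unfolding abs_mult using gt x G0 by (intro mult_mono) auto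
  ultimately have "\<bar>\<theta> * (1 - \<theta>) * ((g (k + 1) - g k) * (w M - w 0)) + gt * x\<bar>
      \<le> \<bar>g (k + 1) - g k\<bar> * \<bar>w M - w 0\<bar> + 2 * (G * S)" by linarith
  then have U: "\<bar>c * (\<theta> * (1 - \<theta>) * ((g (k + 1) - g k) * (w M - w 0)) + gt * x)\<bar>
      \<le> 1 / a0 * (\<bar>g (k + 1) - g k\<bar> * \<bar>w M - w 0\<bar> + 2 * (G * S))"
    unfolding abs_mult[of c] using c C.a0_pos by (intro mult_mono) auto
  have "((1 - \<theta>) * (1 / a k * g k * w 0) + \<theta> * (1 / a (k + 1) * g (k + 1) * w M)) - c * w i * gt
      = T + c * (\<theta> * (1 - \<theta>) * ((g (k + 1) - g k) * (w M - w 0)) + gt * x)"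
    by (simp add: T_def x_def gt_def algebra_simps power2_eq_square)
  then have "\<bar>((1 - \<theta>) * (1 / a k * g k * w 0) + \<theta> * (1 / a (k + 1) * g (k + 1) * w M)) - c * w i * gt\<bar>
      \<le> \<omega> * (G * V) + 1 / a0 * (\<bar>g (k + 1) - g k\<bar> * \<bar>w M - w 0\<bar> + 2 * (G * S))"
    using T U by linarith
  then show ?thesis
    unfolding Rv Eg S_def w_def[abs_def] \<theta>_def c_def by simp
qed

lemma sum_abs_fdiff_R_le:
  "(\<Sum>k<N. h * (\<bar>g (int k + 1) - g (int k)\<bar> * \<bar>R v (int k + 1) - R v (int k)\<bar>))
    \<le> h\<^sup>2 * (C.nrm1 g * F.nrm1 v)"
proof -
  have "(\<Sum>k<N. h * (\<bar>g (int k + 1) - g (int k)\<bar> * \<bar>R v (int k + 1) - R v (int k)\<bar>))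
      = h\<^sup>2 * (\<Sum>k<N. \<bar>sqrt h * fdiff h g (int k)\<bar> * \<bar>sqrt h * fdiff h (R v) (int k)\<bar>)"
  proof -
    have "h * (\<bar>x\<bar> * \<bar>y\<bar>) = h\<^sup>2 * (\<bar>sqrt h * (x / h)\<bar> * \<bar>sqrt h * (y / h)\<bar>)" for x y
    proof -
      have "\<bar>sqrt h * (x / h)\<bar> * \<bar>sqrt h * (y / h)\<bar> = (\<bar>sqrt h\<bar> * \<bar>sqrt h\<bar>) * (\<bar>x / h\<bar> * \<bar>y / h\<bar>)"
        by (simp only: abs_mult mult_ac)
      also have "\<bar>sqrt h\<bar> * \<bar>sqrt h\<bar> = h" using C.h_pos by simp
      finally show ?thesis using C.h_pos by (simp add: power2_eq_square)
    qed
    then show ?thesis unfolding fdiff_def sum_distrib_left by (intro sum.cong refl) simp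
  qed
  also have "\<dots> \<le> h\<^sup>2 * (sqrt (C.e1 g) * sqrt (C.e1 (R v)))"
    unfolding C.sqrt_e1_L2 by (intro mult_left_mono L2_set_mult_ineq) simp
  also have "\<dots> \<le> h\<^sup>2 * (C.nrm1 g * F.nrm1 v)"
    unfolding C.nrm1_def F.nrm1_def using e1_R_le[of v] C.e0_nonneg[of g] F.e0_nonneg[of v]
    by (intro mult_left_mono mult_mono real_sqrt_le_mono) (simp_all add: C.e1_nonneg C.e0_nonneg)
  finally show ?thesis .
qed

text \<open>Apart from the oscillation of the weight, every error is quadratic in \<open>h\<close>:
  the product of two first differences is so directly, and the interpolation error of a cell is
  \<open>h * cell_variation\<close>, summed with the cell size \<open>h\<close>.\<close>

lemma Q0_le:
  assumes v: "v \<in> per (N * M)" and g: "g \<in> per N" and G: "sup_bound g G" and V: "sup_bound v V"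
  shows "\<bar>Q0 v g\<bar> \<le> len * \<omega> * (G * V) + (h\<^sup>2 * (C.nrm1 g * F.nrm1 v)
      + 2 * (G * (h\<^sup>2 * (sqrt len * lap_interior v)))) / a0"
proof -
  define X where "X k i = ((1 - real i / real M) * (1 / a k * g k * R v k) + real i / real M * (1 / a (k
      + 1) * g (k + 1) * R v (k + 1)))
      - 1 / a' (k * int M + int i) * v (k * int M + int i) * E g (k * int M + int i)" for k i
  define Y where "Y k = \<omega> * (G * V) + (\<bar>g (int k + 1) - g (int k)\<bar> * \<bar>R v (int k + 1) - R v (int k)\<bar>
      + 2 * (G * (h * cell_variation v k))) / a0" for k
  have F: "(\<lambda>k. 1 / a k * g k * R v k) \<in> per N"
    using C.a_per g R_per[OF v] by (simp add: per_def)
  have "C.ip (R v) g = (\<Sum>k<N. h * ((\<lambda>k. 1 / a k * g k * R v k) (int k)))"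
    unfolding C.ip_def by (intro sum.cong) (simp_all add: mult_ac)
  also note sum_interpolation[OF F]
  finally have "Q0 v g = (\<Sum>k<N. \<Sum>i<M. h / real M * X (int k) i)"
    unfolding Q0_def F.ip_def sum_cells[of "\<lambda>j. h / real M / a' j * v j * E g j"]
    by (simp add: X_def sum_subtractf[symmetric] right_diff_distrib mult.assoc)
  also have "\<bar>\<dots>\<bar> \<le> (\<Sum>k<N. \<Sum>i<M. h / real M * Y k)"
  proof (rule order_trans[OF sum_abs], rule sum_mono, rule order_trans[OF sum_abs], rule sum_mono)
    fix k i assume "i \<in> {..<M}"
    then have "\<bar>X (int k) i\<bar> \<le> Y k"
      unfolding X_def Y_def using Q0_cell[OF _ G V, of i "int k"] M_pos
      by (simp add: interior_variation_eq)
    then show "\<bar>h / real M * X (int k) i\<bar> \<le> h / real M * Y k"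
      unfolding abs_mult using C.h_pos M_pos by (intro mult_mono) auto
  qed
  also have "\<dots> = (\<Sum>k<N. h * Y k)" using M_pos by simp
  also have "\<dots> = real N * h * \<omega> * (G * V)
      + ((\<Sum>k<N. h * (\<bar>g (int k + 1) - g (int k)\<bar> * \<bar>R v (int k + 1) - R v (int k)\<bar>))
        + 2 * (G * (h\<^sup>2 * (\<Sum>k<N. cell_variation v k)))) / a0"
    unfolding Y_def
    by (simp add: sum.distrib sum_distrib_left sum_divide_distrib algebra_simps power2_eq_square
        add_divide_distrib)
  also have "\<dots> \<le> len * \<omega> * (G * V) + (h\<^sup>2 * (C.nrm1 g * F.nrm1 v)
      + 2 * (G * (h\<^sup>2 * (sqrt len * lap_interior v)))) / a0"
  proof -
    have "0 \<le> G" using G unfolding sup_bound_def by (meson abs_ge_zero order_trans)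
    then show ?thesis unfolding C.circumference
      using C.a0_pos
      by (intro add_mono divide_right_mono sum_abs_fdiff_R_le mult_left_mono sum_cell_variation order_refl) auto
  qed
  finally show ?thesis .
qed

text \<open>Freezing the drift ratio at the left node costs a multiple of \<open>\<omega>\<close>.
  The remaining factor \<open>r i\<close> compares the end values of \<open>g\<close> with the
  interpolated ones and has sum zero over the cell, so \<open>d i\<close> may be replaced by
  \<open>d i - d 0\<close>. This turns a first-order error into one controlled by interior second
  differences.\<close>

lemma Q1_cell:
  fixes k :: int and v :: "int \<Rightarrow> real"
  assumes G: "sup_bound g G"
  defines "B \<equiv> \<lambda>i. b' (k * int M + int i) * E g (k * int M + int i)"
  defines "d \<equiv> \<lambda>i. v (k * int M + int i + 1) - v (k * int M + int i)"
  shows "\<bar>\<Sum>i<M. ((b k * g k + b (k + 1) * g (k + 1)) - (B i + B (Suc i))) * d i\<bar>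
    \<le> 4 * \<omega> * G * (\<Sum>i<M. \<bar>d i\<bar>)
      + 2 * b1 * \<bar>g (k + 1) - g k\<bar> * (real M * interior_variation M (\<lambda>i. v (k * int M + int i)))"
proof -
  define w where "w i = v (k * int M + int i)" for i
  define S where "S = interior_variation M w"
  define \<beta> where "\<beta> = b' (k * int M)"
  define t where "t i = (1 - real i / real M) * g k + real i / real M * g (k + 1)" for i
  define r where "r i = 1 - (2 * real i + 1) / real M" for i
  have Gk: "\<bar>g k\<bar> \<le> G" "\<bar>g (k + 1)\<bar> \<le> G" using G by (simp_all add: sup_bound_def)
  have G0: "0 \<le> G" using Gk by linarith
  have t: "\<bar>t i\<bar> \<le> G" if "i \<le> M" for i
    unfolding t_def using that by (intro abs_interp_le Gk) (use M_pos in simp_all)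
  have B: "B i = b' (k * int M + int i) * t i" if "i \<le> M" for i
    unfolding B_def t_def E_cell[OF that] ..
  define err where "err i = (b (k + 1) - \<beta>) * g (k + 1) - (b' (k * int M + int i) - \<beta>) * t i
    - (b' (k * int M + int (Suc i)) - \<beta>) * t (Suc i)" for i
  have osc: "\<bar>b' (k * int M + int i) - \<beta>\<bar> \<le> \<omega>" if "i \<le> M" for i
    unfolding \<beta>_def using that by (intro b_modulus) simp
  have mult_le: "\<bar>x * y\<bar> \<le> \<omega> * G" if "\<bar>x\<bar> \<le> \<omega>" "\<bar>y\<bar> \<le> G" for x y
    unfolding abs_mult using that \<omega>_nonneg by (intro mult_mono) auto
  have err: "\<bar>err i\<bar> \<le> 4 * \<omega> * G" if i: "i < M" for i
  proof -
    have "b (k + 1) = b' (k * int M + int M)" by (simp add: b_eq algebra_simps)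
    then have "\<bar>(b (k + 1) - \<beta>) * g (k + 1)\<bar> \<le> \<omega> * G" using osc[of M] Gk by (intro mult_le) auto
    moreover have "\<bar>(b' (k * int M + int i) - \<beta>) * t i\<bar> \<le> \<omega> * G"
      "\<bar>(b' (k * int M + int (Suc i)) - \<beta>) * t (Suc i)\<bar> \<le> \<omega> * G"
      using i by (intro mult_le osc t; simp)+
    moreover have "0 \<le> \<omega> * G" using \<omega>_nonneg G0 by simp
    ultimately show ?thesis unfolding err_def by linarith
  qed
  have r: "\<bar>r i\<bar> \<le> 1" if "i < M" for i
    using that by (simp add: r_def abs_le_iff field_simps)
  have tt: "t i + t (Suc i) = (g k + g (k + 1)) - (g (k + 1) - g k) * r i" for i
    using M_pos by (simp add: t_def r_def field_simps)
  have coeff: "((b k * g k + b (k + 1) * g (k + 1)) - (B i + B (Suc i)))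
      = err i + \<beta> * (g (k + 1) - g k) * r i" if "i < M" for i
  proof -
    have "b k = \<beta>" by (simp add: b_eq \<beta>_def)
    then have "((b k * g k + b (k + 1) * g (k + 1)) - (B i + B (Suc i)))
      = err i + \<beta> * ((g k + g (k + 1)) - (t i + t (Suc i)))"
      using that by (simp add: B err_def algebra_simps)
    then show ?thesis unfolding tt by simp
  qed
  have "(\<Sum>i<M. ((b k * g k + b (k + 1) * g (k + 1)) - (B i + B (Suc i))) * d i)
      = (\<Sum>i<M. err i * d i + \<beta> * (g (k + 1) - g k) * (r i * d i))"
    by (intro sum.cong refl) (simp only: coeff lessThan_iff distrib_right mult.assoc)
  also have "\<dots> = (\<Sum>i<M. err i * d i) + \<beta> * (g (k + 1) - g k) * (\<Sum>i<M. r i * d i)"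
    by (simp add: sum.distrib sum_distrib_left)
  also have "(\<Sum>i<M. r i * d i) = (\<Sum>i<M. r i * (d i - d 0))"
  proof -
    \<comment> \<open>The odd numbers add up to a square, hence the \<open>r i\<close> add up to
      zero.\<close>
    have "(\<Sum>i<n. 2 * real i + 1) = (real n)\<^sup>2" for n
      by (induction n) (simp_all add: power2_eq_square algebra_simps)
    then have "(\<Sum>i<M. r i) = 0"
      using M_pos by (simp add: r_def sum_subtractf power2_eq_square flip: sum_divide_distrib)
    then show ?thesis by (simp add: right_diff_distrib sum_subtractf flip: sum_distrib_right)
  qed
  finally have eq: "(\<Sum>i<M. ((b k * g k + b (k + 1) * g (k + 1)) - (B i + B (Suc i))) * d i)
    = (\<Sum>i<M. err i * d i) + \<beta> * (g (k + 1) - g k) * (\<Sum>i<M. r i * (d i - d 0))" .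
  have "\<bar>\<Sum>i<M. err i * d i\<bar> \<le> (\<Sum>i<M. 4 * \<omega> * G * \<bar>d i\<bar>)"
    using err by (intro order_trans[OF sum_abs] sum_mono) (simp add: abs_mult mult_right_mono)
  then have 1: "\<bar>\<Sum>i<M. err i * d i\<bar> \<le> 4 * \<omega> * G * (\<Sum>i<M. \<bar>d i\<bar>)" by (simp add: sum_distrib_left)
  have "\<bar>\<Sum>i<M. r i * (d i - d 0)\<bar> \<le> (\<Sum>i<M. S)"
  proof (intro order_trans[OF sum_abs] sum_mono)
    fix i assume "i \<in> {..<M}"
    then have i: "i < M" by simp
    have "\<bar>d i - d 0\<bar> \<le> S"
      using slope_variation[OF i, of w] by (simp add: S_def d_def w_def add_ac)
    then have "\<bar>r i\<bar> * \<bar>d i - d 0\<bar> \<le> 1 * S" using r[OF i] by (intro mult_mono) auto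
    then show "\<bar>r i * (d i - d 0)\<bar> \<le> S" by (simp add: abs_mult)
  qed
  then have r_sum: "\<bar>\<Sum>i<M. r i * (d i - d 0)\<bar> \<le> real M * S" by simp
  have "\<bar>\<beta> * (g (k + 1) - g k) * (\<Sum>i<M. r i * (d i - d 0))\<bar> \<le> (b1 * \<bar>g (k + 1) - g k\<bar>) * (real M * S)"
    unfolding abs_mult using F.b_bound C.b1_nonneg r_sum by (intro mult_mono) (auto simp: \<beta>_def)
  also have "\<dots> \<le> 2 * b1 * \<bar>g (k + 1) - g k\<bar> * (real M * S)"
    using C.b1_nonneg r_sum by (intro mult_right_mono) auto
  finally show ?thesis unfolding eq using 1 by (simp add: S_def w_def[abs_def])
qed

lemma Q1_le:
  assumes v: "v \<in> per (N * M)" and g: "g \<in> per N" and G: "sup_bound g G"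
  shows "\<bar>Q1 v g\<bar> \<le> 2 * \<omega> * G * (sqrt len * F.nrm1 v) + b1 * (h\<^sup>2 * (C.nrm1 g * lap_interior v))"
proof -
  define B where "B j = b' j * E g j" for j
  have B: "B \<in> per (N * M)" unfolding B_def[abs_def] by (rule per_cmult[OF F.b_per E_per[OF g]])
  have bg: "(\<lambda>k. b k * g k) \<in> per N" by (rule per_cmult[OF C.b_per g])
  define d where "d j = v (j + 1) - v j" for j
  have "2 * (\<Sum>k<N. h * b (int k) * cdiff h (R v) (int k) * g (int k))
      = (\<Sum>k<N. (b (int k) * g (int k)) * (R v (int k + 1) - R v (int k - 1)))"
    unfolding sum_distrib_left using C.h_pos by (intro sum.cong refl) (simp add: cdiff_def)
  also have "\<dots> = (\<Sum>k<N. (b (int k) * g (int k) + b (int k + 1) * g (int k + 1)) * (R v (int k + 1)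
      - R v (int k)))"
    using sum_mult_centered_difference[OF bg R_per[OF v]] by simp
  also have "\<dots> = (\<Sum>k<N. \<Sum>i<M. (b (int k) * g (int k) + b (int k + 1) * g (int k + 1)) * d (int k * int M
      + int i))"
  proof (rule sum.cong[OF refl])
    fix k
    have "R v (int k + 1) - R v (int k) = (\<Sum>i<M. d (int k * int M + int i))"
      using sum_lessThan_telescope[of "\<lambda>i. v (int k * int M + int i)" M]
      by (simp add: R_def d_def algebra_simps)
    then show "(b (int k) * g (int k) + b (int k + 1) * g (int k + 1)) * (R v (int k + 1) - R v (int k))
      = (\<Sum>i<M. (b (int k) * g (int k) + b (int k + 1) * g (int k + 1)) * d (int k * int M + int i))"
      by (simp add: sum_distrib_left)
  qed
  finally have coarse: "2 * (\<Sum>k<N. h * b (int k) * cdiff h (R v) (int k) * g (int k))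
    = (\<Sum>k<N. \<Sum>i<M. (b (int k) * g (int k) + b (int k + 1) * g (int k + 1)) * d (int k * int M + int i))" .
  have "2 * (\<Sum>j<N * M. h / real M * b' (int j) * cdiff (h / real M) v (int j) * E g (int j))
      = (\<Sum>j<N * M. B (int j) * (v (int j + 1) - v (int j - 1)))"
    unfolding sum_distrib_left using C.h_pos M_pos by (intro sum.cong refl) (simp add: cdiff_def B_def)
  also have "\<dots> = (\<Sum>j<N * M. (\<lambda>j. (B j + B (j + 1)) * d j) (int j))"
    using sum_mult_centered_difference[OF B v] by (simp add: d_def)
  also have "\<dots> = (\<Sum>k<N. \<Sum>i<M. (B (int k * int M + int i) + B (int k * int M
      + int (Suc i))) * d (int k * int M + int i))"
    unfolding sum_cells[of "\<lambda>j. (B j + B (j + 1)) * d j"] by (simp add: add_ac)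
  finally have Q1: "2 * Q1 v g = (\<Sum>k<N. \<Sum>i<M. ((b (int k) * g (int k) + b (int k + 1) * g (int k + 1))
      - (B (int k * int M + int i) + B (int k * int M + int (Suc i)))) * d (int k * int M + int i))"
    unfolding Q1_def right_diff_distrib coarse by (simp add: sum_subtractf[symmetric] left_diff_distrib)
  have "\<bar>2 * Q1 v g\<bar> \<le> (\<Sum>k<N. 4 * \<omega> * G * (\<Sum>i<M. \<bar>d (int k * int M + int i)\<bar>)
      + 2 * b1 * \<bar>g (int k + 1) - g (int k)\<bar> * (h * cell_variation v k))"
    unfolding Q1
  proof (rule order_trans[OF sum_abs], rule sum_mono)
    fix k
    have m: "real M * (h / real M * cell_variation v k) = h * cell_variation v k" using M_pos by simp
    show "\<bar>\<Sum>i<M. ((b (int k) * g (int k) + b (int k + 1) * g (int k + 1))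
      - (B (int k * int M + int i) + B (int k * int M + int (Suc i)))) * d (int k * int M + int i)\<bar>
      \<le> 4 * \<omega> * G * (\<Sum>i<M. \<bar>d (int k * int M + int i)\<bar>)
      + 2 * b1 * \<bar>g (int k + 1) - g (int k)\<bar> * (h * cell_variation v k)"
      using Q1_cell[OF G, of "int k" v] unfolding interior_variation_eq m B_def d_def .
  qed
  also have "\<dots> = 4 * \<omega> * G * (\<Sum>j<N * M. \<bar>d (int j)\<bar>)
      + 2 * b1 * (h * (\<Sum>k<N. h * \<bar>fdiff h g (int k)\<bar> * cell_variation v k))"
    unfolding sum_cells[of "\<lambda>j. \<bar>d j\<bar>"] using C.h_pos
    by (simp add: sum.distrib sum_distrib_left fdiff_def mult_ac)
  also have "\<dots> \<le> 4 * \<omega> * G * (sqrt len * F.nrm1 v) + 2 * b1 * (h * (h * (C.nrm1 g * lap_interior v)))"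
  proof (intro add_mono mult_left_mono sum_fdiff_cell_variation)
    have "sqrt (len * F.e1 v) \<le> sqrt len * F.nrm1 v"
      unfolding real_sqrt_mult F.nrm1_def using C.len_pos F.e0_nonneg
          by (intro mult_left_mono real_sqrt_le_mono) auto
    then show "(\<Sum>j<N * M. \<bar>d (int j)\<bar>) \<le> sqrt len * F.nrm1 v" unfolding d_def using F.fdiff_L1[of v] by linarith
    have "0 \<le> G" using G unfolding sup_bound_def by (meson abs_ge_zero order_trans)
    then show "0 \<le> 4 * \<omega> * G" using \<omega>_nonneg by simp
  qed (use C.h_pos C.b1_nonneg in auto)
  finally show ?thesis by (simp add: abs_mult power2_eq_square mult_ac)
qed

end

section \<open>Resolvents on two levels\<close>

context lattice_diffusion
begin

definition delta :: "int \<Rightarrow> int \<Rightarrow> real" where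
  "delta y j = (if int N dvd j - y then 1 / h else 0)"

lemma delta_per: "delta y \<in> per N"
proof (rule perI)
  fix k
  have "int N dvd k + int N - y \<longleftrightarrow> int N dvd k - y"
    using dvd_add_left_iff[of "int N" "int N" "k - y"] by (simp add: algebra_simps)
  then show "delta y (k + int N) = delta y k" by (simp add: delta_def)
qed

lemma sum_delta:
  assumes w: "w \<in> per N"
  shows "(\<Sum>k<N. h * (delta y (int k) * w (int k))) = w y"
proof -
  define y0 where "y0 = nat (y mod int N)"
  have y0: "y0 < N" "int y0 = y mod int N" using N_pos by (simp_all add: y0_def nat_less_iff)
  have "int N dvd int k - y \<longleftrightarrow> k = y0" if "k < N" for k
  proof -
    have "int N dvd int k - y \<longleftrightarrow> int k mod int N = y mod int N" by (simp add: mod_eq_dvd_iff)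
    then show ?thesis using that y0 by (metis mod_less of_nat_eq_iff of_nat_mod)
  qed
  then have "(\<Sum>k<N. h * (delta y (int k) * w (int k))) = (\<Sum>k<N. if k = y0 then w (int k) else 0)"
    using h_pos by (intro sum.cong) (auto simp: delta_def)
  also have "\<dots> = w y" using y0 per_mod[OF w, of y] by simp
  finally show ?thesis .
qed

lemma ip_delta:
  assumes "w \<in> per N"
  shows "ip (delta y) w = w y / a y"
proof -
  have "ip (delta y) w = (\<Sum>k<N. h * (delta y (int k) * (\<lambda>k. w k / a k) (int k)))"
    unfolding ip_def by (intro sum.cong) auto
  also have "\<dots> = w y / a y"
    by (rule sum_delta) (use assms a_per in \<open>simp add: per_def\<close>)
  finally show ?thesis .
qed

end

context diffusion_semigroup
begin

lemma nrm1_K: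
  assumes f: "f \<in> per N"
  shows "nrm1 (K f) \<le> 2 * nrm0 f"
proof (rule nrm1_le_if_weak[OF K_per[OF f] _ nrm0_nonneg])
  have "ip f (K f) \<le> nrm0 f * nrm0 (K f)" using ip_le[of f "K f"] by linarith
  also have "\<dots> \<le> nrm0 f * nrm1 (K f)" by (intro mult_left_mono nrm0_le_nrm1 nrm0_nonneg)
  finally show "ip (A (K f)) (K f) \<le> nrm0 f * nrm1 (K f)" by (simp add: A_K[OF f])
qed

text \<open>Here \<open>nrm1_K\<close> would lose a factor \<open>1 / sqrt h\<close>. Pairing with
  the point source is point evaluation, which the Sobolev inequality bounds by \<open>nrm1\<close>
  uniformly in \<open>h\<close>.\<close>

lemma nrm1_K_delta: "nrm1 (K (delta y)) \<le> 2 * (csob / a0)"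
proof (rule nrm1_le_if_weak[OF K_per[OF delta_per]])
  have w: "K (delta y) \<in> per N" by (rule K_per[OF delta_per])
  have "ip (delta y) (K (delta y)) \<le> \<bar>K (delta y) y\<bar> / a y"
    using a_pos[of y] by (simp add: ip_delta[OF w] divide_right_mono)
  also have "\<dots> \<le> csob * nrm1 (K (delta y)) / a0"
    using a_lower[of y] a0_pos by (intro frac_le abs_le_nrm1 w) (auto intro: order_trans[OF abs_ge_zero
        abs_le_nrm1[OF w]])
  finally show "ip (A (K (delta y))) (K (delta y)) \<le> csob / a0 * nrm1 (K (delta y))"
    by (simp add: A_K[OF delta_per])
qed (use csob_pos a0_pos in simp)

end

text \<open>Collects the coefficients of \<open>Q0_le\<close> and \<open>Q1_le\<close> after the sup
  norms have been replaced by the Sobolev constant times \<open>nrm1\<close>.\<close>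

definition form_const :: "real \<Rightarrow> real \<Rightarrow> real \<Rightarrow> real \<Rightarrow> real" where
  "form_const a0 a1 b1 len = (let cs = sqrt (2 * a1 / len + 2 * len) in
     len * cs\<^sup>2 + (1 + 2 * cs * sqrt len) / a0 + 2 * cs * sqrt len + b1)"

definition potential_const :: "real \<Rightarrow> real \<Rightarrow> real \<Rightarrow> real" where
  "potential_const a0 a1 b1 = (damping a1 b1)\<^sup>2 / a0 + b1\<^sup>2"

text \<open>The first factor is the constant of \<open>nrm1_H\<close>. The second adds the bounds of
  \<open>n2_K\<close> and \<open>n2_K_delta\<close>, so that one constant serves both
  square-summable data and point sources.\<close>

definition elliptic_const :: "real \<Rightarrow> real \<Rightarrow> real \<Rightarrow> real \<Rightarrow> real" where
  "elliptic_const a0 a1 b1 len =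
    (2 * form_const a0 a1 b1 len + 4 * ((damping a1 b1 + 1) * form_const a0 a1 b1 len))
    * (2 + sqrt (12 * potential_const a0 a1 b1 + 3 / a0)
      + (1 + sqrt (3 * potential_const a0 a1 b1)) * (2 * (sqrt (2 * a1 / len + 2 * len) / a0)))"

context two_level
begin

text \<open>A discrete second-order Sobolev norm from which the second differences at coarse nodes
  are left out.\<close>

definition n2 :: "(int \<Rightarrow> real) \<Rightarrow> real" where
  "n2 v = F.nrm1 v + lap_interior v"

definition \<epsilon> :: real where "\<epsilon> = \<omega> + h\<^sup>2"

lemma \<epsilon>_nonneg: "0 \<le> \<epsilon>"
  using \<omega>_nonneg by (simp add: \<epsilon>_def)

lemma n2_nonneg: "0 \<le> n2 v"
  by (simp add: n2_def F.nrm1_nonneg lap_interior_nonneg)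

lemma form_const_nonneg: "0 \<le> form_const a0 a1 b1 len"
  using C.a0_pos C.a1_pos C.b1_nonneg C.len_pos by (simp add: form_const_def Let_def)

lemma Q_le:
  assumes v: "v \<in> per (N * M)" and g: "g \<in> per N"
  shows "\<bar>Q0 v g\<bar> \<le> form_const a0 a1 b1 len * \<epsilon> * n2 v * C.nrm1 g"
    and "\<bar>Q1 v g\<bar> \<le> form_const a0 a1 b1 len * \<epsilon> * n2 v * C.nrm1 g"
proof -
  define n p q s cs where "n = C.nrm1 g" and "p = F.nrm1 v" and "q = lap_interior v"
    and "s = sqrt len" and "cs = sqrt (2 * a1 / len + 2 * len)"
  define Z where "Z = \<epsilon> * (n * (p + q))"
  have nn: "0 \<le> n" "0 \<le> p" "0 \<le> q" "0 \<le> s" "0 \<le> cs" "0 \<le> \<omega>" "0 \<le> h\<^sup>2"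
    using C.nrm1_nonneg F.nrm1_nonneg lap_interior_nonneg C.len_pos C.a1_pos \<omega>_nonneg
    by (simp_all add: n_def p_def q_def s_def cs_def)
  have cs: "C.csob = cs" "F.csob = cs" by (simp_all add: C.csob_def cs_def)
  have Z: "\<omega> * (n * p) \<le> Z" "h\<^sup>2 * (n * p) \<le> Z" "h\<^sup>2 * (n * q) \<le> Z"
    unfolding Z_def \<epsilon>_def using nn by (intro mult_mono mult_nonneg_nonneg; simp)+
  have Z0: "0 \<le> Z" using nn by (simp add: Z_def \<epsilon>_def)
  have form: "form_const a0 a1 b1 len * \<epsilon> * n2 v * C.nrm1 g
      = len * cs\<^sup>2 * Z + (1 + 2 * cs * s) / a0 * Z + 2 * cs * s * Z + b1 * Z"
    by (simp add: form_const_def Let_def Z_def n2_def n_def p_def q_def s_def cs_def algebra_simps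
        add_divide_distrib)
  have G: "sup_bound g (cs * n)"
    using C.abs_le_nrm1[OF g] by (simp add: sup_bound_def cs n_def)
  have V: "sup_bound v (cs * p)"
    using F.abs_le_nrm1[OF v] by (simp add: sup_bound_def cs p_def)
  have "\<bar>Q0 v g\<bar> \<le> len * \<omega> * (cs * n * (cs * p)) + (h\<^sup>2 * (n * p) + 2 * (cs * n * (h\<^sup>2 * (s * q)))) / a0"
    using Q0_le[OF v g G V] by (simp add: n_def p_def q_def s_def)
  also have "\<dots> = len * cs\<^sup>2 * (\<omega> * (n * p)) + (h\<^sup>2 * (n * p) + 2 * cs * s * (h\<^sup>2 * (n * q))) / a0"
    by (simp add: power2_eq_square mult_ac)
  also have "\<dots> \<le> len * cs\<^sup>2 * Z + (Z + 2 * cs * s * Z) / a0"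
    using C.a0_pos C.len_pos nn by (intro add_mono divide_right_mono mult_left_mono Z) auto
  also have "\<dots> \<le> form_const a0 a1 b1 len * \<epsilon> * n2 v * C.nrm1 g"
    unfolding form using nn Z0 C.b1_nonneg by (simp add: algebra_simps add_divide_distrib)
  finally show "\<bar>Q0 v g\<bar> \<le> form_const a0 a1 b1 len * \<epsilon> * n2 v * C.nrm1 g" .
  have "\<bar>Q1 v g\<bar> \<le> 2 * \<omega> * (cs * n) * (s * p) + b1 * (h\<^sup>2 * (n * q))"
    using Q1_le[OF v g G] by (simp add: n_def p_def q_def s_def)
  also have "\<dots> = 2 * cs * s * (\<omega> * (n * p)) + b1 * (h\<^sup>2 * (n * q))" by (simp add: mult_ac)
  also have "\<dots> \<le> 2 * cs * s * Z + b1 * Z"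
    using nn C.b1_nonneg by (intro add_mono mult_left_mono Z) auto
  also have "\<dots> \<le> form_const a0 a1 b1 len * \<epsilon> * n2 v * C.nrm1 g"
    unfolding form using nn Z0 C.len_pos C.a0_pos by simp
  finally show "\<bar>Q1 v g\<bar> \<le> form_const a0 a1 b1 len * \<epsilon> * n2 v * C.nrm1 g" .
qed

text \<open>Solving the definition of \<open>A\<close> for the Laplacian at each node expresses it
  through \<open>v\<close>, its centered difference and \<open>A v\<close> at that same node. The
  sum over \<open>A v\<close> therefore stays restricted to interior nodes; the factor
  \<open>3\<close> comes from squaring three terms.\<close>

lemma lap_interior_le:
  assumes v: "v \<in> per (N * M)"
  shows "(lap_interior v)\<^sup>2 \<le> 3 * potential_const a0 a1 b1 * (F.nrm1 v)\<^sup>2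
    + 3 / a0 * (\<Sum>j<N * M. if M dvd j then 0 else h / real M / a' (int j) * (F.A v (int j))\<^sup>2)"
proof -
  define h' where "h' = h / real M"
  have h': "0 < h'" using C.h_pos M_pos by (simp add: h'_def)
  have pt: "(if M dvd j then 0 else h' * (lap h' v (int j))\<^sup>2)
      \<le> 3 * ((damping a1 b1)\<^sup>2 / a0 * (h' / a' (int j) * (v (int j))\<^sup>2) + b1\<^sup>2 * (h' * (cdiff h' v (int j))\<^sup>2))
        + 3 / a0 * (if M dvd j then 0 else h' / a' (int j) * (F.A v (int j))\<^sup>2)" for j
  proof -
    define x y z where "x = damping a1 b1 * v (int j) / a' (int j)" and "y = b' (int j) * cdiff h' v (int j)"
      and "z = F.A v (int j) / a' (int j)"
    have p: "0 < a' (int j)" by (rule F.a_pos)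
    have lap: "lap h' v (int j) = x - y - z"
      using p by (simp add: F.A_def x_def y_def z_def h'_def field_simps)
    have "(lap h' v (int j))\<^sup>2 \<le> 3 * (x\<^sup>2 + y\<^sup>2 + z\<^sup>2)"
      unfolding lap using sum_squares_bound[of x "-y"] sum_squares_bound[of x "-z"] sum_squares_bound[of y z]
      by (simp add: power2_eq_square algebra_simps)
    then have "h' * (lap h' v (int j))\<^sup>2 \<le> h' * (3 * (x\<^sup>2 + y\<^sup>2 + z\<^sup>2))"
      using h' by (intro mult_left_mono) auto
    also have "\<dots> = 3 * (h' * x\<^sup>2 + h' * y\<^sup>2) + 3 * (h' * z\<^sup>2)" by (simp add: algebra_simps)
    finally have 1: "h' * (lap h' v (int j))\<^sup>2 \<le> 3 * (h' * x\<^sup>2 + h' * y\<^sup>2) + 3 * (h' * z\<^sup>2)" .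
    have sq: "h' * (w / a' (int j))\<^sup>2 \<le> 1 / a0 * (h' / a' (int j) * w\<^sup>2)" for w
    proof -
      have "h' * (w / a' (int j))\<^sup>2 = 1 / a' (int j) * (h' / a' (int j) * w\<^sup>2)"
        by (simp add: power2_eq_square)
      also have "\<dots> \<le> 1 / a0 * (h' / a' (int j) * w\<^sup>2)"
        using F.a_lower[of "int j"] C.a0_pos p h' by (intro mult_right_mono) (auto simp: frac_le)
      finally show ?thesis .
    qed
    have x: "h' * x\<^sup>2 \<le> (damping a1 b1)\<^sup>2 / a0 * (h' / a' (int j) * (v (int j))\<^sup>2)"
      using sq[of "damping a1 b1 * v (int j)"] by (simp add: x_def power_mult_distrib mult_ac)
    have "y\<^sup>2 \<le> b1\<^sup>2 * (cdiff h' v (int j))\<^sup>2"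
      unfolding y_def power_mult_distrib using F.b_bound[of "int j"] C.b1_nonneg
      by (intro mult_right_mono) (auto simp: abs_le_square_iff[symmetric])
    then have y: "h' * y\<^sup>2 \<le> b1\<^sup>2 * (h' * (cdiff h' v (int j))\<^sup>2)"
      using mult_left_mono[of "y\<^sup>2" "b1\<^sup>2 * (cdiff h' v (int j))\<^sup>2" h'] h' by (simp add: mult_ac)
    have z: "3 * (h' * z\<^sup>2) \<le> 3 / a0 * (h' / a' (int j) * (F.A v (int j))\<^sup>2)"
      using sq[of "F.A v (int j)"] by (simp add: z_def)
    have "0 \<le> (damping a1 b1)\<^sup>2 / a0 * (h' / a' (int j) * (v (int j))\<^sup>2)" "0
        \<le> b1\<^sup>2 * (h' * (cdiff h' v (int j))\<^sup>2)"
      using C.a0_pos p h' by simp_all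
    then show ?thesis using 1 x y z by (cases "M dvd j") simp_all
  qed
  have "(lap_interior v)\<^sup>2 = (\<Sum>j<N * M. if M dvd j then 0 else h' * (lap h' v (int j))\<^sup>2)"
    unfolding lap_interior_def h'_def[symmetric] using h' by (simp add: sum_nonneg)
  also have "\<dots> \<le> (\<Sum>j<N * M. 3 * ((damping a1 b1)\<^sup>2 / a0 * (h' / a' (int j) * (v (int j))\<^sup>2)
        + b1\<^sup>2 * (h' * (cdiff h' v (int j))\<^sup>2))
        + 3 / a0 * (if M dvd j then 0 else h' / a' (int j) * (F.A v (int j))\<^sup>2))"
    by (intro sum_mono pt)
  also have "\<dots> = 3 * ((damping a1 b1)\<^sup>2 / a0 * F.e0 v + b1\<^sup>2 * (\<Sum>j<N * M. h' * (cdiff h' v (int j))\<^sup>2))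
     + 3 / a0 * (\<Sum>j<N * M. if M dvd j then 0 else h' / a' (int j) * (F.A v (int j))\<^sup>2)"
    unfolding F.e0_eq unfolding h'_def[symmetric]
    by (simp only: sum.distrib sum_distrib_left[symmetric])
  also have "(damping a1 b1)\<^sup>2 / a0 * F.e0 v + b1\<^sup>2 * (\<Sum>j<N * M. h' * (cdiff h' v (int j))\<^sup>2)
      \<le> (damping a1 b1)\<^sup>2 / a0 * (F.nrm1 v)\<^sup>2 + b1\<^sup>2 * (F.nrm1 v)\<^sup>2"
  proof (intro add_mono mult_left_mono)
    show "F.e0 v \<le> (F.nrm1 v)\<^sup>2" by (simp add: F.nrm1_sq F.e1_nonneg)
    show "(\<Sum>j<N * M. h' * (cdiff h' v (int j))\<^sup>2) \<le> (F.nrm1 v)\<^sup>2"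
      using sum_cdiff_sq_le[OF v h'] F.e0_nonneg[of v] by (simp add: F.nrm1_sq F.e1_def h'_def)
  qed (use C.a0_pos in auto)
  finally show ?thesis unfolding h'_def potential_const_def by (simp add: algebra_simps)
qed

end

locale two_semigroups =
  two_level N h a b a0 a1 b1 len M a' b' \<omega> +
  C: diffusion_semigroup N h a b a0 a1 b1 len K P +
  F: diffusion_semigroup "N * M" "h / real M" a' b' a0 a1 b1 len K' P'
  for N h a b a0 a1 b1 len M a' b' \<omega> K P K' P'
begin

section \<open>Elliptic error operators\<close>

text \<open>The analogue of the error of a Ritz projection: \<open>v\<close> on the coarse lattice
  against the coarse solution whose right-hand side is transferred by \<open>I\<close>.\<close>

definition ritz_error :: "(int \<Rightarrow> real) \<Rightarrow> int \<Rightarrow> real" where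
  "ritz_error v = R v - K (I (F.A v))"

text \<open>The commutator of \<open>I\<close> with the two resolvents, smoothed by one more
  \<open>K\<close>. The outer \<open>K\<close> is there because \<open>I v - R v\<close> is
  estimated only through its pairings \<open>Q0\<close>.\<close>

definition H :: "(int \<Rightarrow> real) \<Rightarrow> int \<Rightarrow> real" where
  "H f = K (I (K' f)) - K (K (I f))"

definition \<eta> :: real where "\<eta> = elliptic_const a0 a1 b1 len * \<epsilon>"

lemma ritz_error_per: "v \<in> per (N * M) \<Longrightarrow> ritz_error v \<in> per N"
  unfolding ritz_error_def by (intro per_diff R_per C.K_per I_per F.A_per)

lemma H_per: "f \<in> per (N * M) \<Longrightarrow> H f \<in> per N"
  unfolding H_def by (intro per_diff C.K_per I_per F.K_per)

text \<open>Applying \<open>A\<close> yields \<open>C.A (R v) - I (F.A v)\<close>, whose pairings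
  are given by \<open>Q0\<close> and \<open>Q1\<close> through \<open>consistency\<close>;
  coercivity then bounds the error itself.\<close>

lemma nrm1_ritz_error:
  assumes v: "v \<in> per (N * M)"
  shows "C.nrm1 (ritz_error v) \<le> 2 * ((damping a1 b1 + 1) * form_const a0 a1 b1 len * \<epsilon> * n2 v)"
proof (rule C.nrm1_le_if_weak[OF ritz_error_per[OF v]])
  have IA: "I (F.A v) \<in> per N" by (intro I_per F.A_per v)
  have "C.A (ritz_error v) = C.A (R v) - I (F.A v)"
    unfolding ritz_error_def kernel_op_diff[OF C.kernel_op_A R_per[OF v] C.K_per[OF IA]] C.A_K[OF IA] ..
  then have "C.ip (C.A (ritz_error v)) (ritz_error v)
      = damping a1 b1 * Q0 v (ritz_error v) - Q1 v (ritz_error v)"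
    using consistency[OF v ritz_error_per[OF v]] by simp
  also have "\<dots> \<le> damping a1 b1 * \<bar>Q0 v (ritz_error v)\<bar> + \<bar>Q1 v (ritz_error v)\<bar>"
    using C.damping_ge abs_ge_self[of "Q0 v (ritz_error v)"]
      mult_left_mono[of "Q0 v (ritz_error v)" "\<bar>Q0 v (ritz_error v)\<bar>" "damping a1 b1"] by linarith
  also have "\<dots> \<le> damping a1 b1 * (form_const a0 a1 b1 len * \<epsilon> * n2 v * C.nrm1 (ritz_error v))
      + form_const a0 a1 b1 len * \<epsilon> * n2 v * C.nrm1 (ritz_error v)"
    using C.damping_ge Q_le[OF v ritz_error_per[OF v]] by (intro add_mono mult_left_mono) auto
  finally show "C.ip (C.A (ritz_error v)) (ritz_error v)
      \<le> (damping a1 b1 + 1) * form_const a0 a1 b1 len * \<epsilon> * n2 v * C.nrm1 (ritz_error v)"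
    by (simp add: algebra_simps)
qed (use C.damping_ge form_const_nonneg \<epsilon>_nonneg n2_nonneg in simp)

text \<open>The pairings of \<open>I v - R v\<close> are \<open>- Q0\<close>, and one resolvent
  turns this weak bound into one in \<open>nrm1\<close>.\<close>

lemma nrm1_K_I_minus_R:
  assumes v: "v \<in> per (N * M)"
  shows "C.nrm1 (K (I v - R v)) \<le> 2 * (form_const a0 a1 b1 len * \<epsilon> * n2 v)"
proof (rule C.nrm1_le_if_weak)
  have IR: "I v - R v \<in> per N" by (intro per_diff I_per R_per v)
  show w: "K (I v - R v) \<in> per N" by (rule C.K_per[OF IR])
  have "C.ip (C.A (K (I v - R v))) (K (I v - R v)) = - Q0 v (K (I v - R v))"
    unfolding C.A_K[OF IR] Q0_def C.ip_diff_left ip_I[OF w v] by simp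
  then show "C.ip (C.A (K (I v - R v))) (K (I v - R v))
      \<le> form_const a0 a1 b1 len * \<epsilon> * n2 v * C.nrm1 (K (I v - R v))"
    using Q_le(1)[OF v w] by linarith
qed (use form_const_nonneg \<epsilon>_nonneg n2_nonneg in simp)

text \<open>With \<open>v = K' f\<close> the unsmoothed commutator is
  \<open>(I v - R v) + ritz_error v\<close>, and \<open>K\<close> is bounded on the second
  summand.\<close>

lemma nrm1_H:
  assumes f: "f \<in> per (N * M)"
  shows "C.nrm1 (H f) \<le> (2 * form_const a0 a1 b1 len + 4 * ((damping a1 b1
      + 1) * form_const a0 a1 b1 len)) * \<epsilon> * n2 (K' f)"
proof -
  define v where "v = K' f"
  have v: "v \<in> per (N * M)" "F.A v = f" using F.K_per[OF f] F.A_K[OF f] by (simp_all add: v_def)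
  have p: "I v \<in> per N" "R v \<in> per N" "K (I f) \<in> per N" "I v - R v \<in> per N" "ritz_error v \<in> per N"
    using v f by (auto intro!: I_per R_per C.K_per per_diff ritz_error_per)
  have eq: "(I v - R v) + ritz_error v = I v - K (I f)" by (simp add: ritz_error_def v)
  have "H f = K ((I v - R v) + ritz_error v)"
    unfolding H_def v_def[symmetric] eq by (rule kernel_op_diff[OF C.kernel_op_K p(1) p(3), symmetric])
  also have "\<dots> = K (I v - R v) + K (ritz_error v)"
    by (rule kernel_op_add[OF C.kernel_op_K p(4) p(5)])
  finally have "C.nrm1 (H f) \<le> C.nrm1 (K (I v - R v)) + C.nrm1 (K (ritz_error v))"
    using C.nrm1_add by simp
  moreover have "C.nrm1 (K (ritz_error v)) \<le> 2 * C.nrm1 (ritz_error v)"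
    using C.nrm1_K[OF p(5)] C.nrm0_le_nrm1[of "ritz_error v"] by linarith
  ultimately show ?thesis
    using nrm1_ritz_error[OF v(1)] nrm1_K_I_minus_R[OF v(1)] by (simp add: v_def algebra_simps)
qed

lemma potential_const_nonneg: "0 \<le> potential_const a0 a1 b1"
  using C.a0_pos by (simp add: potential_const_def)

lemma n2_K:
  assumes f: "f \<in> per (N * M)"
  shows "n2 (K' f) \<le> (2 + sqrt (12 * potential_const a0 a1 b1 + 3 / a0)) * F.nrm0 f"
proof -
  have v: "K' f \<in> per (N * M)" by (rule F.K_per[OF f])
  have n: "F.nrm1 (K' f) \<le> 2 * F.nrm0 f" by (rule F.nrm1_K[OF f])
  have "(F.nrm1 (K' f))\<^sup>2 \<le> (2 * F.nrm0 f)\<^sup>2" by (intro power_mono n F.nrm1_nonneg)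
  then have "3 * potential_const a0 a1 b1 * (F.nrm1 (K' f))\<^sup>2 \<le> 3 * potential_const a0 a1 b1 * (2 * F.nrm0 f)\<^sup>2"
    using potential_const_nonneg by (intro mult_left_mono) auto
  moreover have "(\<Sum>j<N * M. if M dvd j then 0 else h / real M / a' (int j) * (f (int j))\<^sup>2) \<le> (F.nrm0 f)\<^sup>2"
    unfolding F.nrm0_sq F.e0_eq using C.h_pos M_pos F.a_pos by (intro sum_mono) (simp add: less_imp_le)
  then have "3 / a0 * (\<Sum>j<N * M. if M dvd j then 0 else h / real M / a' (int j) * (f (int j))\<^sup>2)
      \<le> 3 / a0 * (F.nrm0 f)\<^sup>2"
    using C.a0_pos by (intro mult_left_mono) auto
  ultimately have "(lap_interior (K' f))\<^sup>2 \<le> (12 * potential_const a0 a1 b1 + 3 / a0) * (F.nrm0 f)\<^sup>2"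
    using lap_interior_le[OF v] unfolding F.A_K[OF f] by (simp add: power_mult_distrib algebra_simps)
  from real_sqrt_le_mono[OF this] have "lap_interior (K' f) \<le> sqrt (12 * potential_const a0 a1 b1
      + 3 / a0) * F.nrm0 f"
    by (simp add: real_sqrt_mult lap_interior_nonneg F.nrm0_nonneg)
  with n show ?thesis by (simp add: n2_def algebra_simps)
qed

text \<open>A point source at a coarse node is invisible to \<open>lap_interior\<close>.\<close>

lemma n2_K_delta:
  "n2 (K' (F.delta (y * int M))) \<le> (1 + sqrt (3 * potential_const a0 a1 b1)) * (2 * (sqrt (2 * a1 / len
      + 2 * len) / a0))"
proof -
  define B where "B = 2 * (sqrt (2 * a1 / len + 2 * len) / a0)"
  define v where "v = K' (F.delta (y * int M))"
  have v: "v \<in> per (N * M)" "F.A v = F.delta (y * int M)"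
    using F.K_per[OF F.delta_per] F.A_K[OF F.delta_per] by (simp_all add: v_def)
  have n: "F.nrm1 v \<le> B"
    using F.nrm1_K_delta[of "y * int M"] by (simp add: v_def B_def F.csob_def)
  have "F.delta (y * int M) (int j) = 0" if "\<not> M dvd j" for j
  proof -
    have "\<not> int (N * M) dvd int j - y * int M"
    proof
      assume "int (N * M) dvd int j - y * int M"
      then have "int M dvd int j - y * int M" by (metis dvd_mult_right of_nat_mult)
      then have "int M dvd int j" by (metis dvd_diff_commute dvd_diff_left_iff dvd_triv_right)
      then show False using that by simp
    qed
    then show ?thesis by (simp add: F.delta_def)
  qed
  then have "(\<Sum>j<N * M. if M dvd j then 0 else h / real M / a' (int j) * (F.delta (y * int M) (int j))\<^sup>2) = 0"
    by (intro sum.neutral) auto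
  then have "(lap_interior v)\<^sup>2 \<le> 3 * potential_const a0 a1 b1 * (F.nrm1 v)\<^sup>2"
    using lap_interior_le[OF v(1)] unfolding v(2) by simp
  from real_sqrt_le_mono[OF this] have "lap_interior v \<le> sqrt (3 * potential_const a0 a1 b1) * F.nrm1 v"
    by (simp add: real_sqrt_mult lap_interior_nonneg F.nrm1_nonneg)
  also have "\<dots> \<le> sqrt (3 * potential_const a0 a1 b1) * B"
    using n potential_const_nonneg by (intro mult_left_mono) auto
  finally show ?thesis
    unfolding v_def[symmetric] B_def[symmetric] using n by (simp add: n2_def distrib_right)
qed

text \<open>Here \<open>n2\<close> is eliminated, so that only \<open>\<eta>\<close> and
  \<open>nrm0\<close> appear afterwards. The second bound is for the point source, for which the
  first would lose a negative power of \<open>h\<close>.\<close>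

lemma elliptic_bounds:
  shows "f \<in> per (N * M) \<Longrightarrow> C.nrm1 (H f) \<le> \<eta> * F.nrm0 f"
    and "C.nrm1 (H (F.delta (y * int M))) \<le> \<eta>"
    and "v \<in> per (N * M) \<Longrightarrow> C.nrm1 (ritz_error v) \<le> \<eta> * F.nrm0 (F.A v)"
proof -
  define c where "c = 2 * form_const a0 a1 b1 len + 4 * ((damping a1 b1 + 1) * form_const a0 a1 b1 len)"
  define p where "p = 2 + sqrt (12 * potential_const a0 a1 b1 + 3 / a0)"
  define q where "q = (1 + sqrt (3 * potential_const a0 a1 b1)) * (2 * (sqrt (2 * a1 / len + 2 * len) / a0))"
  have nn: "0 \<le> c" "0 \<le> p" "0 \<le> q"
    using form_const_nonneg C.damping_ge potential_const_nonneg C.a0_pos C.a1_pos C.len_pos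
    by (simp_all add: c_def p_def q_def)
  have \<eta>: "\<eta> = c * \<epsilon> * (p + q)" by (simp add: \<eta>_def elliptic_const_def c_def p_def q_def mult_ac)
  have n2: "c * \<epsilon> * n2 (K' f) \<le> \<eta> * F.nrm0 f" if f: "f \<in> per (N * M)" for f
  proof -
    have "n2 (K' f) \<le> p * F.nrm0 f" using n2_K[OF f] by (simp add: p_def)
    also have "\<dots> \<le> (p + q) * F.nrm0 f" using nn F.nrm0_nonneg by (intro mult_right_mono) auto
    finally have "c * \<epsilon> * n2 (K' f) \<le> c * \<epsilon> * ((p + q) * F.nrm0 f)"
      using nn \<epsilon>_nonneg by (intro mult_left_mono) auto
    then show ?thesis by (simp add: \<eta> mult_ac)
  qed
  show "C.nrm1 (H f) \<le> \<eta> * F.nrm0 f" if f: "f \<in> per (N * M)"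
    using nrm1_H[OF f] n2[OF f] by (simp add: c_def)
  have "c * \<epsilon> * n2 (K' (F.delta (y * int M))) \<le> c * \<epsilon> * (p + q)"
    using n2_K_delta[of y] nn \<epsilon>_nonneg by (intro mult_left_mono) (auto simp: q_def)
  then show "C.nrm1 (H (F.delta (y * int M))) \<le> \<eta>"
    using nrm1_H[OF F.delta_per, of "y * int M"] by (simp add: c_def \<eta>)
  show "C.nrm1 (ritz_error v) \<le> \<eta> * F.nrm0 (F.A v)" if v: "v \<in> per (N * M)"
  proof -
    have "2 * ((damping a1 b1 + 1) * form_const a0 a1 b1 len * \<epsilon> * n2 v) \<le> c * \<epsilon> * n2 v"
      using form_const_nonneg C.damping_ge \<epsilon>_nonneg n2_nonneg[of v]
      by (simp add: c_def algebra_simps)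
    also have "\<dots> \<le> \<eta> * F.nrm0 (F.A v)" using n2[OF F.A_per[OF v]] by (simp add: F.K_A[OF v])
    finally show ?thesis using nrm1_ritz_error[OF v] by linarith
  qed
qed

text \<open>Only the node \<open>i = 0\<close> of cell \<open>k\<close> can meet the source. Its
  height \<open>real M / h\<close> on the fine lattice is reduced to \<open>1 / h\<close> by the
  factor \<open>1 / real M\<close>, and the coefficients of both levels agree there.\<close>

lemma I_delta: "I (F.delta (y * int M)) = C.delta y"
proof
  fix k
  have d: "int (N * M) dvd c * int M + int i - y * int M \<longleftrightarrow> i = 0 \<and> int N dvd c - y" if "i < M" for c i
  proof -
    have eq: "c * int M + int i - y * int M = (c - y) * int M + int i" by (simp add: algebra_simps)
    show ?thesis
    proof (cases "i = 0")
      case True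
      then show ?thesis unfolding eq using M_pos by simp
    next
      case False
      have "\<not> int (N * M) dvd (c - y) * int M + int i"
      proof
        assume "int (N * M) dvd (c - y) * int M + int i"
        then have "int M dvd (c - y) * int M + int i" by (metis dvd_mult_right of_nat_mult)
        then have "int M dvd int i" by (simp add: dvd_add_right_iff)
        then show False using False that by (auto dest: dvd_imp_le)
      qed
      then show ?thesis unfolding eq using False by simp
    qed
  qed
  have \<delta>: "F.delta (y * int M) (c * int M + int i) = (if i = 0 \<and> int N dvd c - y then 1 / (h / real M) else 0)"
    if "i < M" for c i by (simp only: F.delta_def d[OF that])
  have \<delta>0: "F.delta (y * int M) (k * int M) = (if int N dvd k - y then 1 / (h / real M) else 0)"
    using \<delta>[of 0 k] M_pos by simp
  have 1: "(\<Sum>i<M. (1 - real i / real M) * (F.delta (y * int M) (k * int M + int i) / a' (k * int M + int i)))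
      = (\<Sum>i<M. if i = 0 then F.delta (y * int M) (k * int M) / a' (k * int M) else 0)"
    by (intro sum.cong refl) (auto simp: \<delta> \<delta>0)
  have 2: "(\<Sum>i<M. real i / real M * (F.delta (y * int M) ((k - 1) * int M + int i) / a' ((k - 1) * int M
      + int i))) = 0"
    by (intro sum.neutral) (auto simp: \<delta>)
  have "I (F.delta (y * int M)) k = a k / real M * (F.delta (y * int M) (k * int M) / a' (k * int M))"
    unfolding I_def 1 2 using M_pos by simp
  also have "\<dots> = C.delta y k"
    using M_pos C.a_pos[of k] by (simp add: \<delta>0 C.delta_def a_eq)
  finally show "I (F.delta (y * int M)) k = C.delta y k" .
qed

end

section \<open>Semigroups on two levels\<close>

lemma per_uminus: "f \<in> per N \<Longrightarrow> - f \<in> per N"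
  by (simp add: per_def)

lemma kernel_op_uminus:
  assumes "kernel_op N T" "f \<in> per N"
  shows "T (- f) = - T f"
  using kernel_op_diff[OF assms(1) per_zero assms(2)] kernel_op_diff[OF assms(1) per_zero per_zero] by simp

context diffusion_semigroup
begin

lemma P_double: "0 < s \<Longrightarrow> f \<in> per N \<Longrightarrow> P (2 * s) f = P s (P s f)"
  using P_add[of s s f] by (simp only: mult_2)

lemma nrm0_P: "0 < s \<Longrightarrow> f \<in> per N \<Longrightarrow> nrm0 (P s f) \<le> nrm0 f"
  unfolding nrm0_def by (intro real_sqrt_le_mono P_contraction)

lemma P_A_pow: "0 < s \<Longrightarrow> f \<in> per N \<Longrightarrow> P s ((A ^^ k) f) = (A ^^ k) (P s f)"
  by (induction k) (simp_all add: P_A A_pow_per)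

lemma kernel_op_P_A_pow: "0 < s \<Longrightarrow> kernel_op N (\<lambda>f. P s ((A ^^ k) f))"
proof -
  assume s: "0 < s"
  have "kernel_op N (A ^^ k)"
  proof (induction k)
    case 0
    have "(A ^^ 0) = (\<lambda>f k. f k)" by (simp add: id_def)
    then show ?case using kernel_op_eval[OF N_pos, of "\<lambda>k. k"] by simp
  next
    case (Suc k)
    then show ?case using kernel_op_compose[OF Suc kernel_op_A A_pow_per] by (simp add: comp_def)
  qed
  then show "kernel_op N (\<lambda>f. P s ((A ^^ k) f))"
    by (rule kernel_op_compose[OF _ kernel_op_P[OF s] A_pow_per])
qed

end

text \<open>Five is the highest power of \<open>A\<close> that occurs in \<open>comparison\<close>,
  on the fine side applied to the resolvent of the point source and on the coarse side applied to
  \<open>W\<close>.\<close>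

definition smoothing_sum :: "real \<Rightarrow> real \<Rightarrow> real \<Rightarrow> real" where
  "smoothing_sum a1 b1 s = (\<Sum>k\<le>5. smoothing_const a1 b1 k s)"

lemma (in diffusion_semigroup) nrm1_P_A_pow:
  assumes s: "0 < s" and f: "f \<in> per N" and k: "k \<le> 5"
  shows "nrm1 (P s ((A ^^ k) f)) \<le> smoothing_sum a1 b1 s * nrm0 f"
proof -
  have "0 \<le> smoothing_const a1 b1 j s" for j
    using smoothing_ge s by (simp add: smoothing_const_def)
  then have "smoothing_const a1 b1 k s \<le> smoothing_sum a1 b1 s"
    unfolding smoothing_sum_def using k by (intro member_le_sum) auto
  from mult_right_mono[OF this nrm0_nonneg[of f]] show ?thesis
    using nrm1_A_pow_P[OF s f, of k] by (simp add: P_A_pow[OF s f])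
qed

lemma (in diffusion_semigroup) smoothing_sum_nonneg: "0 < s \<Longrightarrow> 0 \<le> smoothing_sum a1 b1 s"
  unfolding smoothing_sum_def smoothing_const_def using smoothing_ge by (intro sum_nonneg) simp

section \<open>Commutation identities and the estimate of the smoothed error\<close>

context two_semigroups
begin

definition X :: "real \<Rightarrow> (int \<Rightarrow> real) \<Rightarrow> int \<Rightarrow> real" where
  "X s f = P s (I f) - I (P' s f)"

text \<open>The error smoothed by resolvents on both sides. It solves an inhomogeneous equation with
  regular forcing, and the error can be recovered from it at the expense of smoothing factors.\<close>

definition W :: "real \<Rightarrow> (int \<Rightarrow> real) \<Rightarrow> int \<Rightarrow> real" where
  "W s f = K (K (X s (K' f)))"

lemmas pers = R_per I_per C.K_per C.A_per F.K_per F.A_per C.P_per F.P_per per_diff per_add H_per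

lemma X_per: "0 < s \<Longrightarrow> f \<in> per (N * M) \<Longrightarrow> X s f \<in> per N"
  by (simp add: X_def pers)

lemma W_per: "0 < s \<Longrightarrow> f \<in> per (N * M) \<Longrightarrow> W s f \<in> per N"
  by (simp add: W_def pers X_per)

lemmas K_diff = kernel_op_diff[OF C.kernel_op_K]
lemmas A_diff = kernel_op_diff[OF C.kernel_op_A]
lemmas A_add = kernel_op_add[OF C.kernel_op_A]
lemmas P_diff = kernel_op_diff[OF C.kernel_op_P]
lemmas P_add_distrib = kernel_op_add[OF C.kernel_op_P]

text \<open>On the left \<open>A\<close> removes an outer \<open>K\<close>; in
  \<open>W s (F.A g)\<close> the inner \<open>K'\<close> disappears. The results differ by moving a
  resolvent across \<open>I\<close>, once before and once after the evolution, and each move is an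
  instance of \<open>H\<close>.\<close>

lemma A_W:
  assumes s: "0 < s" and g: "g \<in> per (N * M)"
  shows "C.A (W s g) = W s (F.A g) - H (P' s g) + P s (H g)"
proof -
  have 1: "C.A (W s g) = K (P s (I (K' g))) - K (I (P' s (K' g)))"
    unfolding W_def X_def using s g by (simp add: C.A_K pers A_diff K_diff)
  have 2: "W s (F.A g) = K (K (P s (I g))) - K (K (I (P' s g)))"
    unfolding W_def X_def using s g by (simp add: F.K_A pers K_diff)
  have 3: "H (P' s g) = K (I (P' s (K' g))) - K (K (I (P' s g)))"
    unfolding H_def using s g by (simp add: F.P_K)
  have 4: "P s (H g) = K (P s (I (K' g))) - K (K (P s (I g)))"
    unfolding H_def using s g by (simp add: pers P_diff C.P_K)
  show ?thesis unfolding 1 2 3 4 by simp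
qed

lemma A_A_W:
  assumes s: "0 < s" and g: "g \<in> per (N * M)"
  shows "C.A (C.A (W s (F.A g))) = X s g"
  unfolding W_def using s g by (simp add: F.K_A C.A_K pers X_per)

lemma X_double:
  assumes s: "0 < s" and g: "g \<in> per (N * M)"
  shows "X (2 * s) g = P s (X s g) + X s (P' s g)"
  unfolding X_def using s g by (simp add: C.P_double F.P_double P_diff pers)

lemma A_H:
  assumes f: "f \<in> per (N * M)"
  shows "C.A (H f) = I (K' f) - K (I f)"
  unfolding H_def using f by (simp add: A_diff pers C.A_K)

text \<open>Both factors of \<open>A\<close> in \<open>X s q = C.A (C.A (W s (F.A q)))\<close> are
  moved through \<open>W\<close>. This costs terms with \<open>H\<close> acting on powers of
  \<open>A\<close> applied to \<open>q\<close> and \<open>p\<close>, harmless because these are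
  already smoothed. The remaining \<open>C.A (H (F.A p))\<close> is evaluated exactly by
  \<open>A_H\<close>.\<close>

lemma X_P:
  assumes s: "0 < s" and g: "g \<in> per (N * M)"
  defines "q \<equiv> P' s g" and "p \<equiv> P' (2 * s) g"
  shows "X s q = W s (F.A (F.A (F.A q))) - H (F.A (F.A p)) + P s (H (F.A (F.A q)))
    + C.A (P s (H (F.A q))) - I p + K (I (F.A p))"
proof -
  have q: "q \<in> per (N * M)" and p: "p \<in> per (N * M)" using s g by (simp_all add: q_def p_def pers)
  have Pq: "P' s (F.A q) = F.A p" "P' s (F.A (F.A q)) = F.A (F.A p)"
    using s g by (simp_all add: q_def p_def F.P_double F.P_A pers)
  have 1: "C.A (W s (F.A q)) = W s (F.A (F.A q)) - H (F.A p) + P s (H (F.A q))"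
    using A_W[OF s F.A_per[OF q]] by (simp add: Pq)
  have 2: "C.A (C.A (W s (F.A q))) = C.A (W s (F.A (F.A q))) - C.A (H (F.A p)) + C.A (P s (H (F.A q)))"
    unfolding 1 using s q p by (simp add: A_diff A_add pers W_per)
  have 3: "C.A (W s (F.A (F.A q))) = W s (F.A (F.A (F.A q))) - H (F.A (F.A p)) + P s (H (F.A (F.A q)))"
    using A_W[OF s F.A_per[OF F.A_per[OF q]]] by (simp add: Pq)
  have 4: "C.A (H (F.A p)) = I p - K (I (F.A p))"
    using A_H[OF F.A_per[OF p]] by (simp add: F.K_A[OF p])
  show ?thesis unfolding A_A_W[OF s q, symmetric] 2 3 4 by (simp add: fun_eq_iff)
qed

text \<open>Doubling the time splits the error into \<open>P s (X s g)\<close>, where the coarse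
  flow absorbs the two factors of \<open>A\<close> that undo the smoothing in \<open>W\<close>, and
  \<open>X s q\<close>, where \<open>q\<close> is smooth on the fine side. The terms
  \<open>I p\<close> cancel, and \<open>K (I (F.A p)) - R p\<close> is
  \<open>- ritz_error p\<close>.\<close>

lemma difference_identity:
  assumes s: "0 < s" and g: "g \<in> per (N * M)"
  defines "q \<equiv> P' s g" and "p \<equiv> P' (2 * s) g"
  shows "P (2 * s) (I g) - R p = P s (C.A (C.A (W s (F.A g)))) + W s (F.A (F.A (F.A q)))
    - H (F.A (F.A p)) + P s (H (F.A (F.A q))) + C.A (P s (H (F.A q))) - ritz_error p"
proof -
  have 1: "P (2 * s) (I g) - I p = P s (C.A (C.A (W s (F.A g)))) + X s q"
    using X_double[OF s g] unfolding A_A_W[OF s g] by (simp add: X_def[of "2 * s"] p_def q_def)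
  show ?thesis
  proof
    fix k
    show "(P (2 * s) (I g) - R p) k = (P s (C.A (C.A (W s (F.A g)))) + W s (F.A (F.A (F.A q)))
      - H (F.A (F.A p)) + P s (H (F.A (F.A q))) + C.A (P s (H (F.A q))) - ritz_error p) k"
      using fun_cong[OF 1, of k] fun_cong[OF X_P[OF s g, folded q_def p_def], of k]
      unfolding ritz_error_def plus_fun_apply minus_apply by linarith
  qed
qed

text \<open>Commuting \<open>A\<close> past \<open>I\<close> produces a term that cancels the only contribution in which \<open>H\<close> would
  act on the rough datum \<open>F.A g\<close>.\<close>

lemma generator_difference_identity:
  assumes s: "0 < s" and g: "g \<in> per (N * M)"
  defines "q \<equiv> P' s g" and "p \<equiv> P' (2 * s) g"
  shows "C.A (P (2 * s) (I g)) - R (F.A p)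
    = P s (C.A (C.A (C.A (W s (F.A g))))) + P s (C.A (C.A (H (F.A q)))) + W s (F.A (F.A (F.A (F.A q))))
    - H (F.A (F.A (F.A p))) + P s (H (F.A (F.A (F.A q)))) + C.A (P s (H (F.A (F.A q)))) - ritz_error (F.A p)"
proof -
  have Ag: "F.A g \<in> per (N * M)" by (rule F.A_per[OF g])
  have ss: "0 < 2 * s" using s by simp
  have Pq: "P' s (F.A g) = F.A q" "P' (2 * s) (F.A g) = F.A p"
    using s ss g by (simp_all add: q_def p_def F.P_A)
  have W: "W s (F.A (F.A g)) = C.A (W s (F.A g)) + H (F.A q) - P s (H (F.A g))"
    using A_W[OF s Ag] by (simp add: Pq algebra_simps)
  have 1: "P s (C.A (C.A (W s (F.A (F.A g))))) = P s (C.A (C.A (C.A (W s (F.A g)))))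
      + P s (C.A (C.A (H (F.A q))))
      - P s (C.A (C.A (P s (H (F.A g)))))"
    unfolding W using s g Ag
    by (simp add: q_def A_diff A_add P_diff P_add_distrib pers W_per)
  have 2: "P s (C.A (C.A (P s (H (F.A g))))) = C.A (P (2 * s) (I g)) - P (2 * s) (I (F.A g))"
  proof -
    have "C.A (H (F.A g)) = I g - K (I (F.A g))" using A_H[OF Ag] by (simp add: F.K_A[OF g])
    then have "C.A (C.A (H (F.A g))) = C.A (I g) - I (F.A g)"
      using g Ag by (simp add: A_diff pers C.A_K)
    moreover have "P s (C.A (C.A (P s (H (F.A g))))) = P (2 * s) (C.A (C.A (H (F.A g))))"
      using s Ag by (simp add: C.P_double C.P_A pers)
    ultimately show ?thesis using ss g Ag by (simp add: P_diff C.P_A pers)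
  qed
  show ?thesis
  proof
    fix k
    show "(C.A (P (2 * s) (I g)) - R (F.A p)) k
      = (P s (C.A (C.A (C.A (W s (F.A g))))) + P s (C.A (C.A (H (F.A q)))) + W s (F.A (F.A (F.A (F.A q))))
        - H (F.A (F.A (F.A p))) + P s (H (F.A (F.A (F.A q)))) + C.A (P s (H (F.A (F.A q))))
            - ritz_error (F.A p)) k"
      using fun_cong[OF difference_identity[OF s Ag, unfolded Pq], of k] fun_cong[OF 1, of k]
          fun_cong[OF 2, of k]
      unfolding plus_fun_apply minus_apply by linarith
  qed
qed

lemma \<eta>_nonneg: "0 \<le> \<eta>"
  using elliptic_bounds(2)[of 0] C.nrm1_nonneg order_trans by blast

lemma nrm0_H: "f \<in> per (N * M) \<Longrightarrow> C.nrm0 (H f) \<le> \<eta> * F.nrm0 f"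
  using elliptic_bounds(1)[of f] C.nrm0_le_nrm1[of "H f"] by linarith

text \<open>With \<open>x = K' g\<close> the time derivative of \<open>W s g\<close> is
  \<open>K (K (I (P' s g))) - K (P s (I x))\<close>, which equals
  \<open>- C.A (W s g) - H (P' s g)\<close>. Both terms of \<open>W\<close> tend to
  \<open>K (K (I x))\<close>, so the initial value is zero and \<open>duhamel_bound\<close> applies
  with forcing of size \<open>\<eta>\<close>.\<close>

lemma nrm1_W:
  assumes s: "0 < s" and g: "g \<in> per (N * M)"
  shows "C.nrm1 (W s g) \<le> sqrt (2 * (2 + 2 * a1 * b1\<^sup>2) * s) * (\<eta> * F.nrm0 g)"
proof -
  define x where "x = K' g"
  have x: "x \<in> per (N * M)" "F.A x = g" using g by (simp_all add: x_def pers F.A_K)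
  have KK: "kernel_op N (\<lambda>f. K (K f))" by (rule kernel_op_compose[OF C.kernel_op_K C.kernel_op_K C.K_per])
  have KKI: "kernel_op (N * M) (\<lambda>f. K (K (I f)))"
    by (rule kernel_op_compose[OF kernel_op_I KK I_per])
  have W: "W s g = K (K (P s (I x))) - K (K (I (P' s x)))" if "0 < s" for s
    unfolding W_def X_def x_def[symmetric] using that x by (simp add: K_diff pers)
  have "(C.nrm1 (W s g))\<^sup>2 \<le> 2 * (2 + 2 * a1 * b1\<^sup>2) * s * (\<eta> * F.nrm0 g)\<^sup>2"
  proof (rule C.duhamel_bound[where \<phi> = "\<lambda>s. H (P' s g)", OF _ _ _ _ _ s])
    fix s :: real assume s: "0 < s"
    show "W s g \<in> per N" "H (P' s g) \<in> per N" using s g by (simp_all add: W_per pers)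
    show "C.e0 (H (P' s g)) \<le> (\<eta> * F.nrm0 g)\<^sup>2"
    proof -
      have "C.nrm0 (H (P' s g)) \<le> \<eta> * F.nrm0 (P' s g)" using s g by (intro nrm0_H pers)
      also have "\<dots> \<le> \<eta> * F.nrm0 g" using s g by (intro mult_left_mono F.nrm0_P \<eta>_nonneg)
      finally show ?thesis unfolding C.nrm0_sq[symmetric] by (intro power_mono C.nrm0_nonneg)
    qed
    fix k
    have Ix: "I x \<in> per N" by (rule I_per[OF x(1)])
    have d1: "((\<lambda>s. K (K (P s (I x))) k) has_real_derivative K (K (- C.A (P s (I x)))) k) (at s)"
      using s Ix x
      by (intro kernel_op_deriv[OF KK] C.P_deriv per_uminus pers)
    have d2: "((\<lambda>s. K (K (I (P' s x))) k) has_real_derivative K (K (I (- F.A (P' s x)))) k) (at s)"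
      using s x by (intro kernel_op_deriv[OF KKI] F.P_deriv per_uminus pers)
    have "C.A (W s g) = K (P s (I x)) - K (I (P' s x))"
      using W[OF s] s x by (simp add: A_diff pers C.A_K)
    moreover have "H (P' s g) = K (I (P' s x)) - K (K (I (P' s g)))"
      unfolding H_def using s g by (simp add: x_def F.P_K)
    moreover have "K (K (- C.A (P s (I x)))) = - K (P s (I x))"
      using s x by (simp add: kernel_op_uminus[OF KK] C.K_A pers)
    moreover have "K (K (I (- F.A (P' s x)))) = - K (K (I (P' s g)))"
      using s g x by (simp add: kernel_op_uminus[OF KKI] pers F.P_A[symmetric])
    ultimately have eq: "(- C.A (W s g) - H (P' s g)) k = K (K (- C.A (P s (I x)))) k
        - K (K (I (- F.A (P' s x)))) k"
      by simp
    show "((\<lambda>s. W s g k) has_real_derivative (- C.A (W s g) - H (P' s g)) k) (at s)"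
      unfolding eq
    proof (rule DERIV_cong_ev[OF refl _ refl, THEN iffD1, OF _ DERIV_diff[OF d1 d2]])
      show "\<forall>\<^sub>F s in nhds s. K (K (P s (I x))) k - K (K (I (P' s x))) k = W s g k"
        using eventually_nhds_in_open[of "{0<..}" s] s by (auto elim!: eventually_mono simp: W)
    qed
  next
    fix k
    have "((\<lambda>s. K (K (P s (I x))) k - K (K (I (P' s x))) k) \<longlongrightarrow> K (K (I x)) k - K (K (I x)) k) (at_right 0)"
      using x by (intro tendsto_diff kernel_op_lim[OF KK] kernel_op_lim[OF KKI] C.P_lim F.P_lim pers)
    moreover have "\<forall>\<^sub>F s in at_right 0. K (K (P s (I x))) k - K (K (I (P' s x))) k = W s g k"
      using eventually_at_right_less[of "0::real"] by eventually_elim (simp add: W)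
    ultimately show "((\<lambda>s. W s g k) \<longlongrightarrow> 0) (at_right 0)"
      using Lim_transform_eventually by simp
  qed
  from real_sqrt_le_mono[OF this] show ?thesis
    using \<eta>_nonneg F.nrm0_nonneg[of g] C.nrm1_nonneg[of "W s g"] by (simp add: real_sqrt_mult)
qed

end

text \<open>Adding \<open>1\<close> to each factor makes the product dominate every monomial in the
  smoothing, Duhamel and point source constants that arises below.\<close>

definition comparison_const :: "real \<Rightarrow> real \<Rightarrow> real \<Rightarrow> real \<Rightarrow> real \<Rightarrow> real" where
  "comparison_const a0 a1 b1 len s = (smoothing_sum a1 b1 s + 1)\<^sup>2
    * (sqrt (2 * (2 + 2 * a1 * b1\<^sup>2) * s) + 1) * (2 * (sqrt (2 * a1 / len + 2 * len) / a0) + 1)"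

context two_semigroups
begin

text \<open>The datum is \<open>d = F.A G\<close> with \<open>F.nrm0 G\<close> bounded, so a power
  of \<open>A\<close> on either side can be absorbed by \<open>nrm1_P_A_pow\<close>. The factors
  \<open>10\<close> and \<open>11\<close> count terms: five from expanding
  \<open>W s (F.A d)\<close>, then five or six single ones.\<close>

lemma comparison:
  fixes y :: int
  assumes s: "0 < s"
  defines "p \<equiv> P' (2 * s) (F.delta (y * int M))"
  shows "C.nrm1 (P (2 * s) (C.delta y) - R p) \<le> 10 * (comparison_const a0 a1 b1 len s * \<eta>)"
    and "C.nrm1 (C.A (P (2 * s) (C.delta y)) - R (F.A p)) \<le> 11 * (comparison_const a0 a1 b1 len s * \<eta>)"
proof -
  define d where "d = F.delta (y * int M)"
  define G where "G = K' d"
  define q where "q = P' s d"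
  define S w g0 where "S = smoothing_sum a1 b1 s" and "w = sqrt (2 * (2 + 2 * a1 * b1\<^sup>2) * s)"
    and "g0 = 2 * (sqrt (2 * a1 / len + 2 * len) / a0)"
  define \<Lambda> where "\<Lambda> = comparison_const a0 a1 b1 len s"
  have nn: "0 \<le> S" "0 \<le> w" "0 \<le> g0" "0 \<le> \<eta>"
    using C.smoothing_sum_nonneg[OF s] s C.a1_pos C.len_pos C.a0_pos \<eta>_nonneg
    by (simp_all add: S_def w_def g0_def)
  have \<Lambda>: "S * (w * g0) \<le> \<Lambda>" "S * g0 \<le> \<Lambda>" "S * (S * g0) \<le> \<Lambda>" "S \<le> \<Lambda>" "w * (S * g0) \<le> \<Lambda>"
  proof -
    have "0 \<le> S * S * w * g0" "0 \<le> S * S * w" "0 \<le> S * S * g0" "0 \<le> S * S" "0 \<le> S * w * g0" "0 \<le> S * w"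
      "0 \<le> S * g0" "0 \<le> w * g0" using nn by simp_all
    then show "S * (w * g0) \<le> \<Lambda>" "S * g0 \<le> \<Lambda>" "S * (S * g0) \<le> \<Lambda>" "S \<le> \<Lambda>" "w * (S * g0) \<le> \<Lambda>"
      using nn unfolding \<Lambda>_def comparison_const_def S_def[symmetric] w_def[symmetric] g0_def[symmetric]
      by (simp_all add: power2_eq_square algebra_simps)
  qed
  have \<Lambda>\<eta>: "x \<le> \<Lambda> * \<eta>" if "x \<le> c * \<eta>" "c \<le> \<Lambda>" for x c
    using that mult_right_mono[OF that(2) nn(4)] by linarith
  have d: "d \<in> per (N * M)" and G: "G \<in> per (N * M)" "F.A G = d" and q: "q \<in> per (N * M)"
    using s by (simp_all add: d_def G_def q_def pers F.delta_per F.A_K)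
  have Gn: "F.nrm0 G \<le> g0"
    using F.nrm1_K_delta[of "y * int M"] F.nrm0_le_nrm1[of G] by (simp add: G_def d_def g0_def F.csob_def)
  have Pp: "P' s q = p" using s d by (simp add: q_def p_def d_def F.P_double)
  have p: "p \<in> per (N * M)" using s q by (simp add: Pp[symmetric] pers)
  \<comment> \<open>The source is traded for \<open>G\<close> at the price of one more power of
    \<open>A\<close>, so four powers on \<open>q\<close> need smoothing of order five.\<close>
  have qk: "F.nrm0 ((F.A ^^ k) q) \<le> S * g0" if "k \<le> 4" for k
  proof -
    have "(F.A ^^ k) q = P' s ((F.A ^^ Suc k) G)"
      using s G d by (simp add: q_def F.P_A_pow funpow_swap1)
    then have "F.nrm0 ((F.A ^^ k) q) \<le> F.nrm1 (P' s ((F.A ^^ Suc k) G))"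
      using F.nrm0_le_nrm1 by simp
    also have "\<dots> \<le> S * F.nrm0 G"
      unfolding S_def using that by (intro F.nrm1_P_A_pow s G) auto
    also have "\<dots> \<le> S * g0" using Gn nn by (intro mult_left_mono)
    finally show ?thesis .
  qed
  have pk: "F.nrm0 ((F.A ^^ k) p) \<le> S * g0" if "k \<le> 4" for k
  proof -
    have "(F.A ^^ k) p = P' s ((F.A ^^ k) q)" using s q by (simp add: Pp[symmetric] F.P_A_pow)
    then have "F.nrm0 ((F.A ^^ k) p) \<le> F.nrm0 ((F.A ^^ k) q)"
      using F.nrm0_P[OF s F.A_pow_per[OF q]] by simp
    with qk[OF that] show ?thesis by linarith
  qed
  have q': "F.nrm0 q \<le> S * g0" "F.nrm0 (F.A q) \<le> S * g0" "F.nrm0 (F.A (F.A q)) \<le> S * g0"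
    "F.nrm0 (F.A (F.A (F.A q))) \<le> S * g0" "F.nrm0 (F.A (F.A (F.A (F.A q)))) \<le> S * g0"
    using qk[of 0] qk[of 1] qk[of 2] qk[of 3] qk[of 4] by (simp_all add: eval_nat_numeral)
  have p': "F.nrm0 (F.A p) \<le> S * g0" "F.nrm0 (F.A (F.A p)) \<le> S * g0" "F.nrm0 (F.A (F.A (F.A p))) \<le> S * g0"
    using pk[of 1] pk[of 2] pk[of 3] by (simp_all add: eval_nat_numeral)
  have Aq: "F.A q \<in> per (N * M)" "F.A (F.A q) \<in> per (N * M)" "F.A (F.A (F.A q)) \<in> per (N * M)"
    "F.A (F.A (F.A (F.A q))) \<in> per (N * M)" and Ap: "F.A p \<in> per (N * M)" "F.A (F.A p) \<in> per (N * M)"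
    "F.A (F.A (F.A p)) \<in> per (N * M)" using q p by (simp_all add: pers)
  define PA where "PA k f = P s ((C.A ^^ k) f)" for k f
  have PA: "C.nrm1 (PA k f) \<le> S * C.nrm0 f" if "f \<in> per N" "k \<le> 5" for k f
    unfolding PA_def S_def using that s by (intro C.nrm1_P_A_pow)
  have PA_le: "C.nrm1 (PA k f) \<le> S * (\<eta> * x)" if "f \<in> per N" "k \<le> 5" "C.nrm0 f \<le> \<eta> * x" for k f x
    using PA[OF that(1,2)] mult_left_mono[OF that(3) nn(1)] by linarith
  have H_le: "C.nrm0 (H f) \<le> \<eta> * x" "C.nrm1 (H f) \<le> \<eta> * x" if "f \<in> per (N * M)" "F.nrm0 f \<le> x" for f x
    using nrm0_H[OF that(1)] elliptic_bounds(1)[OF that(1)] mult_left_mono[OF that(2) nn(4)] by linarith+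
  have PH_le: "C.nrm0 (P s (H f)) \<le> \<eta> * x" if "f \<in> per (N * M)" "F.nrm0 f \<le> x" for f x
    using C.nrm0_P[OF s H_per[OF that(1)]] H_le(1)[OF that] by linarith
  have W_le: "C.nrm1 (W s f) \<le> w * (\<eta> * x)" if "f \<in> per (N * M)" "F.nrm0 f \<le> x" for f x
    using nrm1_W[OF s that(1)] mult_left_mono[OF mult_left_mono[OF that(2) nn(4)] nn(2)]
    by (simp add: w_def)
  \<comment> \<open>One factor \<open>A\<close> passes from the argument of \<open>W\<close> to the
    coarse side by \<open>A_W\<close>. Used for \<open>f = G\<close> and then for
    \<open>f = d\<close>, this leads from \<open>W s (F.A d)\<close> back to
    \<open>W s G\<close>.\<close>
  have PA_expand: "C.nrm1 (PA k (W s (F.A f))) \<le> C.nrm1 (PA (Suc k) (W s f))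
      + C.nrm1 (PA k (H (P' s f))) + C.nrm1 (PA k (P s (H f)))"
    if f: "f \<in> per (N * M)" for k f
  proof -
    have m: "W s f \<in> per N" "C.A (W s f) \<in> per N" "H (P' s f) \<in> per N" "P s (H f) \<in> per N"
      using s f by (simp_all add: pers W_per)
    have lin: "kernel_op N (PA k)" unfolding PA_def[abs_def] by (rule C.kernel_op_P_A_pow[OF s])
    have "W s (F.A f) = C.A (W s f) + H (P' s f) - P s (H f)"
      using A_W[OF s f] by (simp add: algebra_simps)
    then have "PA k (W s (F.A f)) = PA k (C.A (W s f)) + PA k (H (P' s f)) - PA k (P s (H f))"
      using kernel_op_diff[OF lin per_add[OF m(2,3)] m(4)] kernel_op_add[OF lin m(2,3)] by simp
    moreover have "PA k (C.A (W s f)) = PA (Suc k) (W s f)" by (simp add: PA_def funpow_swap1)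
    ultimately show ?thesis
      using C.nrm1_diff[of "PA k (C.A (W s f)) + PA k (H (P' s f))" "PA k (P s (H f))"]
        C.nrm1_add[of "PA k (C.A (W s f))" "PA k (H (P' s f))"] by simp
  qed
  have W1: "C.nrm1 (PA k (W s d)) \<le> 3 * (\<Lambda> * \<eta>)" if k: "k \<le> 4" for k
  proof -
    have "C.nrm0 (W s G) \<le> \<eta> * (w * g0)"
      using W_le[OF G(1) Gn] C.nrm0_le_nrm1[of "W s G"] by (simp add: mult_ac)
    then have "C.nrm1 (PA (Suc k) (W s G)) \<le> S * (\<eta> * (w * g0))"
      using k s G by (intro PA_le W_per) auto
    then have 1: "C.nrm1 (PA (Suc k) (W s G)) \<le> \<Lambda> * \<eta>" by (intro \<Lambda>\<eta>[OF _ \<Lambda>(1)]) (simp add: mult_ac)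
    have "F.nrm0 (P' s G) \<le> g0" using F.nrm0_P[OF s G(1)] Gn by linarith
    then have "C.nrm1 (PA k (H (P' s G))) \<le> S * (\<eta> * g0)"
      using k s G by (intro PA_le H_le pers) auto
    then have 2: "C.nrm1 (PA k (H (P' s G))) \<le> \<Lambda> * \<eta>" by (intro \<Lambda>\<eta>[OF _ \<Lambda>(2)]) (simp add: mult_ac)
    have "C.nrm1 (PA k (P s (H G))) \<le> S * (\<eta> * g0)"
      using k s G Gn by (intro PA_le PH_le pers) auto
    then have 3: "C.nrm1 (PA k (P s (H G))) \<le> \<Lambda> * \<eta>" by (intro \<Lambda>\<eta>[OF _ \<Lambda>(2)]) (simp add: mult_ac)
    show ?thesis using PA_expand[OF G(1), of k] 1 2 3 unfolding G(2) by linarith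
  qed
  have W2: "C.nrm1 (PA k (W s (F.A d))) \<le> 5 * (\<Lambda> * \<eta>)" if k: "k \<le> 3" for k
  proof -
    have "C.nrm1 (PA k (H q)) \<le> S * (\<eta> * (S * g0))"
      using k q q' by (intro PA_le H_le pers) auto
    then have 2: "C.nrm1 (PA k (H q)) \<le> \<Lambda> * \<eta>" by (intro \<Lambda>\<eta>[OF _ \<Lambda>(3)]) (simp add: mult_ac)
    \<comment> \<open>The datum \<open>d\<close> is rough, so \<open>H d\<close> requires the
      separate bound for point sources.\<close>
    have "C.nrm0 (P s (H d)) \<le> \<eta> * 1"
      using C.nrm0_P[OF s H_per[OF d]] elliptic_bounds(2)[of y] C.nrm0_le_nrm1[of "H d"] by (simp add: d_def)
    then have "C.nrm1 (PA k (P s (H d))) \<le> S * (\<eta> * 1)"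
      using k s d by (intro PA_le pers) auto
    then have 3: "C.nrm1 (PA k (P s (H d))) \<le> \<Lambda> * \<eta>" by (intro \<Lambda>\<eta>[OF _ \<Lambda>(4)]) (simp add: mult_ac)
    have "C.nrm1 (PA (Suc k) (W s d)) \<le> 3 * (\<Lambda> * \<eta>)" using k by (intro W1) simp
    then show ?thesis using PA_expand[OF d, of k] 2 3 unfolding q_def[symmetric] by linarith
  qed
  have W3: "C.nrm1 (W s f) \<le> \<Lambda> * \<eta>" if "f \<in> per (N * M)" "F.nrm0 f \<le> S * g0" for f
    using W_le[OF that] by (intro \<Lambda>\<eta>[OF _ \<Lambda>(5)]) (simp add: mult_ac)
  have H3: "C.nrm1 (H f) \<le> \<Lambda> * \<eta>" if "f \<in> per (N * M)" "F.nrm0 f \<le> S * g0" for f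
    using H_le(2)[OF that] by (intro \<Lambda>\<eta>[OF _ \<Lambda>(2)]) (simp add: mult_ac)
  have PH3: "C.nrm1 (PA k (H f)) \<le> \<Lambda> * \<eta>" if "f \<in> per (N * M)" "F.nrm0 f \<le> S * g0" "k \<le> 5" for f k
  proof -
    have "C.nrm1 (PA k (H f)) \<le> S * (\<eta> * (S * g0))" using that by (intro PA_le H_le pers)
    then show ?thesis by (intro \<Lambda>\<eta>[OF _ \<Lambda>(3)]) (simp add: mult_ac)
  qed
  have ritz: "C.nrm1 (ritz_error v) \<le> \<Lambda> * \<eta>" if "v \<in> per (N * M)" "F.nrm0 (F.A v) \<le> S * g0" for v
  proof -
    have "C.nrm1 (ritz_error v) \<le> (S * g0) * \<eta>"
      using elliptic_bounds(3)[OF that(1)] mult_left_mono[OF that(2) nn(4)] by (simp add: mult_ac)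
    then show ?thesis by (rule \<Lambda>\<eta>[OF _ \<Lambda>(2)])
  qed
  have PA0: "P s f = PA 0 f" "C.A (P s f) = PA 1 f" "P s (C.A (C.A f)) = PA 2 f"
    "P s (C.A (C.A (C.A f))) = PA 3 f" if "f \<in> per N" for f
    using s that by (simp_all add: PA_def C.P_A eval_nat_numeral)
  have Id: "I d = C.delta y" by (simp add: d_def I_delta)
  have tri: "C.nrm1 (f + g) \<le> x + z" "C.nrm1 (f - g) \<le> x + z" if "C.nrm1 f \<le> x" "C.nrm1 g \<le> z" for f g x z
    using C.nrm1_add[of f g] C.nrm1_diff[of f g] that by linarith+
  have PA_eq: "P s (C.A (C.A (W s (F.A d)))) = PA 2 (W s (F.A d))"
    "P s (C.A (C.A (C.A (W s (F.A d))))) = PA 3 (W s (F.A d))"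
    using PA0(3,4)[OF W_per[OF s F.A_per[OF d]]] by blast+
  have PH_eq: "P s (H f) = PA 0 (H f)" "C.A (P s (H f)) = PA 1 (H f)" "P s (C.A (C.A (H f))) = PA 2 (H f)"
    if "f \<in> per (N * M)" for f
    using PA0(1-3)[OF H_per[OF that]] by blast+
  have eq0: "P (2 * s) (C.delta y) - R p = PA 2 (W s (F.A d)) + W s (F.A (F.A (F.A q)))
    - H (F.A (F.A p)) + PA 0 (H (F.A (F.A q))) + PA 1 (H (F.A q)) - ritz_error p"
    using difference_identity[OF s d]
    unfolding Id q_def[symmetric] p_def[folded d_def, symmetric] PA_eq PH_eq(2)[OF Aq(1)] PH_eq(1)[OF Aq(2)] .
  have "C.nrm1 (P (2 * s) (C.delta y) - R p) \<le> 5 * (\<Lambda> * \<eta>) + \<Lambda> * \<eta> + \<Lambda> * \<eta> + \<Lambda> * \<eta> + \<Lambda> * \<eta> + \<Lambda> * \<eta>"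
    unfolding eq0 using q' p' Aq Ap q p by (intro tri W2 W3 H3 PH3 ritz) auto
  then show "C.nrm1 (P (2 * s) (C.delta y) - R p) \<le> 10 * (comparison_const a0 a1 b1 len s * \<eta>)"
    unfolding \<Lambda>_def by linarith
  have eq1: "C.A (P (2 * s) (C.delta y)) - R (F.A p) = PA 3 (W s (F.A d)) + PA 2 (H (F.A q))
      + W s (F.A (F.A (F.A (F.A q))))
    - H (F.A (F.A (F.A p))) + PA 0 (H (F.A (F.A (F.A q)))) + PA 1 (H (F.A (F.A q))) - ritz_error (F.A p)"
    using generator_difference_identity[OF s d]
    unfolding Id q_def[symmetric] p_def[folded d_def, symmetric] PA_eq PH_eq(3)[OF Aq(1)] PH_eq(2)[OF Aq(2)]
      PH_eq(1)[OF Aq(3)] .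
  have "C.nrm1 (C.A (P (2 * s) (C.delta y)) - R (F.A p)) \<le> 5 * (\<Lambda> * \<eta>) + \<Lambda> * \<eta> + \<Lambda> * \<eta> + \<Lambda> * \<eta> + \<Lambda> * \<eta>
      + \<Lambda> * \<eta> + \<Lambda> * \<eta>"
    unfolding eq1 using q' p' Aq Ap q p by (intro tri W2 W3 H3 PH3 ritz) auto
  then show "C.nrm1 (C.A (P (2 * s) (C.delta y)) - R (F.A p)) \<le> 11 * (comparison_const a0 a1 b1 len s * \<eta>)"
    unfolding \<Lambda>_def by linarith
qed

end

section \<open>The semigroup generated by a forward kernel\<close>

lemma (in lattice_diffusion) resolvent_exists:
  "\<exists>K. kernel_op N K \<and> (\<forall>f\<in>per N. K f \<in> per N \<and> A (K f) = f \<and> K (A f) = f)"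
proof (rule kernel_op_inverse[OF N_pos kernel_op_A A_per A_inj])
  fix S assume "kernel_op N S" "\<And>f. f \<in> per N \<Longrightarrow> S f \<in> per N"
    "\<And>f. f \<in> per N \<Longrightarrow> A (S f) = f" "\<And>f. f \<in> per N \<Longrightarrow> S (A f) = f"
  then show ?thesis by (intro exI[of _ S]) simp
qed

text \<open>\<open>\<kappa>\<close> is the matrix of \<open>A\<close>, and only the forward
  equation, in the second variable of \<open>q\<close>, is given. Commutation with \<open>A\<close>
  and the semigroup law have to be derived from uniqueness for linear systems.\<close>

locale forward_kernel = lattice_diffusion +
  fixes \<kappa> :: "int \<Rightarrow> nat \<Rightarrow> real" and q :: "int \<Rightarrow> nat \<Rightarrow> real \<Rightarrow> real"
  assumes A_eq: "f \<in> per N \<Longrightarrow> A f k = (\<Sum>l<N. \<kappa> k l * f (int l))"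
    and q_per: "0 < s \<Longrightarrow> (\<lambda>k. q k l s) \<in> per N"
    and q_deriv: "0 < s \<Longrightarrow> l < N \<Longrightarrow> (q k l has_real_derivative - (\<Sum>j<N. \<kappa> (int j) l * q k j s)) (at s)"
    and q_lim: "i < N \<Longrightarrow> l < N \<Longrightarrow> (q (int i) l \<longlongrightarrow> (if i = l then 1 else 0)) (at_right 0)"
begin

definition T :: "real \<Rightarrow> (int \<Rightarrow> real) \<Rightarrow> int \<Rightarrow> real" where
  "T s f k = (\<Sum>l<N. q k l s * f (int l))"

lemma T_per: "0 < s \<Longrightarrow> T s f \<in> per N"
  unfolding T_def by (intro perI sum.cong refl) (use q_per in \<open>simp add: per_def\<close>)

lemma kernel_op_T: "kernel_op N (T s)"
  unfolding kernel_op_def by (intro exI[of _ "\<lambda>k l. q k l s"]) (simp add: T_def)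

lemma T_deriv_forward:
  assumes s: "0 < s" and f: "f \<in> per N"
  shows "((\<lambda>s. T s f k) has_real_derivative - T s (A f) k) (at s)"
proof -
  have "((\<lambda>s. T s f k) has_real_derivative (\<Sum>l<N. - (\<Sum>j<N. \<kappa> (int j) l * q k j s) * f (int l))) (at s)"
    unfolding T_def
  proof (rule DERIV_sum)
    fix l assume "l \<in> {..<N}"
    then have "l < N" by simp
    from DERIV_cmult_right[OF q_deriv[OF s this]]
    show "((\<lambda>s. q k l s * f (int l)) has_real_derivative - (\<Sum>j<N. \<kappa> (int j) l * q k j s) * f (int l)) (at s)" .
  qed
  moreover have "(\<Sum>l<N. (\<Sum>j<N. \<kappa> (int j) l * q k j s) * f (int l)) = T s (A f) k"
    unfolding T_def A_eq[OF f] sum_distrib_left sum_distrib_right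
    by (subst sum.swap) (simp add: mult_ac)
  ultimately show ?thesis by (simp add: sum_negf)
qed

text \<open>Left multiplication by \<open>\<kappa>\<close> commutes with the forward system, so the
  difference of both sides solves it again. Both sides tend to the same entry of
  \<open>\<kappa>\<close> at time zero, and uniqueness makes the difference vanish.\<close>

lemma q_backward:
  assumes s: "0 < s" and k: "k < N" and l: "l < N"
  shows "(\<Sum>i<N. \<kappa> (int k) i * q (int i) l s) = (\<Sum>j<N. \<kappa> (int j) l * q (int k) j s)"
proof -
  define w where "w l s = (\<Sum>i<N. \<kappa> (int k) i * q (int i) l s) - (\<Sum>j<N. \<kappa> (int j) l * q (int k) j s)" for l s
  have "w l s = 0"
  proof (rule linear_ode_unique[where c = "\<lambda>l j. - \<kappa> (int j) l" and N = N, OF _ _ s l])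
    fix l :: nat and s :: real assume l: "l < N" and s: "0 < s"
    have "(w l has_real_derivative (\<Sum>i<N. \<kappa> (int k) i * (- (\<Sum>j<N. \<kappa> (int j) l * q (int i) j s)))
        - (\<Sum>j<N. \<kappa> (int j) l * (- (\<Sum>i<N. \<kappa> (int i) j * q (int k) i s)))) (at s)"
      unfolding w_def[abs_def] using s l by (intro DERIV_diff DERIV_sum DERIV_cmult q_deriv) auto
    moreover have "(\<Sum>i<N. \<kappa> (int k) i * (\<Sum>j<N. \<kappa> (int j) l * q (int i) j s))
        = (\<Sum>j<N. \<kappa> (int j) l * (\<Sum>i<N. \<kappa> (int k) i * q (int i) j s))"
      unfolding sum_distrib_left by (subst sum.swap) (simp add: mult_ac)
    ultimately show "(w l has_real_derivative (\<Sum>j<N. - \<kappa> (int j) l * w j s)) (at s)"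
      by (simp add: w_def right_diff_distrib sum_subtractf sum_negf)
  next
    fix l assume l: "l < N"
    have "((\<lambda>s. w l s) \<longlongrightarrow> (\<Sum>i<N. \<kappa> (int k) i * (if i = l then 1 else 0))
        - (\<Sum>j<N. \<kappa> (int j) l * (if k = j then 1 else 0))) (at_right 0)"
      unfolding w_def using k l by (intro tendsto_intros q_lim) auto
    moreover have "(\<Sum>i<N. \<kappa> (int k) i * (if i = l then 1 else 0)) = \<kappa> (int k) l"
      "(\<Sum>j<N. \<kappa> (int j) l * (if k = j then 1 else 0)) = \<kappa> (int k) l"
      using k l by (simp_all add: if_distrib[of "\<lambda>x. _ * x"] cong: if_cong)
    ultimately show "(w l \<longlongrightarrow> 0) (at_right 0)" by simp
  qed
  then show ?thesis by (simp add: w_def)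
qed

lemma T_A:
  assumes s: "0 < s" and f: "f \<in> per N"
  shows "T s (A f) = A (T s f)"
proof (rule per_eqI[OF T_per[OF s] A_per[OF T_per[OF s]] N_pos])
  fix k assume k: "k < N"
  have "A (T s f) (int k) = (\<Sum>l<N. (\<Sum>i<N. \<kappa> (int k) i * q (int i) l s) * f (int l))"
    unfolding A_eq[OF T_per[OF s]] T_def sum_distrib_left sum_distrib_right
    by (subst sum.swap) (simp add: mult_ac)
  also have "\<dots> = (\<Sum>l<N. (\<Sum>j<N. \<kappa> (int j) l * q (int k) j s) * f (int l))"
    using q_backward[OF s k] by (intro sum.cong) auto
  also have "\<dots> = T s (A f) (int k)"
    unfolding T_def A_eq[OF f] sum_distrib_left sum_distrib_right
    by (subst sum.swap) (simp add: mult_ac)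
  finally show "T s (A f) (int k) = A (T s f) (int k)" ..
qed

lemma T_deriv:
  assumes s: "0 < s" and f: "f \<in> per N"
  shows "((\<lambda>s. T s f k) has_real_derivative (- A (T s f)) k) (at s)"
  using T_deriv_forward[OF s f] by (simp add: T_A[OF s f])

lemma T_lim:
  assumes f: "f \<in> per N"
  shows "((\<lambda>s. T s f k) \<longlongrightarrow> f k) (at_right 0)"
proof -
  define k' where "k' = nat (k mod int N)"
  have k': "k' < N" "int k' = k mod int N" using N_pos by (simp_all add: k'_def nat_less_iff)
  have "((\<lambda>s. T s f (int k')) \<longlongrightarrow> (\<Sum>l<N. (if k' = l then 1 else 0) * f (int l))) (at_right 0)"
    unfolding T_def using k' by (intro tendsto_intros q_lim) auto
  also have "(\<Sum>l<N. (if k' = l then 1 else 0) * f (int l)) = f (int k')"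
    using k' by (simp add: if_distrib[of "\<lambda>x. x * _"] cong: if_cong)
  also have "\<dots> = f k" using per_mod[OF f, of k] k' by simp
  finally have "((\<lambda>s. T s f (int k')) \<longlongrightarrow> f k) (at_right 0)" .
  moreover have "\<forall>\<^sub>F s in at_right 0. T s f (int k') = T s f k"
    using eventually_at_right_less[of "0::real"]
    by eventually_elim (use per_mod[OF T_per, of _ f k] k' in simp)
  ultimately show ?thesis by (rule Lim_transform_eventually)
qed

text \<open>For fixed \<open>r\<close> both sides solve the backward system in \<open>s\<close> and
  start from \<open>T r f\<close>; uniqueness applies once more.\<close>

lemma T_add:
  assumes s: "0 < s" and r: "0 < r" and f: "f \<in> per N"
  shows "T (s + r) f = T s (T r f)"
proof (rule per_eqI[OF T_per T_per[OF s] N_pos])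
  show "0 < s + r" using s r by simp
  fix k assume k: "k < N"
  define w where "w k s = T (s + r) f (int k) - T s (T r f) (int k)" for k :: nat and s
  have Tr: "T r f \<in> per N" by (rule T_per[OF r])
  have "w k s = 0"
  proof (rule linear_ode_unique[where c = "\<lambda>k j. - \<kappa> (int k) j" and N = N, OF _ _ s k])
    fix k :: nat and s :: real assume k: "k < N" and s: "0 < s"
    have sr: "0 < s + r" using s r by simp
    have "((\<lambda>s. T (s + r) f (int k)) has_real_derivative (- A (T (s + r) f)) (int k)) (at s)"
      using DERIV_shift[THEN iffD1, OF T_deriv[OF sr f]] .
    from DERIV_diff[OF this T_deriv[OF s Tr]]
    have "(w k has_real_derivative (- A (T (s + r) f)) (int k) - (- A (T s (T r f))) (int k)) (at s)"
      unfolding w_def[abs_def] .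
    moreover have "(- A (T (s + r) f)) (int k) - (- A (T s (T r f))) (int k) = (\<Sum>j<N. - \<kappa> (int k) j * w j s)"
      using A_eq[OF T_per[OF sr], of f "int k"] A_eq[OF T_per[OF s], of "T r f" "int k"]
      by (simp add: w_def right_diff_distrib sum_subtractf sum_negf)
    ultimately show "(w k has_real_derivative (\<Sum>j<N. - \<kappa> (int k) j * w j s)) (at s)" by simp
  next
    fix k :: nat
    have "isCont (\<lambda>s. T s f (int k)) (0 + r)" using T_deriv[OF r f] by (auto intro: DERIV_isCont)
    then have "isCont (\<lambda>s. T (s + r) f (int k)) 0" by (rule isCont_o2[rotated]) simp
    then have "((\<lambda>s. T (s + r) f (int k)) \<longlongrightarrow> T (0 + r) f (int k)) (at_right 0)"
      unfolding isCont_def by (rule tendsto_within_subset) simp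
    from tendsto_diff[OF this T_lim[OF Tr, of "int k"]] show "(w k \<longlongrightarrow> 0) (at_right 0)"
      unfolding w_def[abs_def] by simp
  qed
  then show "T (s + r) f (int k) = T s (T r f) (int k)" by (simp add: w_def)
qed

end

section \<open>The kernel of the problem\<close>

definition nodes :: "nat \<Rightarrow> nat" where
  "nodes m = 2 ^ (m + 1)"

lemma nodes_pos [simp]: "0 < nodes m"
  by (simp add: nodes_def)

lemma mesh_nodes: "real (nodes m) * mesh L m = 2 * L"
  by (simp add: mesh_def nodes_def)

lemma lattice_shift_period:
  "real_of_int (k + j * int (nodes m)) * mesh L m = real_of_int k * mesh L m + real_of_int j * (2 * L)"
  by (simp add: mesh_def nodes_def field_simps)

lemma rcong_lattice:
  assumes "0 < L"
  shows "[real_of_int j * mesh L m = real_of_int l * mesh L m] (rmod (2 * L)) \<longleftrightarrow> int (nodes m) dvd j - l"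
proof -
  have "[real_of_int j * mesh L m = real_of_int l * mesh L m] (rmod (2 * L))
      \<longleftrightarrow> (\<exists>n. real_of_int l * mesh L m = real_of_int (j + n * int (nodes m)) * mesh L m)"
    unfolding rcong_altdef lattice_shift_period ..
  also have "\<dots> \<longleftrightarrow> (\<exists>n. l = j + n * int (nodes m))"
    using mesh_pos[OF assms, of m] by (simp only: mult_cancel_right of_int_eq_iff) auto
  also have "\<dots> \<longleftrightarrow> int (nodes m) dvd l - j"
    by (auto simp: dvd_def algebra_simps)
  also have "\<dots> \<longleftrightarrow> int (nodes m) dvd j - l" by (rule dvd_diff_commute)
  finally show ?thesis .
qed

lemma sum_grid:
  assumes L: "0 < L" and F: "(\<lambda>k. F (real_of_int k * mesh L m)) \<in> per (nodes m)"
  shows "(\<Sum>z\<in>grid L m. F z) = (\<Sum>j<nodes m. F (real_of_int (int j) * mesh L m))"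
proof -
  have "inj_on (\<lambda>k::int. of_int k * mesh L m) {-(2 ^ m)..<2 ^ m}"
    using mesh_pos[OF L, of m] by (auto simp: inj_on_def)
  then have "(\<Sum>z\<in>grid L m. F z) = (\<Sum>k\<in>{-(2 ^ m)..<2 ^ m}. F (real_of_int k * mesh L m))"
    unfolding grid_eq[OF L] by (simp add: sum.reindex)
  also have "{-(2 ^ m)..<2 ^ m} = {-(2 ^ m)..<-(2 ^ m) + int (nodes m)}" by (simp add: nodes_def)
  also have "(\<Sum>k\<in>\<dots>. F (real_of_int k * mesh L m)) = (\<Sum>j<nodes m. F (real_of_int (int j) * mesh L m))"
    by (rule sum_per_int_interval[OF F])
  finally show ?thesis .
qed

section \<open>The lattice diffusion attached to a kernel\<close>

definition diffusion_coeff :: "real \<Rightarrow> (real \<Rightarrow> real) \<Rightarrow> nat \<Rightarrow> int \<Rightarrow> real" where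
  "diffusion_coeff L \<sigma> m k = (\<sigma> (real_of_int k * mesh L m))\<^sup>2 / 2"

definition drift_ratio :: "real \<Rightarrow> (real \<Rightarrow> real) \<Rightarrow> (real \<Rightarrow> real) \<Rightarrow> nat \<Rightarrow> int \<Rightarrow> real" where
  "drift_ratio L \<sigma> \<mu> m k = \<mu> (real_of_int k * mesh L m) / diffusion_coeff L \<sigma> m k"

text \<open>The mesh width turns the density into a transition matrix, and the exponential replaces
  the generator by \<open>- A\<close>.\<close>

definition damped_kernel :: "real \<Rightarrow> real \<Rightarrow> nat \<Rightarrow> (real \<Rightarrow> real \<Rightarrow> real \<Rightarrow> real) \<Rightarrow> int \<Rightarrow> nat \<Rightarrow> real \<Rightarrow> real" where
  "damped_kernel L c m v k l s =
     exp (- c * s) * (mesh L m * v (real_of_int k * mesh L m) (real l * mesh L m) s)"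

definition damped_flow :: "real \<Rightarrow> real \<Rightarrow> nat \<Rightarrow> (real \<Rightarrow> real \<Rightarrow> real \<Rightarrow> real) \<Rightarrow> real \<Rightarrow> (int \<Rightarrow> real) \<Rightarrow> int \<Rightarrow>
    real" where
  "damped_flow L c m v s f k = (\<Sum>l<nodes m. damped_kernel L c m v k l s * f (int l))"

locale kernel_level =
  fixes L :: real and \<sigma> \<mu> :: "real \<Rightarrow> real" and a0 a1 b1 :: real and m :: nat
      and v :: "real \<Rightarrow> real \<Rightarrow> real \<Rightarrow> real"
  assumes L_pos: "0 < L" and \<sigma>_period: "\<And>x. \<sigma> (x + 2 * L) = \<sigma> x" and \<mu>_period: "\<And>x. \<mu> (x + 2 * L) = \<mu> x"
    and a0: "0 < a0" and lower: "\<And>x. a0 \<le> (\<sigma> x)\<^sup>2 / 2" and upper: "\<And>x. (\<sigma> x)\<^sup>2 / 2 \<le> a1"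
    and drift: "\<And>x. \<bar>\<mu> x / ((\<sigma> x)\<^sup>2 / 2)\<bar> \<le> b1" and kernel: "is_kernel L \<sigma> \<mu> m v"
begin

abbreviation (input) "N \<equiv> nodes m"
abbreviation (input) "node k \<equiv> real_of_int k * mesh L m"

lemma node_shift: "node (k + int N) = node k + 2 * L"
  using lattice_shift_period[of k 1 m L] by simp

sublocale D: lattice_diffusion "nodes m" "mesh L m" "diffusion_coeff L \<sigma> m" "drift_ratio L \<sigma> \<mu> m" a0 a1
    b1 "2 * L"
proof
  show "diffusion_coeff L \<sigma> m \<in> per (nodes m)" "drift_ratio L \<sigma> \<mu> m \<in> per (nodes m)"
    unfolding per_def drift_ratio_def diffusion_coeff_def
    by (simp_all add: node_shift[simplified] \<sigma>_period \<mu>_period)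
  show "real (nodes m) * mesh L m = 2 * L" by (rule mesh_nodes)
qed (use a0 lower upper drift L_pos in \<open>auto simp: mesh_pos drift_ratio_def diffusion_coeff_def nodes_def\<close>)

lemma gen_node: "gen L \<sigma> \<mu> m F (node k) = damping a1 b1 * F (node k) - D.A (\<lambda>k. F (node k)) k"
proof -
  have "diffusion_coeff L \<sigma> m k \<noteq> 0" using D.a_pos[of k] by simp
  then have "diffusion_coeff L \<sigma> m k * drift_ratio L \<sigma> \<mu> m k = \<mu> (node k)"
    by (simp add: drift_ratio_def)
  moreover have "laplacian L m F (node k) = lap (mesh L m) (\<lambda>k. F (node k)) k"
    "nabla L m F (node k) = cdiff (mesh L m) (\<lambda>k. F (node k)) k"
    by (simp_all add: laplacian_def nabla_def lap_def cdiff_def algebra_simps)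
  ultimately show ?thesis
    by (simp add: gen_def D.A_def distrib_left mult.assoc[symmetric]) (simp add: diffusion_coeff_def)
qed

lemma node_lattice: "node k \<in> Defs.lattice L m"
  unfolding Defs.lattice_def by (rule rangeI)

lemma kernel_per:
  assumes s: "0 < s"
  shows "(\<lambda>k. v (node k) (node l) s) \<in> per N" and "(\<lambda>l. v (node k) (node l) s) \<in> per N"
  using kernel s node_lattice unfolding is_kernel_def
  by (auto intro!: perI simp: node_shift[simplified])

lemma gen_matrix_node:
  "gen_matrix L \<sigma> \<mu> m (node j) (node l) = mesh L m * (damping a1 b1 * D.delta l j - D.A (D.delta l) j)"
proof -
  have e: "(\<lambda>k. if [node k = node l] (rmod 2 * L) then 1 else 0) = (\<lambda>k. mesh L m * D.delta l k)"
    using mesh_pos[OF L_pos, of m] by (auto simp: rcong_lattice[OF L_pos] D.delta_def)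
  have "D.A (\<lambda>k. mesh L m * D.delta l k) j = mesh L m * D.A (D.delta l) j"
    by (rule kernel_op_scale[OF D.kernel_op_A D.delta_per])
  then show ?thesis
    unfolding gen_matrix_def gen_node e using mesh_pos[OF L_pos, of m]
    by (simp add: fun_cong[OF e] right_diff_distrib)
qed

lemma gen_adj_node:
  assumes \<phi>: "(\<lambda>k. \<phi> (node k)) \<in> per N"
  shows "gen_adj L \<sigma> \<mu> m \<phi> (node l)
    = (\<Sum>j<N. mesh L m * (damping a1 b1 * D.delta l (int j) - D.A (D.delta l) (int j)) * \<phi> (node (int j)))"
proof -
  have per: "(\<lambda>k. gen_matrix L \<sigma> \<mu> m (node k) (node l) * \<phi> (node k)) \<in> per N"
    unfolding gen_matrix_node using \<phi> D.delta_per[of l] D.A_per[OF D.delta_per, of l] by (simp add: per_def)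
  show ?thesis unfolding gen_adj_def sum_grid[OF L_pos per] by (simp only: gen_matrix_node)
qed

lemma grid_representative:
  obtains k' j where "k' \<in> {-(2 ^ m)..<2 ^ m}" "k = k' + j * int N" "node k' \<in> grid L m"
proof
  define k' where "k' = (k + 2 ^ m) mod int N - 2 ^ m"
  have "0 \<le> (k + 2 ^ m) mod int N" "(k + 2 ^ m) mod int N < int N" by simp_all
  moreover have "int N = 2 * 2 ^ m" by (simp add: nodes_def)
  ultimately show k': "k' \<in> {-(2 ^ m)..<2 ^ m}" by (simp add: k'_def)
  show "k = k' + ((k + 2 ^ m) div int N) * int N"
    unfolding k'_def using mod_div_mult_eq[of "k + 2 ^ m" "int N"] by linarith
  show "node k' \<in> grid L m" unfolding grid_eq[OF L_pos] using k' by blast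
qed

text \<open>The forward equation is given on the grid of representatives. It extends to all lattice
  nodes because both sides depend on \<open>k\<close> and \<open>l\<close> only modulo the
  period.\<close>

lemma kernel_deriv:
  assumes s: "0 < s"
  shows "((\<lambda>s. v (node k) (node l) s) has_real_derivative
    (\<Sum>j<N. mesh L m * (damping a1 b1 * D.delta l (int j) - D.A (D.delta l) (int j)) * v (node k) (node
        (int j)) s)) (at s)"
proof -
  obtain k' i where k: "k = k' + i * int N" "node k' \<in> grid L m" using grid_representative by blast
  obtain l' j where l: "l = l' + j * int N" "node l' \<in> grid L m" using grid_representative by blast
  have eq: "v (node k) (node n) s = v (node k') (node n) s" if "0 < s" for s n
    unfolding k by (rule per_mult_int[OF kernel_per(1)[OF that]])
  have eql: "v (node n) (node l) s = v (node n) (node l') s" if "0 < s" for s n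
    unfolding l by (rule per_mult_int[OF kernel_per(2)[OF that]])
  have delta_eq: "D.delta l = D.delta l'"
  proof
    fix n
    have "int N dvd n - l \<longleftrightarrow> int N dvd (n - l') + (- j) * int N" by (simp add: l algebra_simps)
    also have "\<dots> \<longleftrightarrow> int N dvd n - l'" by (rule dvd_add_left_iff) simp
    finally show "D.delta l n = D.delta l' n" by (simp add: D.delta_def)
  qed
  then have rhs: "gen_adj L \<sigma> \<mu> m (\<lambda>z. v (node k') z s) (node l') =
    (\<Sum>j<N. mesh L m * (damping a1 b1 * D.delta l (int j) - D.A (D.delta l) (int j)) * v (node k) (node
        (int j)) s)"
    unfolding gen_adj_node[OF kernel_per(2)[OF s]] delta_eq by (simp only: eq[OF s])
  have "((\<lambda>s. v (node k') (node l') s) has_real_derivative gen_adj L \<sigma> \<mu> m (\<lambda>z. v (node k') z s) (node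
      l')) (at s)"
    using kernel k l s unfolding is_kernel_def by blast
  moreover have "\<forall>\<^sub>F s in nhds s. v (node k') (node l') s = v (node k) (node l) s"
    using eventually_nhds_in_open[of "{0<..}" s] s by (auto elim!: eventually_mono simp: eq eql)
  ultimately show ?thesis
    unfolding rhs by (rule DERIV_cong_ev[OF refl _ refl, THEN iffD1, rotated])
qed

lemma kernel_lim:
  "((\<lambda>s. v (node k) (node l) s) \<longlongrightarrow> D.delta l k) (at_right 0)"
proof -
  obtain k' i where k: "k = k' + i * int N" "node k' \<in> grid L m" using grid_representative by blast
  obtain l' j where l: "l = l' + j * int N" "node l' \<in> grid L m" using grid_representative by blast
  have "((\<lambda>s. v (node k') (node l') s) \<longlongrightarrow> discrete_delta L m (node k') (node l')) (at_right 0)"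
    using kernel k l unfolding is_kernel_def by blast
  moreover have "discrete_delta L m (node k') (node l') = D.delta l k"
  proof -
    have "int N dvd k - l \<longleftrightarrow> int N dvd (k' - l') + (i - j) * int N" by (simp add: k l algebra_simps)
    also have "\<dots> \<longleftrightarrow> int N dvd k' - l'" by (rule dvd_add_left_iff) simp
    finally show ?thesis by (simp add: discrete_delta_def rcong_lattice[OF L_pos] D.delta_def)
  qed
  moreover have "\<forall>\<^sub>F s in at_right 0. v (node k') (node l') s = v (node k) (node l) s"
    using eventually_at_right_less[of "0::real"]
    by eventually_elim (simp only: k l per_mult_int[OF kernel_per(1)] per_mult_int[OF kernel_per(2)])
  ultimately show ?thesis using Lim_transform_eventually by fastforce
qed

lemma A_matrix:
  assumes f: "f \<in> per N"
  shows "D.A f k = (\<Sum>l<N. mesh L m * D.A (D.delta (int l)) k * f (int l))"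
proof -
  obtain \<kappa> where \<kappa>: "\<And>f k. f \<in> per N \<Longrightarrow> D.A f k = (\<Sum>l<N. \<kappa> k l * f (int l))"
    using D.kernel_op_A unfolding kernel_op_def by blast
  have "mesh L m * D.A (D.delta (int l)) k = \<kappa> k l" if l: "l < N" for l
  proof -
    have "D.delta (int l) (int j) = (if j = l then 1 / mesh L m else 0)" if "j < N" for j
    proof -
      have "int N dvd int j - int l \<longleftrightarrow> int j mod int N = int l mod int N" by (simp only: mod_eq_dvd_iff)
      also have "\<dots> \<longleftrightarrow> j = l" using that l by (metis mod_less of_nat_eq_iff of_nat_mod)
      finally show ?thesis by (simp add: D.delta_def)
    qed
    then have "D.A (D.delta (int l)) k = (\<Sum>j<N. if j = l then \<kappa> k j / mesh L m else 0)"
      unfolding \<kappa>[OF D.delta_per] by (intro sum.cong) auto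
    then show ?thesis using l mesh_pos[OF L_pos, of m] by simp
  qed
  then show ?thesis unfolding \<kappa>[OF f] by (intro sum.cong) auto
qed

sublocale FK: forward_kernel "nodes m" "mesh L m" "diffusion_coeff L \<sigma> m" "drift_ratio L \<sigma> \<mu> m" a0 a1 b1 "2 * L"
  "\<lambda>k l. mesh L m * D.A (D.delta (int l)) k" "damped_kernel L (damping a1 b1) m v"
proof
  fix s :: real and k :: int and l :: nat
  show "D.A f k = (\<Sum>l<N. mesh L m * D.A (D.delta (int l)) k * f (int l))" if "f \<in> per N" for f k
    by (rule A_matrix[OF that])
  show "(\<lambda>k. damped_kernel L (damping a1 b1) m v k l s) \<in> per N" if "0 < s"
    using kernel_per(1)[OF that, of "int l"] by (simp add: per_def damped_kernel_def)
  show "(damped_kernel L (damping a1 b1) m v k l has_real_derivative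
      - (\<Sum>j<N. mesh L m * D.A (D.delta (int l)) (int j) * damped_kernel L (damping a1 b1) m v k j s)) (at s)"
    if s: "0 < s" and l: "l < N"
  proof -
    define e where "e = exp (- damping a1 b1 * s)"
    define w where "w j = v (node k) (node (int j)) s" for j :: nat
    define y where "y j = D.A (D.delta (int l)) (int j)" for j :: nat
    define h where "h = mesh L m"
    have d: "(\<Sum>j<N. h * (D.delta (int l) (int j) * w j)) = w l"
      unfolding w_def h_def using D.sum_delta[OF kernel_per(2)[OF s], of "int l" k] by simp
    have S: "(\<Sum>j<N. h * (damping a1 b1 * D.delta (int l) (int j) - y j) * w j)
        = damping a1 b1 * w l - (\<Sum>j<N. h * y j * w j)"
      unfolding d[symmetric] sum_distrib_left by (simp add: sum_subtractf[symmetric] algebra_simps)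
    have E: "((\<lambda>s. exp (- damping a1 b1 * s)) has_real_derivative - damping a1 b1 * e) (at s)"
      unfolding e_def by (auto intro!: derivative_eq_intros)
    have V: "((\<lambda>s. h * v (node k) (node (int l)) s) has_real_derivative h * (damping a1 b1 * w l
        - (\<Sum>j<N. h * y j * w j))) (at s)"
      using DERIV_cmult[OF kernel_deriv[OF s, of k "int l"], of h] unfolding S[symmetric]
      unfolding h_def w_def y_def .
    have "((\<lambda>s. exp (- damping a1 b1 * s) * (h * v (node k) (node (int l)) s)) has_real_derivative
        e * (h * (damping a1 b1 * w l - (\<Sum>j<N. h * y j * w j))) + (- damping a1 b1 * e) * (h * w l)) (at s)"
      using DERIV_mult'[OF E V] by (simp add: e_def w_def)
    moreover have "e * (h * (damping a1 b1 * w l - (\<Sum>j<N. h * y j * w j))) + (- damping a1 b1 * e) * (h * w l)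
        = - (\<Sum>j<N. h * y j * (e * (h * w j)))"
      by (simp add: sum_distrib_left algebra_simps)
    ultimately show ?thesis
      unfolding damped_kernel_def[abs_def] by (simp add: e_def h_def w_def y_def)
  qed
  show "(damped_kernel L (damping a1 b1) m v (int k) l \<longlongrightarrow> (if k = l then 1 else 0)) (at_right 0)"
    if k: "k < N" and l: "l < N" for k
  proof -
    have "((\<lambda>s. exp (- damping a1 b1 * s) * (mesh L m * v (node (int k)) (node (int l)) s)) \<longlongrightarrow>
        exp (- damping a1 b1 * 0) * (mesh L m * D.delta (int l) (int k))) (at_right 0)"
      by (intro tendsto_intros kernel_lim)
    also have "exp (- damping a1 b1 * 0) * (mesh L m * D.delta (int l) (int k)) = (if k = l then 1 else 0)"
    proof -
      have "int N dvd int k - int l \<longleftrightarrow> int k mod int N = int l mod int N" by (simp only: mod_eq_dvd_iff)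
      also have "\<dots> \<longleftrightarrow> k = l" using k l by (metis mod_less of_nat_eq_iff of_nat_mod)
      finally show ?thesis using mesh_pos[OF L_pos, of m] by (simp add: D.delta_def)
    qed
    finally show ?thesis by (simp add: damped_kernel_def[abs_def])
  qed
qed

lemma damped_flow_eq: "damped_flow L (damping a1 b1) m v = FK.T"
  by (intro ext) (simp add: damped_flow_def FK.T_def)

lemma diffusion_semigroup_exists:
  "\<exists>K. diffusion_semigroup (nodes m) (mesh L m) (diffusion_coeff L \<sigma> m) (drift_ratio L \<sigma> \<mu> m) a0 a1 b1 (2 * L)
     K (damped_flow L (damping a1 b1) m v)"
proof -
  obtain K where K: "kernel_op N K" "\<forall>f\<in>per N. K f \<in> per N \<and> D.A (K f) = f \<and> K (D.A f) = f"
    using D.resolvent_exists by blast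
  show ?thesis unfolding damped_flow_eq
    by (intro exI[of _ K], unfold_locales)
      (use K FK.kernel_op_T FK.T_per FK.T_A FK.T_add FK.T_deriv FK.T_lim in auto)
qed

lemma damped_flow_delta:
  assumes s: "0 < s"
  shows "damped_flow L (damping a1 b1) m v s (D.delta l) k = exp (- damping a1 b1 * s) * v (node k) (node l) s"
proof -
  have "damped_flow L (damping a1 b1) m v s (D.delta l) k
      = exp (- damping a1 b1 * s) * (\<Sum>j<N. mesh L m * (D.delta l (int j) * v (node k) (node (int j)) s))"
    by (simp add: damped_flow_def damped_kernel_def sum_distrib_left mult_ac)
  also have "(\<Sum>j<N. mesh L m * (D.delta l (int j) * v (node k) (node (int j)) s)) = v (node k) (node l) s"
    by (rule D.sum_delta[OF kernel_per(2)[OF s]])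
  finally show ?thesis .
qed

lemma gen_kernel:
  assumes s: "0 < s"
  shows "gen L \<sigma> \<mu> m (\<lambda>z. v z (node l) s) (node k)
    = exp (damping a1 b1 * s) * (damping a1 b1 * damped_flow L (damping a1 b1) m v s (D.delta l) k
        - D.A (damped_flow L (damping a1 b1) m v s (D.delta l)) k)"
proof -
  define f where "f = damped_flow L (damping a1 b1) m v s (D.delta l)"
  have eq: "(\<lambda>k. v (node k) (node l) s) = (\<lambda>k. exp (damping a1 b1 * s) * f k)"
    by (simp add: f_def damped_flow_delta[OF s] mult.assoc[symmetric] exp_add[symmetric])
  have f: "f \<in> per N" unfolding f_def damped_flow_eq by (rule FK.T_per[OF s])
  show ?thesis
    unfolding gen_node eq f_def[symmetric] kernel_op_scale[OF D.kernel_op_A f] fun_cong[OF eq]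
    by (simp add: right_diff_distrib)
qed

text \<open>Both sides are the time derivative of the same kernel entry, the left one by the forward
  equation and the right one because the flow commutes with \<open>A\<close>.\<close>

lemma gen_adj_eq_gen:
  assumes s: "0 < s"
  shows "gen_adj L \<sigma> \<mu> m (\<lambda>z. v (node k) z s) (node l) = gen L \<sigma> \<mu> m (\<lambda>z. v z (node l) s) (node k)"
proof (rule DERIV_unique)
  show "((\<lambda>s. v (node k) (node l) s) has_real_derivative gen_adj L \<sigma> \<mu> m (\<lambda>z. v (node k) z s) (node l)) (at s)"
    using kernel_deriv[OF s, of k l] unfolding gen_adj_node[OF kernel_per(2)[OF s]] .
  have E: "((\<lambda>s. exp (damping a1 b1 * s)) has_real_derivative damping a1 b1 * exp (damping a1 b1 * s)) (at s)"
    by (auto intro!: derivative_eq_intros)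
  have "((\<lambda>s. exp (damping a1 b1 * s) * FK.T s (D.delta l) k) has_real_derivative
      gen L \<sigma> \<mu> m (\<lambda>z. v z (node l) s) (node k)) (at s)"
    using DERIV_mult'[OF E FK.T_deriv[OF s D.delta_per, of l k]]
    unfolding gen_kernel[OF s] damped_flow_eq by (simp add: algebra_simps)
  moreover have "\<forall>\<^sub>F s in nhds s. exp (damping a1 b1 * s) * FK.T s (D.delta l) k = v (node k) (node l) s"
    using eventually_nhds_in_open[of "{0<..}" s] s
    by (auto elim!: eventually_mono
        simp: damped_flow_delta[unfolded damped_flow_eq] mult.assoc[symmetric] exp_add[symmetric])
  ultimately show "((\<lambda>s. v (node k) (node l) s) has_real_derivative gen L \<sigma> \<mu> m (\<lambda>z. v z (node l) s)
      (node k)) (at s)"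
    by (rule DERIV_cong_ev[OF refl _ refl, THEN iffD1, rotated])
qed

end

section \<open>Comparison of kernels on nested lattices\<close>

lemma fine_nodes: "m \<le> m' \<Longrightarrow> nodes m' = nodes m * 2 ^ (m' - m)"
  by (simp add: nodes_def flip: power_add power_Suc)

lemma fine_mesh: "m \<le> m' \<Longrightarrow> mesh L m' = mesh L m / real (2 ^ (m' - m))"
  by (simp add: mesh_def flip: power_add)

text \<open>The time is halved because \<open>comparison\<close> works at \<open>2 * s\<close>. The
  exponential undoes the damping, the root is the Sobolev constant, and
  \<open>11 + 10 * damping a1 b1\<close> comes from writing the generator as \<open>damping\<close>
  minus \<open>A\<close>.\<close>

definition kernel_const :: "real \<Rightarrow> real \<Rightarrow> real \<Rightarrow> real \<Rightarrow> real \<Rightarrow> real" where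
  "kernel_const L a0 a1 b1 t = exp (damping a1 b1 * t) * (sqrt (2 * a1 / (2 * L) + 2 * (2 * L))
    * ((11 + 10 * damping a1 b1) * (comparison_const a0 a1 b1 (2 * L) (t / 2) * elliptic_const a0 a1 b1
        (2 * L))))"

text \<open>Up to the damping factor, kernel entries are values of the flow of a point source, at
  node \<open>k\<close> on the coarse and \<open>k * int M\<close> on the fine level. The Sobolev
  inequality makes the bounds of \<open>comparison\<close> pointwise.\<close>

lemma kernel_comparison:
  assumes C: "kernel_level L \<sigma> \<mu> a0 a1 b1 m v" and F: "kernel_level L \<sigma> \<mu> a0 a1 b1 m' v'"
    and le: "m \<le> m'" and t: "0 < t"
    and a_mod: "\<And>x y. \<bar>x - y\<bar> \<le> mesh L m \<Longrightarrow> \<bar>1 / ((\<sigma> x)\<^sup>2 / 2) - 1 / ((\<sigma> y)\<^sup>2 / 2)\<bar> \<le> \<omega>"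
    and b_mod: "\<And>x y. \<bar>x - y\<bar> \<le> mesh L m \<Longrightarrow> \<bar>\<mu> x / ((\<sigma> x)\<^sup>2 / 2) - \<mu> y / ((\<sigma> y)\<^sup>2 / 2)\<bar> \<le> \<omega>"
    and x: "x \<in> grid L m" and y: "y \<in> grid L m"
  shows "\<bar>v x y t - v' x y t\<bar> \<le> kernel_const L a0 a1 b1 t * (\<omega> + (mesh L m)\<^sup>2)" (is "?first")
    and "\<bar>gen L \<sigma> \<mu> m (\<lambda>z. v z y t) x - gen L \<sigma> \<mu> m' (\<lambda>z. v' z y t) x\<bar>
      \<le> kernel_const L a0 a1 b1 t * (\<omega> + (mesh L m)\<^sup>2)" (is "?second")
proof -
  interpret C: kernel_level L \<sigma> \<mu> a0 a1 b1 m v by (rule C)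
  interpret F: kernel_level L \<sigma> \<mu> a0 a1 b1 m' v' by (rule F)
  define M :: nat where "M = 2 ^ (m' - m)"
  define P where "P = damped_flow L (damping a1 b1) m v"
  define P' where "P' = damped_flow L (damping a1 b1) m' v'"
  have M: "0 < M" by (simp add: M_def)
  have nM: "nodes m' = nodes m * M" and hM: "mesh L m' = mesh L m / real M"
    using fine_nodes[OF le] fine_mesh[OF le] by (simp_all add: M_def)
  have node: "real_of_int (k * int M) * mesh L m' = real_of_int k * mesh L m" for k
    using M by (simp add: hM)
  obtain K where K: "diffusion_semigroup (nodes m) (mesh L m) (diffusion_coeff L \<sigma> m) (drift_ratio L \<sigma> \<mu>
      m) a0 a1 b1 (2 * L) K P"
    using C.diffusion_semigroup_exists unfolding P_def by blast
  obtain K' where K': "diffusion_semigroup (nodes m * M) (mesh L m / real M) (diffusion_coeff L \<sigma> m')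
      (drift_ratio L \<sigma> \<mu> m') a0 a1 b1 (2 * L) K' P'"
    using F.diffusion_semigroup_exists unfolding P'_def nM hM by blast
  interpret D: diffusion_semigroup "nodes m" "mesh L m" "diffusion_coeff L \<sigma> m" "drift_ratio L \<sigma> \<mu> m" a0
      a1 b1 "2 * L" K P
    by (rule K)
  interpret D': diffusion_semigroup "nodes m * M" "mesh L m / real M" "diffusion_coeff L \<sigma> m'"
      "drift_ratio L \<sigma> \<mu> m'"
    a0 a1 b1 "2 * L" K' P' by (rule K')
  have close: "\<bar>real_of_int j * mesh L m' - real_of_int k * mesh L m\<bar> \<le> mesh L m" if "\<bar>j - k * int M\<bar>
      \<le> int M" for j k
  proof -
    have "\<bar>real_of_int (j - k * int M)\<bar> \<le> real M" using that by linarith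
    then have le: "\<bar>real_of_int (j - k * int M)\<bar> * mesh L m' \<le> real M * mesh L m'"
      using F.D.h_pos by (intro mult_right_mono) auto
    have eq: "real_of_int j * mesh L m' - real_of_int k * mesh L m = real_of_int (j - k * int M) * mesh L m'"
      unfolding node[symmetric] by (simp add: algebra_simps)
    have "real M * mesh L m' = mesh L m" using M by (simp add: hM)
    with le show ?thesis unfolding eq abs_mult abs_of_pos[OF F.D.h_pos] by linarith
  qed
  interpret TS: two_semigroups "nodes m" "mesh L m" "diffusion_coeff L \<sigma> m" "drift_ratio L \<sigma> \<mu> m" a0 a1
      b1 "2 * L" M
    "diffusion_coeff L \<sigma> m'" "drift_ratio L \<sigma> \<mu> m'" \<omega> K P K' P'
  proof unfold_locales
    fix k j :: int
    show "diffusion_coeff L \<sigma> m k = diffusion_coeff L \<sigma> m' (k * int M)"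
      unfolding diffusion_coeff_def node ..
    then show "drift_ratio L \<sigma> \<mu> m k = drift_ratio L \<sigma> \<mu> m' (k * int M)"
      unfolding drift_ratio_def node by simp
    assume j: "\<bar>j - k * int M\<bar> \<le> int M"
    show "\<bar>1 / diffusion_coeff L \<sigma> m' j - 1 / diffusion_coeff L \<sigma> m' (k * int M)\<bar> \<le> \<omega>"
      unfolding diffusion_coeff_def node by (rule a_mod[OF close[OF j]])
    show "\<bar>drift_ratio L \<sigma> \<mu> m' j - drift_ratio L \<sigma> \<mu> m' (k * int M)\<bar> \<le> \<omega>"
      unfolding drift_ratio_def diffusion_coeff_def node by (rule b_mod[OF close[OF j]])
  qed
  obtain k l where k: "x = real_of_int k * mesh L m" and l: "y = real_of_int l * mesh L m"
    using x y unfolding grid_def Defs.lattice_def by blast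
  define E where "E = exp (damping a1 b1 * t)"
  define B where "B = sqrt (2 * a1 / (2 * L) + 2 * (2 * L)) * (comparison_const a0 a1 b1 (2 * L) (t / 2)
      * TS.\<eta>)"
  define g where "g = P t (C.D.delta l)"
  define g' where "g' = P' t (D'.delta (l * int M))"
  have g_per: "g \<in> per (nodes m)" "g' \<in> per (nodes m * M)"
    unfolding g_def g'_def by (intro D.P_per D'.P_per t C.D.delta_per D'.delta_per)+
  have cs: "C.D.csob = sqrt (2 * a1 / (2 * L) + 2 * (2 * L))" by (simp add: C.D.csob_def)
  have t2: "0 < t / 2" using t by simp
  define S where "S = comparison_const a0 a1 b1 (2 * L) (t / 2) * TS.\<eta>"
  have tt: "2 * (t / 2) = t" by simp
  have "\<bar>(g - TS.R g') k\<bar> \<le> C.D.csob * C.D.nrm1 (g - TS.R g')"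
    using g_per by (intro C.D.abs_le_nrm1 per_diff TS.R_per)
  also have "\<dots> \<le> C.D.csob * (10 * S)"
    using TS.comparison(1)[OF t2, of l] C.D.csob_pos
    unfolding tt g_def[symmetric] g'_def[symmetric] S_def[symmetric] by (intro mult_left_mono) auto
  finally have 0: "\<bar>g k - g' (k * int M)\<bar> \<le> 10 * B" by (simp add: cs B_def S_def TS.R_def)
  have "\<bar>(C.D.A g - TS.R (D'.A g')) k\<bar> \<le> C.D.csob * C.D.nrm1 (C.D.A g - TS.R (D'.A g'))"
    using g_per by (intro C.D.abs_le_nrm1 per_diff TS.R_per C.D.A_per D'.A_per)
  also have "\<dots> \<le> C.D.csob * (11 * S)"
    using TS.comparison(2)[OF t2, of l] C.D.csob_pos
    unfolding tt g_def[symmetric] g'_def[symmetric] S_def[symmetric] by (intro mult_left_mono) auto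
  finally have 1: "\<bar>C.D.A g k - D'.A g' (k * int M)\<bar> \<le> 11 * B" by (simp add: cs B_def S_def TS.R_def)
  have B0: "0 \<le> B" using 0 by linarith
  have const: "kernel_const L a0 a1 b1 t * (\<omega> + (mesh L m)\<^sup>2) = E * ((11 + 10 * damping a1 b1) * B)"
    unfolding kernel_const_def E_def B_def TS.\<eta>_def TS.\<epsilon>_def by (simp only: mult_ac)
  have E: "0 < E" by (simp add: E_def)
  have inv: "E * (exp (- damping a1 b1 * t) * z) = z" for z
    by (simp add: E_def mult.assoc[symmetric] exp_add[symmetric])
  have v: "v x y t = E * g k"
    unfolding g_def P_def C.damped_flow_delta[OF t] inv k l ..
  have v': "v' x y t = E * g' (k * int M)"
    unfolding g'_def P'_def F.damped_flow_delta[OF t, unfolded nM hM] inv k l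
    using M by simp
  have gen: "gen L \<sigma> \<mu> m (\<lambda>z. v z y t) x = E * (damping a1 b1 * g k - C.D.A g k)"
    unfolding g_def P_def E_def k l by (rule C.gen_kernel[OF t])
  have gen': "gen L \<sigma> \<mu> m' (\<lambda>z. v' z y t) x = E * (damping a1 b1 * g' (k * int M) - D'.A g' (k * int M))"
    unfolding g'_def P'_def E_def k l
    using F.gen_kernel[OF t, of "l * int M" "k * int M"] unfolding node by (simp add: nM hM)
  have "10 * B \<le> (11 + 10 * damping a1 b1) * B" using B0 C.D.damping_ge by (intro mult_right_mono) auto
  then have "E * \<bar>g k - g' (k * int M)\<bar> \<le> E * ((11 + 10 * damping a1 b1) * B)"
    using 0 E by (intro mult_left_mono) auto
  then show ?first unfolding v v' const right_diff_distrib[symmetric] abs_mult using E by simp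
  have "\<bar>damping a1 b1 * (g k - g' (k * int M))\<bar> \<le> damping a1 b1 * (10 * B)"
    unfolding abs_mult using C.D.damping_ge 0 by (intro mult_mono) auto
  then have "\<bar>(damping a1 b1 * g k - C.D.A g k) - (damping a1 b1 * g' (k * int M) - D'.A g' (k * int M))\<bar>
      \<le> (11 + 10 * damping a1 b1) * B"
    using 1 by (simp add: algebra_simps)
  then have "E * \<bar>(damping a1 b1 * g k - C.D.A g k) - (damping a1 b1 * g' (k * int M) - D'.A g' (k * int M))\<bar>
      \<le> E * ((11 + 10 * damping a1 b1) * B)"
    using E by (intro mult_left_mono) auto
  then show ?second unfolding gen gen' const right_diff_distrib[symmetric] abs_mult using E by simp
qed

section \<open>Moduli of continuity on the circle\<close>

lemma periodic_shift:
  fixes \<phi> :: "real \<Rightarrow> real"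
  assumes "\<And>x. \<phi> (x + 2 * L) = \<phi> x"
  shows "\<phi> (x + 2 * L * real_of_int n) = \<phi> x"
proof -
  \<comment> \<open>Read as a function of the number of turns, this has period \<open>1\<close>, so
    the induction of \<open>per_mult_int\<close> can be reused.\<close>
  have "(\<lambda>k. \<phi> (x + 2 * L * real_of_int k)) \<in> per 1"
    using assms[of "x + 2 * L * real_of_int k" for k] by (auto intro!: perI simp: algebra_simps)
  from per_mult_int[OF this, of 0 n] show ?thesis by simp
qed

lemma circle_representative:
  assumes L: "0 < L"
  obtains n :: int where "x - 2 * L * real_of_int n \<in> {-L..L}"
proof
  define n where "n = \<lfloor>(x + L) / (2 * L)\<rfloor>"
  have "real_of_int n \<le> (x + L) / (2 * L)" "(x + L) / (2 * L) < real_of_int n + 1"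
    unfolding n_def by linarith+
  then show "x - 2 * L * real_of_int n \<in> {-L..L}" using L by (simp add: field_simps)
qed

lemma circle_dist_le: "circle_dist L x y \<le> \<bar>x - y - 2 * L * real_of_int n\<bar>"
  unfolding circle_dist_def by (rule cINF_lower) (auto intro: bdd_belowI2[of _ 0])

lemma circle_dist_nonneg: "0 \<le> circle_dist L x y"
  unfolding circle_dist_def by (rule cINF_greatest) auto

text \<open>The hypothesis concerns the fundamental interval and the circle distance. After shifting
  both points there, their circle distance is at most \<open>\<bar>x - y\<bar>\<close>, and
  monotonicity of \<open>\<rho>\<close> gives a bound for arbitrary real points.\<close>

lemma circle_modulus:
  fixes \<phi> \<rho> :: "real \<Rightarrow> real"
  assumes L: "0 < L" and per: "\<And>x. \<phi> (x + 2 * L) = \<phi> x" and mono: "mono_on {0..} \<rho>" and c0: "0 < c0"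
    and le: "\<And>x y. x \<in> {-L..L} \<Longrightarrow> y \<in> {-L..L} \<Longrightarrow> \<bar>\<phi> x - \<phi> y\<bar> \<le> c0 * \<rho> (circle_dist L x y)"
    and d: "\<bar>x - y\<bar> \<le> d"
  shows "\<bar>\<phi> x - \<phi> y\<bar> \<le> c0 * \<rho> d"
proof -
  obtain i where i: "x - 2 * L * real_of_int i \<in> {-L..L}" by (rule circle_representative[OF L])
  obtain j where j: "y - 2 * L * real_of_int j \<in> {-L..L}" by (rule circle_representative[OF L])
  define x' y' where "x' = x - 2 * L * real_of_int i" and "y' = y - 2 * L * real_of_int j"
  have "\<phi> x = \<phi> x'" "\<phi> y = \<phi> y'"
    using periodic_shift[of \<phi> L x' i, OF per] periodic_shift[of \<phi> L y' j, OF per]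
        by (simp_all add: x'_def y'_def)
  then have "\<bar>\<phi> x - \<phi> y\<bar> \<le> c0 * \<rho> (circle_dist L x' y')" using le[OF i j] by (simp add: x'_def y'_def)
  moreover have "circle_dist L x' y' \<le> d"
    using circle_dist_le[of L x' y' "j - i"] d by (simp add: x'_def y'_def algebra_simps)
  then have "\<rho> (circle_dist L x' y') \<le> \<rho> d"
    using circle_dist_nonneg[of L x' y'] by (intro mono_onD[OF mono]) auto
  ultimately show ?thesis using c0 by (smt (verit) mult_left_mono)
qed

text \<open>Chaining over steps of length at most \<open>mesh L m\<close>: a nonconstant function cannot have a modulus
  of continuity that is smaller than linear.\<close>

lemma mesh_sq_le_modulus:
  fixes \<phi> \<rho> :: "real \<Rightarrow> real"
  assumes L: "0 < L" and c0: "0 < c0"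
    and le: "\<And>x y d. \<bar>x - y\<bar> \<le> d \<Longrightarrow> \<bar>\<phi> x - \<phi> y\<bar> \<le> c0 * \<rho> d"
    and nonconst: "\<not> \<phi> constant_on {-L..L}"
  shows "\<exists>c1>0. \<forall>m. (mesh L m)\<^sup>2 \<le> c1 * \<rho> (mesh L m)"
proof -
  obtain y where y: "y \<in> {-L..L}" "\<phi> y \<noteq> \<phi> (- L)" using nonconst unfolding constant_on_def by blast
  define \<delta> where "\<delta> = \<bar>\<phi> y - \<phi> (- L)\<bar>"
  have \<delta>: "0 < \<delta>" using y by (simp add: \<delta>_def)
  have "(mesh L m)\<^sup>2 \<le> (2 * L\<^sup>2 * c0 / \<delta>) * \<rho> (mesh L m)" for m
  proof -
    \<comment> \<open>Exactly \<open>nodes m\<close> steps lead from \<open>- L\<close> to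
      \<open>y\<close>, and none exceeds the mesh width because the whole distance is at most
      \<open>2 * L\<close>.\<close>
    define s where "s = (y + L) / real (nodes m)"
    have h: "0 < mesh L m" "mesh L m \<le> L" using L by (simp_all add: mesh_pos mesh_def divide_le_eq)
    have s: "\<bar>s\<bar> \<le> mesh L m"
    proof -
      have "s \<le> 2 * L / real (nodes m)" "0 \<le> s" using y by (simp_all add: s_def divide_right_mono)
      moreover have "2 * L / real (nodes m) = mesh L m" using mesh_nodes[of m L] by (simp add: field_simps)
      ultimately show ?thesis by simp
    qed
    have "\<bar>\<phi> (- L + real i * s) - \<phi> (- L)\<bar> \<le> real i * (c0 * \<rho> (mesh L m))" for i
    proof (induction i)
      case (Suc i)
      have "\<bar>\<phi> (- L + real (Suc i) * s) - \<phi> (- L + real i * s)\<bar> \<le> c0 * \<rho> (mesh L m)"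
        by (rule le) (use s in \<open>simp add: algebra_simps\<close>)
      then show ?case using Suc by (simp add: algebra_simps)
    qed simp
    from this[of "nodes m"] have "\<delta> \<le> real (nodes m) * (c0 * \<rho> (mesh L m))"
      by (simp add: s_def \<delta>_def)
    \<comment> \<open>Multiplication by the mesh width turns the number of steps into
      \<open>2 * L\<close>; estimating one of the two mesh factors by \<open>L\<close> then gives
      the constant \<open>2 * L\<^sup>2 * c0 / \<delta>\<close>.\<close>
    then have "mesh L m * \<delta> \<le> mesh L m * (real (nodes m) * (c0 * \<rho> (mesh L m)))"
      using h by (intro mult_left_mono) auto
    also have "\<dots> = 2 * L * (c0 * \<rho> (mesh L m))"
      using mesh_nodes[of m L] by (simp only: mult.assoc[symmetric] mult.commute[of "mesh L m"])
    finally have "mesh L m * \<delta> \<le> 2 * L * (c0 * \<rho> (mesh L m))" .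
    then have "L * (mesh L m * \<delta>) \<le> L * (2 * L * (c0 * \<rho> (mesh L m)))" using L by (intro mult_left_mono) auto
    moreover have "(mesh L m)\<^sup>2 * \<delta> \<le> L * mesh L m * \<delta>"
      unfolding power2_eq_square using h \<delta> by (intro mult_right_mono) auto
    ultimately have "(mesh L m)\<^sup>2 * \<delta> \<le> 2 * L\<^sup>2 * c0 * \<rho> (mesh L m)"
      by (simp add: power2_eq_square mult_ac)
    then show ?thesis using \<delta> by (simp add: field_simps)
  qed
  then show ?thesis using L c0 \<delta> by (intro exI[of _ "2 * L\<^sup>2 * c0 / \<delta>"]) auto
qed

text \<open>Compactness gives extrema on the fundamental interval and periodicity makes them global.
  They supply the bounds \<open>a0\<close>, \<open>a1\<close>, \<open>b1\<close> common to all
  levels.\<close>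

lemma periodic_bounds:
  fixes \<phi> :: "real \<Rightarrow> real"
  assumes L: "0 < L" and per: "\<And>x. \<phi> (x + 2 * L) = \<phi> x" and cont: "uniformly_continuous_on {-L..L} \<phi>"
  obtains x y where "x \<in> {-L..L}" "y \<in> {-L..L}" "\<And>z. \<phi> x \<le> \<phi> z" "\<And>z. \<phi> z \<le> \<phi> y"
proof -
  have c: "continuous_on {-L..L} \<phi>" by (rule uniformly_continuous_imp_continuous[OF cont])
  have ne: "{-L..L} \<noteq> {}" using L by simp
  obtain x where x: "x \<in> {-L..L}" "\<forall>z\<in>{-L..L}. \<phi> x \<le> \<phi> z"
    using continuous_attains_inf[OF compact_Icc ne c] by blast
  obtain y where y: "y \<in> {-L..L}" "\<forall>z\<in>{-L..L}. \<phi> z \<le> \<phi> y"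
    using continuous_attains_sup[OF compact_Icc ne c] by blast
  have "\<exists>z'\<in>{-L..L}. \<phi> z = \<phi> z'" for z
  proof -
    obtain i where i: "z - 2 * L * real_of_int i \<in> {-L..L}" by (rule circle_representative[OF L])
    then show ?thesis
      using periodic_shift[of \<phi> L "z - 2 * L * real_of_int i" i, OF per] by (intro bexI[OF _ i]) simp
  qed
  then show ?thesis using that[OF x(1) y(1)] x(2) y(2) by metis
qed

lemma quotient_modulus:
  fixes a a' u u' :: real
  assumes a0: "0 < a0" and a: "a0 \<le> a" "a0 \<le> a'" and u: "\<bar>u'\<bar> \<le> B"
    and du: "\<bar>u - u'\<bar> \<le> D" and da: "\<bar>a - a'\<bar> \<le> D"
  shows "\<bar>u / a - u' / a'\<bar> \<le> (1 / a0 + B / a0\<^sup>2) * D"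
proof -
  have pos: "0 < a" "0 < a'" using a0 a by linarith+
  have nn: "0 \<le> D" "0 \<le> B" using da u by linarith+
  have "u / a - u' / a' = (u - u') / a + u' * (a' - a) / (a * a')" using pos by (simp add: field_simps)
  then have "\<bar>u / a - u' / a'\<bar> \<le> \<bar>(u - u') / a\<bar> + \<bar>u' * (a' - a) / (a * a')\<bar>"
    using abs_triangle_ineq[of "(u - u') / a" "u' * (a' - a) / (a * a')"] by simp
  also have "\<dots> = \<bar>u - u'\<bar> / a + \<bar>u'\<bar> * \<bar>a - a'\<bar> / (a * a')"
    using pos by (simp add: abs_mult abs_minus_commute)
  also have "\<dots> \<le> D / a0 + B * D / (a0 * a0)"
    using a0 a u du da nn pos by (intro add_mono frac_le mult_mono mult_pos_pos mult_nonneg_nonneg) auto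
  finally show ?thesis by (simp add: power2_eq_square algebra_simps)
qed

section \<open>Uniform constants and the two estimates\<close>

theorem theorem2:
  fixes L c0 t :: real
    and \<sigma> \<mu> \<rho> :: "real \<Rightarrow> real"
    and u :: "nat \<Rightarrow> real \<Rightarrow> real \<Rightarrow> real \<Rightarrow> real"
  assumes L_pos: "0 < L"
    and \<sigma>_periodic: "\<And>x. \<sigma> (x + 2 * L) = \<sigma> x"
    and \<mu>_periodic: "\<And>x. \<mu> (x + 2 * L) = \<mu> x"
    and \<sigma>_pos: "\<And>x. x \<in> {-L..L} \<Longrightarrow> 0 < \<sigma> x"
    and \<sigma>2_uniformly_continuous: "uniformly_continuous_on {-L..L} (\<lambda>x. (\<sigma> x)\<^sup>2)"
    and \<mu>_uniformly_continuous: "uniformly_continuous_on {-L..L} \<mu>"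
    and \<rho>_mono: "mono_on {0..} \<rho>"
    and \<rho>_lim: "(\<rho> \<longlongrightarrow> 0) (at_right 0)"
    and c0_pos: "0 < c0"
    and \<sigma>2_modulus: "\<And>x y. x \<in> {-L..L} \<Longrightarrow> y \<in> {-L..L} \<Longrightarrow>
      \<bar>(\<sigma> x)\<^sup>2 - (\<sigma> y)\<^sup>2\<bar> \<le> c0 * \<rho> (circle_dist L x y)"
    and \<mu>_modulus: "\<And>x y. x \<in> {-L..L} \<Longrightarrow> y \<in> {-L..L} \<Longrightarrow>
      \<bar>\<mu> x - \<mu> y\<bar> \<le> c0 * \<rho> (circle_dist L x y)"
    and constant_case:
      "(\<lambda>x. (\<sigma> x)\<^sup>2) constant_on {-L..L} \<Longrightarrow> \<mu> constant_on {-L..L} \<Longrightarrow>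
        \<exists>c1>0. \<forall>m\<ge>min_level L \<sigma> \<mu>. (mesh L m)\<^sup>2 \<le> c1 * \<rho> (mesh L m)"
    and t_pos: "0 < t"
    and u_kernel: "\<And>m. is_kernel L \<sigma> \<mu> m (u m)"
  shows "\<exists>c>0. \<forall>m m'. min_level L \<sigma> \<mu> \<le> m \<and> m \<le> m' \<longrightarrow>
    (\<forall>x\<in>grid L m. \<forall>y\<in>grid L m.
      \<bar>u m x y t - u m' x y t\<bar> \<le> c * \<rho> (mesh L m) \<and>
      \<bar>deriv (\<lambda>s. u m x y s) t - deriv (\<lambda>s. u m' x y s) t\<bar> =
        \<bar>gen_adj L \<sigma> \<mu> m (\<lambda>z. u m x z t) y - gen_adj L \<sigma> \<mu> m' (\<lambda>z. u m' x z t) y\<bar> \<and>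
      \<bar>gen_adj L \<sigma> \<mu> m (\<lambda>z. u m x z t) y - gen_adj L \<sigma> \<mu> m' (\<lambda>z. u m' x z t) y\<bar> =
        \<bar>gen L \<sigma> \<mu> m (\<lambda>z. u m z y t) x - gen L \<sigma> \<mu> m' (\<lambda>z. u m' z y t) x\<bar> \<and>
      \<bar>gen L \<sigma> \<mu> m (\<lambda>z. u m z y t) x - gen L \<sigma> \<mu> m' (\<lambda>z. u m' z y t) x\<bar> \<le> c * \<rho> (mesh L m))"
proof -
  define f where "f = (\<lambda>x. (\<sigma> x)\<^sup>2)"
  have f_per: "f (x + 2 * L) = f x" for x by (simp add: f_def \<sigma>_periodic)
  obtain x0 x1 where x0: "x0 \<in> {-L..L}" "x1 \<in> {-L..L}" "\<And>z. f x0 \<le> f z" "\<And>z. f z \<le> f x1"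
    by (rule periodic_bounds[of L f, OF L_pos f_per \<sigma>2_uniformly_continuous[folded f_def]]) (rule that)
  obtain z0 z1 where z: "z0 \<in> {-L..L}" "z1 \<in> {-L..L}" "\<And>z. \<mu> z0 \<le> \<mu> z" "\<And>z. \<mu> z \<le> \<mu> z1"
    by (rule periodic_bounds[of L \<mu>, OF L_pos \<mu>_periodic \<mu>_uniformly_continuous]) (rule that)
  define a0 a1 B where "a0 = f x0 / 2" and "a1 = f x1 / 2" and "B = \<bar>\<mu> z0\<bar> + \<bar>\<mu> z1\<bar>"
  define b1 where "b1 = B / a0"
  have a0: "0 < a0" using \<sigma>_pos[OF x0(1)] by (simp add: a0_def f_def)
  have lower: "a0 \<le> (\<sigma> x)\<^sup>2 / 2" and upper: "(\<sigma> x)\<^sup>2 / 2 \<le> a1" for x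
    using x0(3,4)[of x] by (simp_all add: a0_def a1_def f_def)
  have B: "\<bar>\<mu> x\<bar> \<le> B" for x using z(3)[of x] z(4)[of x] by (simp add: B_def)
  have drift: "\<bar>\<mu> x / ((\<sigma> x)\<^sup>2 / 2)\<bar> \<le> b1" for x
  proof -
    have "\<bar>\<mu> x\<bar> / ((\<sigma> x)\<^sup>2 / 2) \<le> B / a0" using lower[of x] B[of x] a0 by (intro frac_le) auto
    moreover have "\<bar>\<mu> x / ((\<sigma> x)\<^sup>2 / 2)\<bar> = \<bar>\<mu> x\<bar> / ((\<sigma> x)\<^sup>2 / 2)" by (simp add: abs_divide abs_mult)
    ultimately show ?thesis by (simp add: b1_def)
  qed
  have level: "kernel_level L \<sigma> \<mu> a0 a1 b1 m (u m)" for m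
    by unfold_locales (use L_pos \<sigma>_periodic \<mu>_periodic a0 lower upper drift u_kernel in auto)
  have f_mod: "\<bar>f x - f y\<bar> \<le> c0 * \<rho> d" if "\<bar>x - y\<bar> \<le> d" for x y d
    by (rule circle_modulus[of L f, OF L_pos f_per \<rho>_mono c0_pos _ that]) (use \<sigma>2_modulus in \<open>simp add: f_def\<close>)
  have \<mu>_mod: "\<bar>\<mu> x - \<mu> y\<bar> \<le> c0 * \<rho> d" if "\<bar>x - y\<bar> \<le> d" for x y d
    by (rule circle_modulus[of L \<mu>, OF L_pos \<mu>_periodic \<rho>_mono c0_pos \<mu>_modulus that])
  \<comment> \<open>Equal points in the modulus inequality show that \<open>\<rho>\<close> is
    nonnegative at every mesh width.\<close>
  have \<rho>_nonneg: "0 \<le> \<rho> (mesh L m)" for m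
    using f_mod[of 0 0 "mesh L m"] mesh_pos[OF L_pos, of m] c0_pos by (simp add: zero_le_mult_iff)
  \<comment> \<open>The square of the mesh width has to be dominated by \<open>\<rho>\<close>. For
    two constant coefficients the modulus inequality puts no positive lower bound on
    \<open>\<rho>\<close>, and \<open>constant_case\<close> supplies the estimate; otherwise a
    nonconstant coefficient does.\<close>
  obtain c1 where c1: "0 < c1" "\<And>m. min_level L \<sigma> \<mu> \<le> m \<Longrightarrow> (mesh L m)\<^sup>2 \<le> c1 * \<rho> (mesh L m)"
  proof (cases "f constant_on {-L..L} \<and> \<mu> constant_on {-L..L}")
    case True
    then show ?thesis using constant_case that unfolding f_def by blast
  next
    case False
    then show ?thesis
      using mesh_sq_le_modulus[of L c0 f \<rho>, OF L_pos c0_pos f_mod]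
        mesh_sq_le_modulus[of L c0 \<mu> \<rho>, OF L_pos c0_pos \<mu>_mod] that by blast
  qed
  define c2 where "c2 = (1 / a0 + (1 + B) / a0\<^sup>2) * c0"
  \<comment> \<open>The absolute value and the summand \<open>1\<close> make \<open>c\<close>
    positive whatever the sign of \<open>kernel_const\<close>.\<close>
  define c where "c = \<bar>kernel_const L a0 a1 b1 t\<bar> * (c2 + c1) + 1"
  have B0: "0 \<le> B" by (simp add: B_def)
  have c2: "0 \<le> c2" using a0 B0 c0_pos by (simp add: c2_def)
  have "0 < c" using c1 c2 by (simp add: c_def add_nonneg_pos)
  moreover have "\<bar>u m x y t - u m' x y t\<bar> \<le> c * \<rho> (mesh L m) \<and>
      \<bar>deriv (\<lambda>s. u m x y s) t - deriv (\<lambda>s. u m' x y s) t\<bar> =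
        \<bar>gen_adj L \<sigma> \<mu> m (\<lambda>z. u m x z t) y - gen_adj L \<sigma> \<mu> m' (\<lambda>z. u m' x z t) y\<bar> \<and>
      \<bar>gen_adj L \<sigma> \<mu> m (\<lambda>z. u m x z t) y - gen_adj L \<sigma> \<mu> m' (\<lambda>z. u m' x z t) y\<bar> =
        \<bar>gen L \<sigma> \<mu> m (\<lambda>z. u m z y t) x - gen L \<sigma> \<mu> m' (\<lambda>z. u m' z y t) x\<bar> \<and>
      \<bar>gen L \<sigma> \<mu> m (\<lambda>z. u m z y t) x - gen L \<sigma> \<mu> m' (\<lambda>z. u m' z y t) x\<bar> \<le> c * \<rho> (mesh L m)"
    if m: "min_level L \<sigma> \<mu> \<le> m" and le: "m \<le> m'" and x: "x \<in> grid L m" and y: "y \<in> grid L m" for m m' x y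
  proof -
    define \<omega> where "\<omega> = c2 * \<rho> (mesh L m)"
    have a_diff: "\<bar>(\<sigma> x)\<^sup>2 / 2 - (\<sigma> y)\<^sup>2 / 2\<bar> \<le> c0 * \<rho> (mesh L m)" if "\<bar>x - y\<bar> \<le> mesh L m" for x y
      using f_mod[OF that] by (simp add: f_def)
    \<comment> \<open>The bound \<open>1 + B\<close> covers both numerators in use, the constant
      \<open>1\<close> and the drift.\<close>
    have quot: "\<bar>w / ((\<sigma> x)\<^sup>2 / 2) - w' / ((\<sigma> y)\<^sup>2 / 2)\<bar> \<le> \<omega>"
      if "\<bar>x - y\<bar> \<le> mesh L m" "\<bar>w'\<bar> \<le> 1 + B" "\<bar>w - w'\<bar> \<le> c0 * \<rho> (mesh L m)" for x y w w'
      using quotient_modulus[OF a0 lower lower that(2,3) a_diff[OF that(1)]] by (simp add: \<omega>_def c2_def)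
    have a_mod: "\<bar>1 / ((\<sigma> x)\<^sup>2 / 2) - 1 / ((\<sigma> y)\<^sup>2 / 2)\<bar> \<le> \<omega>" if "\<bar>x - y\<bar> \<le> mesh L m" for x y
      using B0 c0_pos \<rho>_nonneg by (intro quot that) auto
    have b_mod: "\<bar>\<mu> x / ((\<sigma> x)\<^sup>2 / 2) - \<mu> y / ((\<sigma> y)\<^sup>2 / 2)\<bar> \<le> \<omega>" if "\<bar>x - y\<bar> \<le> mesh L m" for x y
      using B[of y] by (intro quot that \<mu>_mod) auto
    have "kernel_const L a0 a1 b1 t * (\<omega> + (mesh L m)\<^sup>2) \<le> \<bar>kernel_const L a0 a1 b1 t\<bar> * ((c2
        + c1) * \<rho> (mesh L m))"
    proof (rule mult_mono)
      show "\<omega> + (mesh L m)\<^sup>2 \<le> (c2 + c1) * \<rho> (mesh L m)"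
        using c1(2)[OF m] by (simp add: \<omega>_def distrib_right)
      show "0 \<le> \<omega> + (mesh L m)\<^sup>2" using c2 \<rho>_nonneg by (simp add: \<omega>_def)
    qed auto
    also have "\<dots> \<le> c * \<rho> (mesh L m)" using \<rho>_nonneg[of m] by (simp add: c_def algebra_simps)
    finally have const: "kernel_const L a0 a1 b1 t * (\<omega> + (mesh L m)\<^sup>2) \<le> c * \<rho> (mesh L m)" .
    obtain k l where k: "x = real_of_int k * mesh L m" and l: "y = real_of_int l * mesh L m"
      using x y unfolding grid_def Defs.lattice_def by blast
    define M :: nat where "M = 2 ^ (m' - m)"
    have node: "real_of_int (i * int M) * mesh L m' = real_of_int i * mesh L m" for i
      using fine_mesh[OF le, of L] by (simp add: M_def)
    have adj: "gen_adj L \<sigma> \<mu> m (\<lambda>z. u m x z t) y = gen L \<sigma> \<mu> m (\<lambda>z. u m z y t) x"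
      unfolding k l by (rule kernel_level.gen_adj_eq_gen[OF level t_pos])
    have adj': "gen_adj L \<sigma> \<mu> m' (\<lambda>z. u m' x z t) y = gen L \<sigma> \<mu> m' (\<lambda>z. u m' z y t) x"
      using kernel_level.gen_adj_eq_gen[OF level t_pos, of m' "k * int M" "l * int M"] unfolding node k l .
    have x': "x \<in> grid L m'" and y': "y \<in> grid L m'"
    proof -
      have "real_of_int i * mesh L m \<in> Defs.lattice L m'" for i
        unfolding node[symmetric] Defs.lattice_def by (rule rangeI)
      then show "x \<in> grid L m'" "y \<in> grid L m'" using x y unfolding grid_def k l by auto
    qed
    have d: "deriv (\<lambda>s. u m x y s) t = gen_adj L \<sigma> \<mu> m (\<lambda>z. u m x z t) y"
      "deriv (\<lambda>s. u m' x y s) t = gen_adj L \<sigma> \<mu> m' (\<lambda>z. u m' x z t) y"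
      using u_kernel[of m] u_kernel[of m'] x y x' y' t_pos unfolding is_kernel_def
          by (blast intro: DERIV_imp_deriv)+
    show ?thesis
      using kernel_comparison[OF level level le t_pos a_mod b_mod x y] const
      unfolding d adj adj' by linarith
  qed
  ultimately show ?thesis by blast
qed

end
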